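(* Let $T\in(0,\infty)$, and let $\alpha\in(0,1)$ and $p,q\in(1,\infty)$ satisfy $$d<p<\frac1\alpha,\qquad p<q\le p(\alpha p+1).$$ Then, for $\psi\in\mathbb H_{p,0}^{\alpha,1}((0,T)\times B_1)$, we have $$\|\psi\|_{L_q((0,T)\times B_1)}\le N\Big(\sum_{0\le|\beta|\le1}\|D_x^\beta\psi\|_{L_p((0,T)\times B_1)}\Big)^{1-\theta}\|\partial_t^\alpha\psi\|_{L_p((0,T)\times B_1)}^{\theta},$$ where $N=N(d,\alpha,p,q)$ is independent of $T$, and $$\theta=\frac1\alpha\Big(\frac1p-\frac1q\Big)\in(0,1).$$ If $d<p\le 1/\alpha$, then the same estimate holds for $q$ satisfying $$1\le q<p(\alpha p+1),$$ with $N$ depending also on $T$.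
   Context: $B_1$ is the open unit ball of $\mathbb R^d$ centered at the origin; $\beta$ is a multi-index in the spatial variables. $N=N(\cdots)$ is a constant depending only on the listed quantities. For $\mathcal D\subset\mathbb R^k$ (not necessarily open), $\varphi\in C_0^\infty(\mathcal D)$ means that $\varphi$ is infinitely differentiable in $\mathcal D$ and is supported in the intersection of $\mathcal D$ and a bounded open set; in particular $\varphi$ need not vanish on the boundary of $\mathcal D$ unless $\mathcal D$ is open, so that functions in $C_0^\infty([0,T)\times\Omega)$ need not vanish at $t=0$. $I_0^{1-\alpha}u(t,x)=\frac1{\Gamma(1-\alpha)}\int_0^t(t-s)^{-\alpha}u(s,x)\,ds$. For a domain $\Omega\subset\mathbb R^d$, $\mathbb H_p^{\alpha,1}((0,T)\times\Omega)$ is the set of $u\in L_p((0,T)\times\Omega)$ with $D_xu\in L_p((0,T)\times\Omega)$ and for which there is $g\in L_p((0,T)\times\Omega)$, denoted $\partial_tI_0^{1-\alpha}u$, such that $\int_0^T\!\int_\Omega g\varphi\,dx\,dt=-\int_0^T\!\int_\Omega I_0^{1-\alpha}u\,\partial_t\varphi\,dx\,dt$ for all $\varphi\in C_0^\infty([0,T)\times\Omega)$. Its norm is $\|\partial_tI_0^{1-\alpha}u\|_{L_p}+\sum_{0\le|\beta|\le1}\|D_x^\beta u\|_{L_p}$, with $L_p=L_p((0,T)\times\Omega)$. $\mathbb H_{p,0}^{\alpha,1}((0,T)\times\Omega)$ is the set of $u\in\mathbb H_p^{\alpha,1}((0,T)\times\Omega)$ that are limits in this norm of functions $u_n\in C^\infty([0,T]\times\Omega)$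 which vanish for large $|x|$ and satisfy $u_n(0,x)=0$. For such $u$, $\partial_t^\alpha u=\partial_tI_0^{1-\alpha}u$.
   Formalization: In the second assertion, for q ≤ p the estimate is stated with every θ in [0,1) instead of θ = (1/α)(1/p − 1/q), which is negative for q < p and makes the inequality false (take ψ = sin(nt) with n → ∞); for q > p the formula for θ is unchanged. *)

theory Defs
  imports "HOL-Analysis.Analysis"
begin

text \<open>Functions on space-time are represented as total functions of type
  \<open>real \<times> 'a \<Rightarrow> real\<close>, time being the first component; the values outside the set under
  consideration are irrelevant.\<close>

definition Lp_space :: "real \<Rightarrow> 'b::euclidean_space set \<Rightarrow> ('b \<Rightarrow> real) set" where
  "Lp_space p D =
     {f. f \<in> borel_measurable (lebesgue_on D) \<and> integrable (lebesgue_on D) (\<lambda>z. \<bar>f z\<bar> powr p)}"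

text \<open>Because the Bochner integral of a non-integrable function is \<open>0\<close>, the following is the
  \<open>L\<^sub>p\<close> norm only for members of \<open>Lp_space p D\<close>.\<close>

definition Lp_norm :: "real \<Rightarrow> 'b::euclidean_space set \<Rightarrow> ('b \<Rightarrow> real) \<Rightarrow> real" where
  "Lp_norm p D f = (\<integral>z. \<bar>f z\<bar> powr p \<partial>lebesgue_on D) powr (1 / p)"

primrec Ck_on :: "nat \<Rightarrow> 'b::euclidean_space set \<Rightarrow> ('b \<Rightarrow> real) \<Rightarrow> bool" where
  "Ck_on 0 U f \<longleftrightarrow> continuous_on U f"
| "Ck_on (Suc k) U f \<longleftrightarrow>
     (\<forall>z\<in>U. f differentiable (at z)) \<and> (\<forall>v. Ck_on k U (\<lambda>z. frechet_derivative f (at z) v))"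

text \<open>On a set that is not open, smoothness means the existence of a smooth extension to an open
  neighbourhood. For \<open>[0,T) \<times> \<Omega>\<close> and \<open>[0,T] \<times> \<Omega>\<close> with \<open>\<Omega>\<close> open, this is smoothness up to
  the time boundary.\<close>

definition smooth_on :: "'b::euclidean_space set \<Rightarrow> ('b \<Rightarrow> real) \<Rightarrow> bool" where
  "smooth_on D f \<longleftrightarrow> (\<exists>U h. open U \<and> D \<subseteq> U \<and> (\<forall>k. Ck_on k U h) \<and> (\<forall>z\<in>D. h z = f z))"

text \<open>The class \<open>C\<^sub>0\<^sup>\<infinity>(D)\<close>: the support is bounded and contained in \<open>D\<close>, where it may meet
  \<open>frontier D\<close> if \<open>D\<close> is not open.\<close>

definition test_funs :: "'b::euclidean_space set \<Rightarrow> ('b \<Rightarrow> real) set" where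
  "test_funs D =
     {\<phi>. smooth_on D \<phi> \<and> bounded {z\<in>D. \<phi> z \<noteq> 0} \<and> closure {z\<in>D. \<phi> z \<noteq> 0} \<subseteq> D}"

definition cyl :: "real \<Rightarrow> 'a set \<Rightarrow> (real \<times> 'a) set" where
  "cyl T \<Omega> = {0<..<T} \<times> \<Omega>"

definition frac_int :: "real \<Rightarrow> (real \<times> 'a \<Rightarrow> real) \<Rightarrow> real \<times> 'a \<Rightarrow> real" where
  "frac_int \<gamma> u = (\<lambda>(t, x).
     1 / Gamma \<gamma> * (\<integral>s. (t - s) powr (\<gamma> - 1) * u (s, x) \<partial>lebesgue_on {0..t}))"

definition is_weak_dx ::
  "real \<Rightarrow> real \<Rightarrow> 'a::euclidean_space set \<Rightarrow> 'a \<Rightarrow> (real \<times> 'a \<Rightarrow> real) \<Rightarrow> (real \<times> 'a \<Rightarrow> real) \<Rightarrow> bool"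
  where
  "is_weak_dx p T \<Omega> b u v \<longleftrightarrow> v \<in> Lp_space p (cyl T \<Omega>) \<and>
     (\<forall>\<phi>\<in>test_funs (cyl T \<Omega>).
        (\<integral>z. v z * \<phi> z \<partial>lebesgue_on (cyl T \<Omega>)) =
        - (\<integral>z. u z * frechet_derivative \<phi> (at z) (0, b) \<partial>lebesgue_on (cyl T \<Omega>)))"

definition weak_dx ::
  "real \<Rightarrow> real \<Rightarrow> 'a::euclidean_space set \<Rightarrow> 'a \<Rightarrow> (real \<times> 'a \<Rightarrow> real) \<Rightarrow> real \<times> 'a \<Rightarrow> real" where
  "weak_dx p T \<Omega> b u = (SOME v. is_weak_dx p T \<Omega> b u v)"

text \<open>The test functions need not vanish at \<open>t = 0\<close>, so \<open>g\<close> being \<open>\<partial>\<^sub>t I\<^sub>0\<^bsup>1-\<alpha>\<^esup> u\<close> in the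
  following sense contains the initial condition \<open>I\<^sub>0\<^bsup>1-\<alpha>\<^esup> u = 0\<close> at \<open>t = 0\<close>.\<close>

definition is_frac_dt ::
  "real \<Rightarrow> real \<Rightarrow> real \<Rightarrow> 'a::euclidean_space set \<Rightarrow> (real \<times> 'a \<Rightarrow> real) \<Rightarrow> (real \<times> 'a \<Rightarrow> real) \<Rightarrow> bool"
  where
  "is_frac_dt \<alpha> p T \<Omega> u g \<longleftrightarrow> g \<in> Lp_space p (cyl T \<Omega>) \<and>
     (\<forall>\<phi>\<in>test_funs ({0..<T} \<times> \<Omega>).
        (\<integral>z. g z * \<phi> z \<partial>lebesgue_on (cyl T \<Omega>)) =
        - (\<integral>z. frac_int (1 - \<alpha>) u z * frechet_derivative \<phi> (at z) (1, 0) \<partial>lebesgue_on (cyl T \<Omega>)))"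

definition frac_dt ::
  "real \<Rightarrow> real \<Rightarrow> real \<Rightarrow> 'a::euclidean_space set \<Rightarrow> (real \<times> 'a \<Rightarrow> real) \<Rightarrow> real \<times> 'a \<Rightarrow> real" where
  "frac_dt \<alpha> p T \<Omega> u = (SOME g. is_frac_dt \<alpha> p T \<Omega> u g)"

text \<open>The derivatives chosen by \<open>SOME\<close> are determined up to null sets, hence the norms below
  do not depend on the choice.\<close>

definition H_space :: "real \<Rightarrow> real \<Rightarrow> real \<Rightarrow> 'a::euclidean_space set \<Rightarrow> (real \<times> 'a \<Rightarrow> real) set" where
  "H_space \<alpha> p T \<Omega> =
     {u \<in> Lp_space p (cyl T \<Omega>).
        (\<forall>b\<in>Basis. \<exists>v. is_weak_dx p T \<Omega> b u v) \<and> (\<exists>g. is_frac_dt \<alpha> p T \<Omega> u g)}"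

text \<open>The sum of \<open>\<parallel>D\<^sub>x\<^sup>\<beta> u\<parallel>\<close> over the multi-indices with \<open>\<bar>\<beta>\<bar> \<le> 1\<close>; those of order one
  correspond to the elements of \<^const>\<open>Basis\<close>.\<close>

definition W1_norm :: "real \<Rightarrow> real \<Rightarrow> 'a::euclidean_space set \<Rightarrow> (real \<times> 'a \<Rightarrow> real) \<Rightarrow> real" where
  "W1_norm p T \<Omega> u =
     Lp_norm p (cyl T \<Omega>) u + (\<Sum>b\<in>Basis. Lp_norm p (cyl T \<Omega>) (weak_dx p T \<Omega> b u))"

definition H_norm :: "real \<Rightarrow> real \<Rightarrow> real \<Rightarrow> 'a::euclidean_space set \<Rightarrow> (real \<times> 'a \<Rightarrow> real) \<Rightarrow> real" where
  "H_norm \<alpha> p T \<Omega> u = Lp_norm p (cyl T \<Omega>) (frac_dt \<alpha> p T \<Omega> u) + W1_norm p T \<Omega> u"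

definition H0_space :: "real \<Rightarrow> real \<Rightarrow> real \<Rightarrow> 'a::euclidean_space set \<Rightarrow> (real \<times> 'a \<Rightarrow> real) set" where
  "H0_space \<alpha> p T \<Omega> =
     {u \<in> H_space \<alpha> p T \<Omega>. \<exists>w :: nat \<Rightarrow> real \<times> 'a \<Rightarrow> real.
        (\<forall>n. w n \<in> H_space \<alpha> p T \<Omega> \<and>
             smooth_on ({0..T} \<times> \<Omega>) (w n) \<and>
             (\<exists>R. \<forall>t\<in>{0..T}. \<forall>x\<in>\<Omega>. norm x \<ge> R \<longrightarrow> w n (t, x) = 0) \<and>
             (\<forall>x\<in>\<Omega>. w n (0, x) = 0)) \<and>
        (\<lambda>n. H_norm \<alpha> p T \<Omega> (\<lambda>z. u z - w n z)) \<longlonglongrightarrow> 0}"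

end

theory Submission
  imports Defs
begin

text \<open>Write \<open>W\<close> for the first-order Sobolev norm of \<open>\<psi>\<close> in space, \<open>g\<close> for \<open>\<partial>\<^sub>t\<^sup>\<alpha> \<psi>\<close>, and for a
point \<open>x\<close> of the ball put \<open>U(x) = \<integral> \<bar>\<psi>(t,x)\<bar>\<^sup>p dt\<close> and \<open>Q(x) = \<integral> \<bar>g(t,x)\<bar>\<^sup>p dt\<close>.
The estimate is a one-dimensional inequality in time, applied for almost every \<open>x\<close> and then
integrated over the ball.

In time, \<open>\<psi>(\<sqdot>,x)\<close> is the Riemann-Liouville integral of \<open>g(\<sqdot>,x)\<close>, the convolution
with \<open>r\<^sup>\<alpha>\<^sup>-\<^sup>1/\<Gamma>(\<alpha>)\<close> (\<open>frac_dt_inverse\<close>). Hence \<open>\<psi>\<close> differs from its average over the preceding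
interval of length \<open>h\<close> by at most the convolution of \<open>\<bar>g\<bar>\<close> with a kernel that decays like \<open>h r\<^sup>\<alpha>\<^sup>-\<^sup>2\<close>.
Young's inequality bounds the average and the difference, and the choice of \<open>h\<close> that balances the two gives
\<open>\<integral> \<bar>\<psi>(t,x)\<bar>\<^sup>q dt \<le> C U(x)\<^sup>a Q(x)\<^sup>b\<close> with \<open>a = (1-\<theta>)q/p\<close> and \<open>b = \<theta>q/p\<close>, where
the homogeneity in \<open>h\<close> produces the exponent \<open>\<theta> = (1/p - 1/q)/\<alpha>\<close>
(\<open>time_gagliardo_nirenberg\<close>). The condition \<open>\<theta> < 1\<close> puts the kernel of the difference into the
\<open>L\<^sub>s\<close> space that Young's inequality asks for.

In space, \<open>p > d\<close> gives \<open>sup\<^sub>x \<bar>\<psi>(t,x)\<bar>\<^sup>p \<le> C (\<integral> \<bar>\<psi>\<bar>\<^sup>p + \<integral> \<bar>D\<psi>\<bar>\<^sup>p)\<close> for every \<open>t\<close>.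
After integration in \<open>t\<close> this says that \<open>U(x) \<le> C W\<^sup>p\<close> for almost every \<open>x\<close>
(\<open>sup_time_Lp_bound\<close>). It is a pointwise statement about smooth functions and is transported to
\<open>\<psi>\<close> by the smooth approximations that define the space, whose classical and weak derivatives agree.

So \<open>\<integral>\<integral> \<bar>\<psi>\<bar>\<^sup>q \<le> C W\<^sup>p\<^sup>a \<integral> Q(x)\<^sup>b dx\<close>. The condition \<open>q \<le> p(\<alpha>p+1)\<close> is equivalent to \<open>b \<le> 1\<close>, and
then Jensen's inequality bounds the last integral by \<open>C (\<integral> Q)\<^sup>b\<close>, where \<open>\<integral> Q\<close> is the \<open>p\<close>-th power of
the norm of \<open>g\<close> (\<open>interpolation_estimate\<close>). Nothing in this depends on \<open>T\<close>. For \<open>q \<le> p\<close> the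
estimate is softer: on a bounded time interval the kernel is integrable, so the \<open>L\<^sub>p\<close> norm of
\<open>\<psi>\<close> is bounded both by \<open>W\<close> and by \<open>C\<^sub>T\<close> times the norm of \<open>g\<close>
(\<open>subcritical_estimate\<close>).\<close>

section \<open>Young's convolution inequality on the line\<close>

text \<open>The tangent line bound for the logarithm at the weighted arithmetic mean replaces convexity here, which also
covers weights equal to \<open>0\<close>.\<close>

lemma weighted_am_gm3:
  fixes a b c :: real
  assumes "a \<ge> 0" "b \<ge> 0" "c \<ge> 0" "l \<ge> 0" "m \<ge> 0" "n \<ge> 0" "l + m + n = 1"
  shows "a powr l * b powr m * c powr n \<le> l * a + m * b + n * c"
proof (cases "a = 0 \<or> b = 0 \<or> c = 0")
  case True
  then have "a powr l * b powr m * c powr n = 0" by auto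
  moreover have "0 \<le> l * a + m * b + n * c" using assms by simp
  ultimately show ?thesis by linarith
next
  case False
  then have pos: "a > 0" "b > 0" "c > 0" using assms by auto
  define S where "S = l * a + m * b + n * c"
  have "S > 0"
  proof -
    have "l > 0 \<or> m > 0 \<or> n > 0" using assms by linarith
    moreover have "0 \<le> l * a" "0 \<le> m * b" "0 \<le> n * c" using assms by simp_all
    ultimately show ?thesis unfolding S_def using pos
      by (smt (verit) mult_pos_pos)
  qed
  have *: "ln x \<le> ln S + (x / S - 1)" if "x > 0" for x
    using ln_le_minus_one[of "x / S"] that \<open>S > 0\<close> by (simp add: ln_div)
  have "l * ln a + m * ln b + n * ln c
      \<le> l * (ln S + (a / S - 1)) + m * (ln S + (b / S - 1)) + n * (ln S + (c / S - 1))"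
    using assms pos * by (intro add_mono mult_left_mono) auto
  also have "\<dots> = (l + m + n) * ln S + (l * a + m * b + n * c) / S - (l + m + n)"
    by (simp add: algebra_simps add_divide_distrib)
  also have "\<dots> = ln S" using assms \<open>S > 0\<close> by (simp add: S_def)
  finally have "exp (l * ln a + m * ln b + n * ln c) \<le> S"
    using \<open>S > 0\<close> by (simp add: ln_ge_iff)
  then show ?thesis using pos by (simp add: powr_def exp_add S_def)
qed

text \<open>Hoelder's inequality for the factorisation
\<open>K F = (K\<^sup>s F\<^sup>p)\<^sup>1\<^sup>/\<^sup>q (F\<^sup>p)\<^sup>1\<^sup>/\<^sup>p\<^sup>-\<^sup>1\<^sup>/\<^sup>q (K\<^sup>s)\<^sup>1\<^sup>/\<^sup>s\<^sup>-\<^sup>1\<^sup>/\<^sup>q\<close>, whose three exponents add up to \<open>1\<close>. It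
follows by integrating the weighted inequality of the means for the three factors normalised to mass \<open>1\<close>. With
\<open>s = 1\<close> and \<open>q = p\<close> it is Jensen's inequality with weight \<open>K\<close>.\<close>

lemma nn_integral_mult_three_exponents:
  fixes K F :: "'b \<Rightarrow> real"
  assumes [measurable]: "K \<in> borel_measurable M" "F \<in> borel_measurable M"
    and nonneg: "\<And>x. K x \<ge> 0" "\<And>x. F x \<ge> 0"
    and exps: "1 \<le> p" "p \<le> q" "1 \<le> s" "1 / s = 1 + 1 / q - 1 / p"
    and pos: "0 < A" "0 < B" "0 \<le> D"
    and intK: "(\<integral>\<^sup>+x. ennreal (K x powr s) \<partial>M) \<le> ennreal A"
    and intF: "(\<integral>\<^sup>+x. ennreal (F x powr p) \<partial>M) \<le> ennreal B"
    and intKF: "(\<integral>\<^sup>+x. ennreal (K x powr s * F x powr p) \<partial>M) \<le> ennreal D"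
  shows "(\<integral>\<^sup>+x. ennreal (K x * F x) \<partial>M)
     \<le> ennreal (A powr (1/s - 1/q) * B powr (1/p - 1/q) * D powr (1/q))"
proof (cases "D = 0")
  case True
  then have "(\<integral>\<^sup>+x. ennreal (K x powr s * F x powr p) \<partial>M) = 0" using intKF by simp
  then have "AE x in M. ennreal (K x powr s * F x powr p) = 0"
    by (subst (asm) nn_integral_0_iff_AE) auto
  then have "AE x in M. ennreal (K x * F x) = 0"
    by eventually_elim (auto simp: ennreal_eq_0_iff zero_less_mult_iff mult_le_0_iff)
  then have "(\<integral>\<^sup>+x. ennreal (K x * F x) \<partial>M) = 0"
    by (subst nn_integral_0_iff_AE) auto
  then show ?thesis by simp
next
  case False
  with pos have D: "D > 0" by simp
  have q: "q \<ge> 1" using exps by simp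
  have e1: "1/p - 1/q \<ge> 0" using exps by (simp add: frac_le)
  have e2: "1/s - 1/q \<ge> 0"
  proof -
    have "1 / p \<le> 1" using exps by simp
    then show ?thesis using exps(4) by linarith
  qed
  have e3: "1/q + (1/p - 1/q) + (1/s - 1/q) = 1" using exps by simp
  define c where "c = A powr (1/s - 1/q) * B powr (1/p - 1/q) * D powr (1/q)"
  have c: "c > 0" using pos D by (simp add: c_def)
  have pt: "K x * F x \<le> c * (1/q / D) * (K x powr s * F x powr p) + c * ((1/p - 1/q) / B) * F x powr p
      + c * ((1/s - 1/q) / A) * K x powr s" for x
  proof (cases "K x = 0 \<or> F x = 0")
    case True
    have "0 \<le> c * (1/q / D) * (K x powr s * F x powr p) + c * ((1/p - 1/q) / B) * F x powr p
      + c * ((1/s - 1/q) / A) * K x powr s"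
      using c e1 e2 q pos by (intro add_nonneg_nonneg mult_nonneg_nonneg) auto
    then show ?thesis using True by auto
  next
    case False
    then have KF: "K x > 0" "F x > 0" using nonneg[of x] by auto
    let ?a = "K x powr s * F x powr p / D" and ?b = "F x powr p / B" and ?c = "K x powr s / A"
    have "?a powr (1/q) * ?b powr (1/p - 1/q) * ?c powr (1/s - 1/q)
      \<le> 1/q * ?a + (1/p - 1/q) * ?b + (1/s - 1/q) * ?c"
      using pos q e1 e2 e3 D by (intro weighted_am_gm3) auto
    moreover have "?a powr (1/q) * ?b powr (1/p - 1/q) * ?c powr (1/s - 1/q) = K x * F x / c"
    proof -
      have ex: "s * (1/q) + s * (1/s - 1/q) = 1" "p * (1/q) + p * (1/p - 1/q) = 1"
        using exps(1-3) by (simp_all add: right_diff_distrib)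
      have "?a powr (1/q) * ?b powr (1/p - 1/q) * ?c powr (1/s - 1/q)
         = (K x powr (s * (1/q)) * K x powr (s * (1/s - 1/q))) *
           (F x powr (p * (1/q)) * F x powr (p * (1/p - 1/q))) / c"
        using KF pos D by (simp only: c_def powr_divide powr_mult powr_powr powr_ge_zero
            zero_le_mult_iff less_imp_le) (simp add: field_simps)
      also have "\<dots> = K x * F x / c"
        using KF by (simp only: powr_add[symmetric] ex powr_one less_imp_le)
      finally show ?thesis .
    qed
    ultimately have "K x * F x / c \<le> 1/q * ?a + (1/p - 1/q) * ?b + (1/s - 1/q) * ?c" by simp
    then have "K x * F x \<le> c * (1/q * ?a + (1/p - 1/q) * ?b + (1/s - 1/q) * ?c)"
      using c by (simp add: pos_divide_le_eq mult.commute)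
    also have "\<dots> = c * (1/q / D) * (K x powr s * F x powr p) + c * ((1/p - 1/q) / B) * F x powr p
      + c * ((1/s - 1/q) / A) * K x powr s"
      by (simp add: distrib_left)
    finally show ?thesis .
  qed
  have "(\<integral>\<^sup>+x. ennreal (K x * F x) \<partial>M) \<le>
     (\<integral>\<^sup>+x. ennreal (c * (1/q / D)) * ennreal (K x powr s * F x powr p) +
          ennreal (c * ((1/p - 1/q) / B)) * ennreal (F x powr p)
      + ennreal (c * ((1/s - 1/q) / A)) * ennreal (K x powr s) \<partial>M)"
  proof (rule nn_integral_mono)
    fix x
    show "ennreal (K x * F x) \<le> ennreal (c * (1/q / D)) * ennreal (K x powr s * F x powr p) +
          ennreal (c * ((1/p - 1/q) / B)) * ennreal (F x powr p)
      + ennreal (c * ((1/s - 1/q) / A)) * ennreal (K x powr s)"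
      using pt[of x] c e1 e2 q pos
      by (simp add: ennreal_mult'[symmetric] ennreal_plus[symmetric] ennreal_leI del: ennreal_plus)
  qed
  also have "\<dots> = ennreal (c * (1/q / D)) * (\<integral>\<^sup>+x. ennreal (K x powr s * F x powr p) \<partial>M) +
          ennreal (c * ((1/p - 1/q) / B)) * (\<integral>\<^sup>+x. ennreal (F x powr p) \<partial>M)
      + ennreal (c * ((1/s - 1/q) / A)) * (\<integral>\<^sup>+x. ennreal (K x powr s) \<partial>M)"
    by (simp add: nn_integral_add nn_integral_cmult)
  also have "\<dots> \<le> ennreal (c * (1/q / D)) * ennreal D +
          ennreal (c * ((1/p - 1/q) / B)) * ennreal B
      + ennreal (c * ((1/s - 1/q) / A)) * ennreal A"
    by (intro add_mono mult_left_mono intK intF intKF) auto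
  also have "\<dots> = ennreal (c * (1/q / D) * D + c * ((1/p - 1/q) / B) * B + c * ((1/s - 1/q) / A) * A)"
    using c e1 e2 q pos by (simp add: ennreal_mult'[symmetric] ennreal_plus[symmetric] del: ennreal_plus)
  also have "c * (1/q / D) * D + c * ((1/p - 1/q) / B) * B + c * ((1/s - 1/q) / A) * A
     = c * (1/q + (1/p - 1/q) + (1/s - 1/q))"
    using D pos by (simp add: field_simps)
  finally show ?thesis using e3 by (simp add: c_def)
qed

lemma nn_integral_lborel_minus:
  fixes f :: "real \<Rightarrow> ennreal"
  assumes [measurable]: "f \<in> borel_measurable borel"
  shows "(\<integral>\<^sup>+t. f (t - r) \<partial>lborel) = (\<integral>\<^sup>+t. f t \<partial>lborel)"
  using nn_integral_real_affine[OF assms, of 1 "- r"] by (simp add: add.commute)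

lemma nn_integral_lborel_reflect:
  fixes f :: "real \<Rightarrow> ennreal"
  assumes [measurable]: "f \<in> borel_measurable borel"
  shows "(\<integral>\<^sup>+t. f (r - t) \<partial>lborel) = (\<integral>\<^sup>+t. f t \<partial>lborel)"
  using nn_integral_real_affine[OF assms, of "-1" "r"] by (simp add: add.commute)

text \<open>The pointwise bound above leaves \<open>(K\<^sup>s * F\<^sup>p)\<^sup>1\<^sup>/\<^sup>q\<close>, whose \<open>q\<close>-th power has integral
\<open>\<integral> K\<^sup>s \<integral> F\<^sup>p\<close> by Tonelli. The convolution may be infinite on a null set, where the default value
\<open>enn2real \<infinity> = 0\<close> is harmless because of the first conclusion.\<close>

lemma Young_convolution:
  fixes K F :: "real \<Rightarrow> real"
  assumes [measurable]: "K \<in> borel_measurable borel" "F \<in> borel_measurable borel"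
    and nonneg: "\<And>x. K x \<ge> 0" "\<And>x. F x \<ge> 0"
    and exps: "1 \<le> p" "p \<le> q" "1 \<le> s" "1 / s = 1 + 1 / q - 1 / p"
    and pos: "0 < A" "0 < B"
    and intK: "(\<integral>\<^sup>+x. ennreal (K x powr s) \<partial>lborel) \<le> ennreal A"
    and intF: "(\<integral>\<^sup>+x. ennreal (F x powr p) \<partial>lborel) \<le> ennreal B"
  shows "AE t in lborel. (\<integral>\<^sup>+r. ennreal (K r * F (t - r)) \<partial>lborel) < \<infinity>" (is ?fin)
    and "(\<integral>\<^sup>+t. ennreal (enn2real (\<integral>\<^sup>+r. ennreal (K r * F (t - r)) \<partial>lborel) powr q) \<partial>lborel)
      \<le> ennreal (A powr (q / s) * B powr (q / p))" (is ?bound)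
proof -
  define D where "D t = (\<integral>\<^sup>+r. ennreal (K r powr s * F (t - r) powr p) \<partial>lborel)" for t
  have [measurable]: "D \<in> borel_measurable borel"
    unfolding D_def by measurable
  have "(\<integral>\<^sup>+t. D t \<partial>lborel) =
      (\<integral>\<^sup>+r. (\<integral>\<^sup>+t. ennreal (K r powr s * F (t - r) powr p) \<partial>lborel) \<partial>lborel)"
    unfolding D_def by (rule lborel_pair.Fubini') measurable
  also have "\<dots> = (\<integral>\<^sup>+r. ennreal (K r powr s) * (\<integral>\<^sup>+t. ennreal (F t powr p) \<partial>lborel) \<partial>lborel)"
  proof (rule nn_integral_cong)
    fix r
    have "(\<integral>\<^sup>+t. ennreal (K r powr s * F (t - r) powr p) \<partial>lborel)
      = (\<integral>\<^sup>+t. ennreal (K r powr s) * ennreal (F (t - r) powr p) \<partial>lborel)"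
      by (simp add: ennreal_mult')
    also have "\<dots> = ennreal (K r powr s) * (\<integral>\<^sup>+t. ennreal (F (t - r) powr p) \<partial>lborel)"
      by (subst nn_integral_cmult) auto
    also have "(\<integral>\<^sup>+t. ennreal (F (t - r) powr p) \<partial>lborel) = (\<integral>\<^sup>+t. ennreal (F t powr p) \<partial>lborel)"
      by (rule nn_integral_lborel_minus[where f = "\<lambda>t. ennreal (F t powr p)"]) measurable
    finally show "(\<integral>\<^sup>+t. ennreal (K r powr s * F (t - r) powr p) \<partial>lborel)
      = ennreal (K r powr s) * (\<integral>\<^sup>+t. ennreal (F t powr p) \<partial>lborel)" .
  qed
  also have "\<dots> = (\<integral>\<^sup>+r. ennreal (K r powr s) \<partial>lborel) * (\<integral>\<^sup>+t. ennreal (F t powr p) \<partial>lborel)"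
    by (rule nn_integral_multc) measurable
  also have "\<dots> \<le> ennreal A * ennreal B" by (intro mult_mono intK intF) auto
  finally have intD: "(\<integral>\<^sup>+t. D t \<partial>lborel) \<le> ennreal (A * B)" using pos by (simp add: ennreal_mult')
  then have "(\<integral>\<^sup>+t. D t \<partial>lborel) \<noteq> \<infinity>" by (auto simp: top_unique)
  then have finD: "AE t in lborel. D t \<noteq> \<infinity>" by (intro nn_integral_noteq_infinite) auto
  define c where "c = A powr (1/s - 1/q) * B powr (1/p - 1/q)"
  have est: "(\<integral>\<^sup>+r. ennreal (K r * F (t - r)) \<partial>lborel) \<le> ennreal (c * enn2real (D t) powr (1/q))"
    if "D t \<noteq> \<infinity>" for t
    unfolding c_def
  proof (rule nn_integral_mult_three_exponents[where p = p and s = s])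
    show "(\<integral>\<^sup>+x. ennreal (F (t - x) powr p) \<partial>lborel) \<le> ennreal B"
      using intF by (subst nn_integral_lborel_reflect[where f = "\<lambda>t. ennreal (F t powr p)"]) auto
    show "(\<integral>\<^sup>+x. ennreal (K x powr s * F (t - x) powr p) \<partial>lborel) \<le> ennreal (enn2real (D t))"
      using that unfolding D_def by (simp add: less_top)
  qed (use nonneg exps pos intK in auto)
  show ?fin
    using finD by eventually_elim (use est in \<open>fastforce intro: le_less_trans\<close>)
  have "q \<ge> 1" using exps by simp
  have "(\<integral>\<^sup>+t. ennreal (enn2real (\<integral>\<^sup>+r. ennreal (K r * F (t - r)) \<partial>lborel) powr q) \<partial>lborel)
     \<le> (\<integral>\<^sup>+t. ennreal (c powr q) * D t \<partial>lborel)"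
  proof (rule nn_integral_mono_AE, use finD in eventually_elim)
    case (elim t)
    have c: "c \<ge> 0" by (simp add: c_def)
    have "enn2real (\<integral>\<^sup>+r. ennreal (K r * F (t - r)) \<partial>lborel) \<le> c * enn2real (D t) powr (1/q)"
      using est[OF elim] c by (intro enn2real_leI) auto
    then have "enn2real (\<integral>\<^sup>+r. ennreal (K r * F (t - r)) \<partial>lborel) powr q
        \<le> (c * enn2real (D t) powr (1/q)) powr q"
      using \<open>q \<ge> 1\<close> by (intro powr_mono2) auto
    also have "\<dots> = c powr q * enn2real (D t)"
      using \<open>q \<ge> 1\<close> c by (simp add: powr_mult powr_powr)
    finally have "ennreal (enn2real (\<integral>\<^sup>+r. ennreal (K r * F (t - r)) \<partial>lborel) powr q)
       \<le> ennreal (c powr q * enn2real (D t))" by (rule ennreal_leI)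
    also have "\<dots> = ennreal (c powr q) * D t" using elim by (simp add: ennreal_mult' less_top)
    finally show ?case .
  qed
  also have "\<dots> = ennreal (c powr q) * (\<integral>\<^sup>+t. D t \<partial>lborel)"
    by (rule nn_integral_cmult) measurable
  also have "\<dots> \<le> ennreal (c powr q) * ennreal (A * B)" by (intro mult_left_mono intD) auto
  also have "\<dots> = ennreal (c powr q * (A * B))" by (simp add: ennreal_mult')
  also have "c powr q * (A * B) = A powr (q / s) * B powr (q / p)"
  proof -
    have "c powr q = A powr (q / s - 1) * B powr (q / p - 1)"
      using \<open>q \<ge> 1\<close> unfolding c_def
      by (simp add: powr_mult powr_powr left_diff_distrib)
    then show ?thesis using pos by (simp add: powr_diff)
  qed
  finally show ?bound .
qed

section \<open>The Riemann-Liouville kernel and its averages\<close>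

definition rl_kernel :: "real \<Rightarrow> real \<Rightarrow> real" where
  "rl_kernel \<alpha> r = indicator {0<..} r * r powr (\<alpha> - 1) / Gamma \<alpha>"

lemma rl_kernel_measurable [measurable]: "rl_kernel \<alpha> \<in> borel_measurable borel"
  unfolding rl_kernel_def by measurable

lemma rl_kernel_nonneg: "0 < \<alpha> \<Longrightarrow> 0 \<le> rl_kernel \<alpha> r"
  by (simp add: rl_kernel_def Gamma_real_nonneg)

lemma rl_kernel_pos: "0 < r \<Longrightarrow> rl_kernel \<alpha> r = r powr (\<alpha> - 1) / Gamma \<alpha>"
  by (simp add: rl_kernel_def)

lemma rl_kernel_nonpos: "r \<le> 0 \<Longrightarrow> rl_kernel \<alpha> r = 0"
  by (simp add: rl_kernel_def)

lemma ennreal_mult_add: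
  "0 \<le> u \<Longrightarrow> 0 \<le> x \<Longrightarrow> 0 \<le> v \<Longrightarrow> 0 \<le> y \<Longrightarrow> ennreal u * ennreal x + ennreal v * ennreal y = ennreal (u * x + v * y)"
  by (simp add: ennreal_mult)

lemma nn_integral_powr_from_0:
  fixes a c :: real
  assumes "-1 < a" "0 \<le> c"
  shows "(\<integral>\<^sup>+x. ennreal (indicator {0<..<c} x * x powr a) \<partial>lborel) = ennreal (c powr (a + 1) / (a + 1))"
proof -
  have "(\<integral>\<^sup>+x. ennreal (indicator {0<..<c} x * x powr a) \<partial>lborel)
    = (\<integral>\<^sup>+x\<in>{0..c}. ennreal (x powr a) \<partial>lborel)"
  proof (rule nn_integral_cong_AE, use AE_lborel_singleton[of 0] AE_lborel_singleton[of c] in eventually_elim)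
    case (elim x)
    then show ?case by (auto simp: indicator_def)
  qed
  also have "\<dots> = ennreal (c powr (a + 1) / (a + 1))"
    by (rule nn_integral_has_integral_lebesgue'[OF _ has_integral_powr_from_0])
       (use assms in \<open>auto\<close>)
  finally show ?thesis .
qed

lemma nn_integral_powr_to_inf:
  fixes a c :: real
  assumes "a < -1" "0 < c"
  shows "(\<integral>\<^sup>+x. ennreal (indicator {c..} x * x powr a) \<partial>lborel) = ennreal (c powr (a + 1) / - (a + 1))"
proof -
  have "(\<integral>\<^sup>+x. ennreal (indicator {c..} x * x powr a) \<partial>lborel)
    = (\<integral>\<^sup>+x\<in>{c..}. ennreal (x powr a) \<partial>lborel)"
    by (intro nn_integral_cong) (auto simp: indicator_def)
  also have "\<dots> = ennreal (-(c powr (a + 1)) / (a + 1))"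
    by (rule nn_integral_has_integral_lebesgue'[OF _ has_integral_powr_to_inf])
       (use assms in \<open>auto\<close>)
  finally show ?thesis by (metis minus_divide_divide minus_minus minus_divide_right)
qed

text \<open>This is comparable to \<open>r\<^sup>\<alpha>\<^sup>-\<^sup>1 min(1, h/r)\<close>. It has the singularity of the kernel at \<open>0\<close>, but the
faster decay of its derivative at infinity, so that it lies in \<open>L\<^sub>s\<close> on the whole half-line for
\<open>1 \<le> s < 1/(1-\<alpha>)\<close>.\<close>

definition kernel_majorant :: "real \<Rightarrow> real \<Rightarrow> real \<Rightarrow> real" where
  "kernel_majorant \<alpha> h r = (4 + 2 / \<alpha>) / Gamma \<alpha> *
     (if 0 < r \<and> r < 2 * h then r powr (\<alpha> - 1) else if 2 * h \<le> r then h * r powr (\<alpha> - 2) else 0)"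

lemma kernel_majorant_measurable [measurable]: "kernel_majorant \<alpha> h \<in> borel_measurable borel"
  unfolding kernel_majorant_def by measurable

lemma kernel_majorant_nonneg: "0 < \<alpha> \<Longrightarrow> 0 \<le> h \<Longrightarrow> 0 \<le> kernel_majorant \<alpha> h r"
  unfolding kernel_majorant_def by (simp add: Gamma_real_nonneg)

lemma powr_shift_diff:
  fixes \<alpha> r s h :: real
  assumes "\<alpha> < 1" "0 < \<alpha>" "0 < s" "s < h" "2 * h \<le> r"
  shows "\<bar>r powr (\<alpha> - 1) - (r - s) powr (\<alpha> - 1)\<bar> \<le> 4 * h * r powr (\<alpha> - 2)"
proof -
  have r: "0 < r" "0 < r - s" "r / 2 \<le> r - s" using assms by auto
  have "\<exists>z::real. z > r - s \<and> z < r \<and> r powr (\<alpha> - 1) - (r - s) powr (\<alpha> - 1)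
      = (r - (r - s)) * ((\<alpha> - 1) * z powr (\<alpha> - 2))"
    using r assms by (intro MVT2) (auto intro!: derivative_eq_intros)
  then obtain z where z: "z > r - s" "z < r"
    and eq: "r powr (\<alpha> - 1) - (r - s) powr (\<alpha> - 1) = s * ((\<alpha> - 1) * z powr (\<alpha> - 2))" by auto
  have "\<bar>r powr (\<alpha> - 1) - (r - s) powr (\<alpha> - 1)\<bar> = s * (1 - \<alpha>) * z powr (\<alpha> - 2)"
    unfolding eq using assms by (simp add: abs_mult)
  also have "\<dots> \<le> h * 1 * (4 * r powr (\<alpha> - 2))"
  proof (intro mult_mono)
    have "z powr (\<alpha> - 2) \<le> (r / 2) powr (\<alpha> - 2)"
      using z r assms by (intro powr_mono2') auto
    also have "\<dots> = r powr (\<alpha> - 2) * 2 powr (2 - \<alpha>)"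
      using r by (simp add: powr_divide powr_minus powr_diff field_simps)
    also have "\<dots> \<le> r powr (\<alpha> - 2) * 2 powr 2"
      using assms by (intro mult_left_mono powr_mono) auto
    finally show "z powr (\<alpha> - 2) \<le> 4 * r powr (\<alpha> - 2)" by simp
  qed (use assms in auto)
  finally show ?thesis by simp
qed

text \<open>For \<open>r < 2h\<close> the two kernels are estimated separately, for \<open>r \<ge> 2h\<close> their difference by the mean value theorem.\<close>

lemma kernel_average_le_majorant:
  assumes "0 < \<alpha>" "\<alpha> < 1" "0 < h"
  shows "(\<integral>\<^sup>+s. ennreal (indicator {0<..<h} s / h * \<bar>rl_kernel \<alpha> r - rl_kernel \<alpha> (r - s)\<bar>) \<partial>lborel)
     \<le> ennreal (kernel_majorant \<alpha> h r)"
proof -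
  have G: "Gamma \<alpha> > 0" using assms by (simp add: Gamma_real_pos)
  consider "r \<le> 0" | "0 < r" "r < 2 * h" | "2 * h \<le> r" by linarith
  then show ?thesis
  proof cases
    case 1
    then have "ennreal (indicator {0<..<h} s / h * \<bar>rl_kernel \<alpha> r - rl_kernel \<alpha> (r - s)\<bar>) = 0" for s
      by (cases "s \<in> {0<..<h}") (auto simp: rl_kernel_nonpos)
    then have "(\<integral>\<^sup>+s. ennreal (indicator {0<..<h} s / h * \<bar>rl_kernel \<alpha> r - rl_kernel \<alpha> (r - s)\<bar>) \<partial>lborel) = 0"
      by simp
    then show ?thesis by simp
  next
    case 2
    have "(\<integral>\<^sup>+s. ennreal (indicator {0<..<h} s / h * \<bar>rl_kernel \<alpha> r - rl_kernel \<alpha> (r - s)\<bar>) \<partial>lborel)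
      \<le> (\<integral>\<^sup>+s. ennreal (rl_kernel \<alpha> r / h) * indicator {0<..<h} s
            + ennreal (1 / (h * Gamma \<alpha>)) * ennreal (indicator {0<..<r} (r - s) * (r - s) powr (\<alpha> - 1)) \<partial>lborel)"
    proof (rule nn_integral_mono)
      fix s
      have "indicator {0<..<h} s / h * \<bar>rl_kernel \<alpha> r - rl_kernel \<alpha> (r - s)\<bar>
         \<le> rl_kernel \<alpha> r / h * indicator {0<..<h} s
            + 1 / (h * Gamma \<alpha>) * (indicator {0<..<r} (r - s) * (r - s) powr (\<alpha> - 1))"
      proof (cases "0 < s \<and> s < h")
        case True
        have "\<bar>rl_kernel \<alpha> r - rl_kernel \<alpha> (r - s)\<bar> \<le> rl_kernel \<alpha> r + rl_kernel \<alpha> (r - s)"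
          using rl_kernel_nonneg[OF assms(1), of r] rl_kernel_nonneg[OF assms(1), of "r - s"] by linarith
        then have "\<bar>rl_kernel \<alpha> r - rl_kernel \<alpha> (r - s)\<bar> / h \<le> (rl_kernel \<alpha> r + rl_kernel \<alpha> (r - s)) / h"
          using assms by (intro divide_right_mono) auto
        also have "\<dots> = rl_kernel \<alpha> r / h + rl_kernel \<alpha> (r - s) / h"
          by (rule add_divide_distrib)
        also have "rl_kernel \<alpha> (r - s) / h = 1 / (h * Gamma \<alpha>) * (indicator {0<..<r} (r - s) * (r - s) powr (\<alpha> - 1))"
          using True by (auto simp: rl_kernel_def indicator_def)
        finally show ?thesis using True by simp
      qed (use G assms in auto)
      then show "ennreal (indicator {0<..<h} s / h * \<bar>rl_kernel \<alpha> r - rl_kernel \<alpha> (r - s)\<bar>)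
         \<le> ennreal (rl_kernel \<alpha> r / h) * indicator {0<..<h} s
            + ennreal (1 / (h * Gamma \<alpha>)) * ennreal (indicator {0<..<r} (r - s) * (r - s) powr (\<alpha> - 1))"
        using G assms rl_kernel_nonneg[OF assms(1), of r]
        by (simp add: ennreal_indicator[symmetric] ennreal_mult'[symmetric] ennreal_plus[symmetric] ennreal_leI
             del: ennreal_plus)
    qed
    also have "\<dots> = ennreal (rl_kernel \<alpha> r / h) * emeasure lborel {0<..<h}
        + ennreal (1 / (h * Gamma \<alpha>)) * (\<integral>\<^sup>+s. ennreal (indicator {0<..<r} (r - s) * (r - s) powr (\<alpha> - 1)) \<partial>lborel)"
      by (subst nn_integral_add) (auto simp: nn_integral_cmult)
    also have "(\<integral>\<^sup>+s. ennreal (indicator {0<..<r} (r - s) * (r - s) powr (\<alpha> - 1)) \<partial>lborel)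
        = (\<integral>\<^sup>+s. ennreal (indicator {0<..<r} s * s powr (\<alpha> - 1)) \<partial>lborel)"
      by (rule nn_integral_lborel_reflect[where f = "\<lambda>s. ennreal (indicator {0<..<r} s * s powr (\<alpha> - 1))"]) measurable
    also have "\<dots> = ennreal (r powr \<alpha> / \<alpha>)"
      using nn_integral_powr_from_0[of "\<alpha> - 1" r] 2 assms by simp
    also have "ennreal (rl_kernel \<alpha> r / h) * emeasure lborel {0<..<h}
        + ennreal (1 / (h * Gamma \<alpha>)) * ennreal (r powr \<alpha> / \<alpha>)
        = ennreal (rl_kernel \<alpha> r + 1 / (h * Gamma \<alpha>) * (r powr \<alpha> / \<alpha>))"
    proof -
      define x y where "x = rl_kernel \<alpha> r" and "y = 1 / (h * Gamma \<alpha>)"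
      have xy: "x \<ge> 0" "y \<ge> 0" using G assms rl_kernel_nonneg[OF assms(1), of r] by (auto simp: x_def y_def)
      have "ennreal (x / h) * ennreal h + ennreal y * ennreal (r powr \<alpha> / \<alpha>) = ennreal (x + y * (r powr \<alpha> / \<alpha>))"
        using xy assms by (subst ennreal_plus) (auto simp flip: ennreal_mult)
      then show ?thesis using assms by (simp add: x_def[symmetric] y_def[symmetric])
    qed
    also have "\<dots> \<le> ennreal (kernel_majorant \<alpha> h r)"
    proof (rule ennreal_leI)
      have "r powr \<alpha> / h \<le> 2 * r powr (\<alpha> - 1)"
        using 2 assms by (simp add: powr_diff field_simps)
      then have "(r powr \<alpha> / h) / (\<alpha> * Gamma \<alpha>) \<le> (2 * r powr (\<alpha> - 1)) / (\<alpha> * Gamma \<alpha>)"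
        using G assms by (intro divide_right_mono) auto
      then have "rl_kernel \<alpha> r + 1 / (h * Gamma \<alpha>) * (r powr \<alpha> / \<alpha>)
          \<le> r powr (\<alpha> - 1) / Gamma \<alpha> + (2 * r powr (\<alpha> - 1)) / (\<alpha> * Gamma \<alpha>)"
        using 2 by (simp add: rl_kernel_pos mult_ac)
      also have "\<dots> = (1 + 2 / \<alpha>) / Gamma \<alpha> * r powr (\<alpha> - 1)"
        by (simp add: distrib_right add_divide_distrib)
      also have "\<dots> \<le> (4 + 2 / \<alpha>) / Gamma \<alpha> * r powr (\<alpha> - 1)"
        using G by (intro mult_right_mono divide_right_mono) auto
      finally show "rl_kernel \<alpha> r + 1 / (h * Gamma \<alpha>) * (r powr \<alpha> / \<alpha>) \<le> kernel_majorant \<alpha> h r"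
        using 2 by (simp add: kernel_majorant_def)
    qed
    finally show ?thesis .
  next
    case 3
    have "(\<integral>\<^sup>+s. ennreal (indicator {0<..<h} s / h * \<bar>rl_kernel \<alpha> r - rl_kernel \<alpha> (r - s)\<bar>) \<partial>lborel)
      \<le> (\<integral>\<^sup>+s. ennreal (4 * r powr (\<alpha> - 2) / Gamma \<alpha>) * indicator {0<..<h} s \<partial>lborel)"
    proof (rule nn_integral_mono)
      fix s
      have "indicator {0<..<h} s / h * \<bar>rl_kernel \<alpha> r - rl_kernel \<alpha> (r - s)\<bar>
         \<le> 4 * r powr (\<alpha> - 2) / Gamma \<alpha> * indicator {0<..<h} s"
      proof (cases "0 < s \<and> s < h")
        case True
        have "\<bar>rl_kernel \<alpha> r - rl_kernel \<alpha> (r - s)\<bar> = \<bar>r powr (\<alpha> - 1) - (r - s) powr (\<alpha> - 1)\<bar> / Gamma \<alpha>"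
          using True 3 G assms by (simp add: rl_kernel_pos diff_divide_distrib[symmetric])
        also have "\<dots> \<le> 4 * h * r powr (\<alpha> - 2) / Gamma \<alpha>"
          using powr_shift_diff[of \<alpha> s h r] True 3 assms G by (intro divide_right_mono) auto
        finally have "\<bar>rl_kernel \<alpha> r - rl_kernel \<alpha> (r - s)\<bar> / h \<le> (4 * h * r powr (\<alpha> - 2) / Gamma \<alpha>) / h"
          using assms by (intro divide_right_mono) auto
        then show ?thesis using True assms by simp
      qed (use G assms in auto)
      then show "ennreal (indicator {0<..<h} s / h * \<bar>rl_kernel \<alpha> r - rl_kernel \<alpha> (r - s)\<bar>)
         \<le> ennreal (4 * r powr (\<alpha> - 2) / Gamma \<alpha>) * indicator {0<..<h} s"
        using G by (simp add: ennreal_indicator[symmetric] ennreal_mult'[symmetric] ennreal_leI)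
    qed
    also have "\<dots> = ennreal (4 * r powr (\<alpha> - 2) / Gamma \<alpha>) * emeasure lborel {0<..<h}"
      by (simp add: nn_integral_cmult)
    also have "\<dots> = ennreal (4 / Gamma \<alpha> * (h * r powr (\<alpha> - 2)))"
      using G assms by (simp add: ennreal_mult'[symmetric] mult_ac)
    also have "\<dots> \<le> ennreal (kernel_majorant \<alpha> h r)"
    proof (rule ennreal_leI)
      have "4 / Gamma \<alpha> * (h * r powr (\<alpha> - 2)) \<le> (4 + 2 / \<alpha>) / Gamma \<alpha> * (h * r powr (\<alpha> - 2))"
        using G assms by (intro mult_right_mono divide_right_mono) auto
      then show "4 / Gamma \<alpha> * (h * r powr (\<alpha> - 2)) \<le> kernel_majorant \<alpha> h r"
        using 3 by (simp add: kernel_majorant_def)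
    qed
    finally show ?thesis .
  qed
qed

text \<open>The power of \<open>h\<close> is dictated by homogeneity: the majorant at \<open>h\<close> is \<open>h\<^sup>\<alpha>\<^sup>-\<^sup>1\<close> times the majorant at \<open>1\<close>,
dilated by \<open>h\<close>.\<close>

lemma kernel_majorant_Lp:
  assumes "0 < \<alpha>" "\<alpha> < 1" "1 \<le> s" "(1 - \<alpha>) * s < 1"
  obtains C where "C > 0"
    "\<And>h. h > 0 \<Longrightarrow> (\<integral>\<^sup>+r. ennreal (kernel_majorant \<alpha> h r powr s) \<partial>lborel) \<le> ennreal (C * h powr (1 - (1 - \<alpha>) * s))"
proof -
  define c where "c = (4 + 2 / \<alpha>) / Gamma \<alpha>"
  have c: "c > 0" using assms by (simp add: c_def Gamma_real_pos add_pos_pos)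
  define a where "a = (\<alpha> - 1) * s"
  define b where "b = (\<alpha> - 2) * s"
  have a: "a > -1" using assms by (simp add: a_def algebra_simps)
  have b: "b < -1"
  proof -
    have "(2 - \<alpha>) * s \<ge> (2 - \<alpha>) * 1" using assms by (intro mult_left_mono) auto
    then show ?thesis using assms by (simp add: b_def algebra_simps)
  qed
  have ab: "s + (b + 1) = a + 1" by (simp add: a_def b_def algebra_simps)
  define C where "C = c powr s * (2 powr (a + 1) / (a + 1)) + c powr s * (2 powr (b + 1) / - (b + 1))"
  have ab0: "a + 1 > 0" "- (b + 1) > 0" using a b by auto
  have "C > 0" unfolding C_def
    by (rule add_pos_pos; rule mult_pos_pos; (rule divide_pos_pos)?) (use ab0 c in auto)
  moreover have "(\<integral>\<^sup>+r. ennreal (kernel_majorant \<alpha> h r powr s) \<partial>lborel) \<le> ennreal (C * h powr (1 - (1 - \<alpha>) * s))"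
    if h: "h > 0" for h
  proof -
    have "ennreal (kernel_majorant \<alpha> h r powr s) =
        ennreal (c powr s) * ennreal (indicator {0<..<2*h} r * r powr a)
        + ennreal (c powr s * h powr s) * ennreal (indicator {2*h..} r * r powr b)" for r
    proof -
      consider "r \<le> 0" | "0 < r" "r < 2 * h" | "2 * h \<le> r" by linarith
      then show ?thesis
      proof cases
        case 1
        then show ?thesis using h by (simp add: kernel_majorant_def)
      next
        case 2
        then have "kernel_majorant \<alpha> h r powr s = c powr s * r powr a"
          using c by (simp add: kernel_majorant_def c_def[symmetric] powr_mult powr_powr a_def)
        then show ?thesis using 2 by (simp add: ennreal_mult')
      next
        case 3
        then have "kernel_majorant \<alpha> h r powr s = c powr s * h powr s * r powr b"
          using c h by (simp add: kernel_majorant_def c_def[symmetric] powr_mult powr_powr b_def)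
        moreover have "indicator {0<..<2*h} r = (0::real)" "indicator {2*h..} r = (1::real)"
          using 3 by auto
        ultimately show ?thesis by (simp only: ennreal_mult'[symmetric] powr_ge_zero mult_nonneg_nonneg) simp
      qed
    qed
    then have "(\<integral>\<^sup>+r. ennreal (kernel_majorant \<alpha> h r powr s) \<partial>lborel)
       = (\<integral>\<^sup>+r. ennreal (c powr s) * ennreal (indicator {0<..<2*h} r * r powr a)
        + ennreal (c powr s * h powr s) * ennreal (indicator {2*h..} r * r powr b) \<partial>lborel)" by simp
    also have "\<dots> = ennreal (c powr s) * ennreal ((2*h) powr (a+1) / (a+1))
        + ennreal (c powr s * h powr s) * ennreal ((2*h) powr (b+1) / -(b+1))"
      using h a b by (simp add: nn_integral_add nn_integral_cmult nn_integral_powr_from_0 nn_integral_powr_to_inf del: minus_add_distrib)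
    also have "\<dots> = ennreal (c powr s * ((2*h) powr (a+1) / (a+1)) + c powr s * h powr s * ((2*h) powr (b+1) / -(b+1)))"
      by (rule ennreal_mult_add; (rule divide_nonneg_pos)?) (use ab0 in auto)
    also have "c powr s * ((2*h) powr (a+1) / (a+1)) + c powr s * h powr s * ((2*h) powr (b+1) / -(b+1))
      = C * h powr (a + 1)"
    proof -
      have e1: "h powr s * (2*h) powr (b+1) = 2 powr (b+1) * h powr (a+1)"
        using h by (simp add: powr_mult ab[symmetric] powr_add mult_ac)
      have e2: "(2*h) powr (a+1) = 2 powr (a+1) * h powr (a+1)"
        using h by (simp add: powr_mult)
      have "c powr s * h powr s * ((2*h) powr (b+1) / -(b+1)) = c powr s * (h powr s * (2*h) powr (b+1)) / -(b+1)"
        by simp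
      also have "\<dots> = c powr s * (2 powr (b+1) / -(b+1)) * h powr (a+1)"
        unfolding e1 by simp
      finally have e3: "c powr s * h powr s * ((2*h) powr (b+1) / -(b+1)) = c powr s * (2 powr (b+1) / -(b+1)) * h powr (a+1)" .
      show ?thesis unfolding e3 e2 C_def distrib_right by simp
    qed
    finally show ?thesis by (simp add: a_def algebra_simps)
  qed
  ultimately show thesis by (rule that)
qed

section \<open>A Gagliardo-Nirenberg inequality in time\<close>

lemma powr_add_le:
  fixes x y q :: real
  assumes "0 \<le> x" "0 \<le> y" "0 \<le> q"
  shows "(x + y) powr q \<le> 2 powr q * (x powr q + y powr q)"
proof -
  have "(x + y) powr q \<le> (2 * max x y) powr q"
    using assms by (intro powr_mono2) auto
  also have "\<dots> = 2 powr q * max x y powr q"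
    using assms by (simp add: powr_mult)
  also have "max x y powr q \<le> x powr q + y powr q"
    by (auto simp: max_def)
  finally show ?thesis by simp
qed

text \<open>Up to time \<open>T\<close> the convolution only sees the kernel on \<open>(0,T)\<close>, where it has mass
\<open>T\<^sup>\<alpha>/(\<alpha> \<Gamma>(\<alpha>))\<close>, so Young's inequality with \<open>s = 1\<close> applies.\<close>

lemma rl_convolution_Lp:
  fixes f :: "real \<Rightarrow> real"
  assumes \<alpha>: "0 < \<alpha>" and p: "1 \<le> p" and T: "0 < T"
    and [measurable]: "f \<in> borel_measurable borel" and f0: "\<And>t. t \<notin> {0<..<T} \<Longrightarrow> f t = 0"
    and Q: "0 \<le> Q" and intf: "(\<integral>\<^sup>+t. ennreal (\<bar>f t\<bar> powr p) \<partial>lborel) \<le> ennreal Q"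
  shows "AE t in lborel. t < T \<longrightarrow> (\<integral>\<^sup>+r. ennreal (rl_kernel \<alpha> r * \<bar>f (t - r)\<bar>) \<partial>lborel) < \<infinity>"
    and "(\<integral>\<^sup>+t. ennreal (indicator {0<..<T} t * \<bar>\<integral>r. rl_kernel \<alpha> r * f (t - r) \<partial>lborel\<bar> powr p) \<partial>lborel)
      \<le> ennreal ((T powr \<alpha> / (\<alpha> * Gamma \<alpha>)) powr p * Q)"
proof -
  have G: "Gamma \<alpha> > 0" using \<alpha> by (simp add: Gamma_real_pos)
  define K where "K r = 1 / Gamma \<alpha> * (indicator {0<..<T} r * r powr (\<alpha> - 1))" for r
  define A where "A = T powr \<alpha> / (\<alpha> * Gamma \<alpha>)"
  have A: "A > 0" using \<alpha> G T by (simp add: A_def)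
  have K[measurable]: "K \<in> borel_measurable borel" unfolding K_def by measurable
  have K0: "K r \<ge> 0" for r using G by (simp add: K_def)
  have "(\<integral>\<^sup>+r. ennreal (K r powr 1) \<partial>lborel)
     = (\<integral>\<^sup>+r. ennreal (1 / Gamma \<alpha>) * ennreal (indicator {0<..<T} r * r powr (\<alpha> - 1)) \<partial>lborel)"
    using K0 G by (intro nn_integral_cong) (simp add: K_def ennreal_mult'[symmetric])
  also have "\<dots> = ennreal (1 / Gamma \<alpha>) * ennreal (T powr \<alpha> / \<alpha>)"
    using nn_integral_powr_from_0[of "\<alpha> - 1" T] \<alpha> T by (simp add: nn_integral_cmult)
  also have "\<dots> = ennreal A"
    using G by (simp add: A_def ennreal_mult'[symmetric] mult.commute)
  finally have intK: "(\<integral>\<^sup>+r. ennreal (K r powr 1) \<partial>lborel) \<le> ennreal A" by simp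
  have KF: "K r * \<bar>f (t - r)\<bar> = rl_kernel \<alpha> r * \<bar>f (t - r)\<bar>" if "t < T" for t r
  proof (cases "f (t - r) = 0")
    case False
    then have "t - r > 0" using f0[of "t - r"] by auto
    then show ?thesis using that by (auto simp: K_def rl_kernel_def indicator_def)
  qed auto
  define c where "c t = (\<integral>\<^sup>+r. ennreal (K r * \<bar>f (t - r)\<bar>) \<partial>lborel)" for t
  have Young: "AE t in lborel. c t < \<infinity>"
      "(\<integral>\<^sup>+t. ennreal (enn2real (c t) powr p) \<partial>lborel) \<le> ennreal (A powr p * B)"
    if "B > 0" "B \<ge> Q" for B
  proof -
    have "(\<integral>\<^sup>+t. ennreal (\<bar>f t\<bar> powr p) \<partial>lborel) \<le> ennreal B"
      using intf that by (meson dual_order.trans ennreal_leI)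
    from Young_convolution[where s = 1 and p = p and q = p and A = A and B = B, OF K _ K0 _ p _ _ _ A _ intK this]
    show "AE t in lborel. c t < \<infinity>"
      "(\<integral>\<^sup>+t. ennreal (enn2real (c t) powr p) \<partial>lborel) \<le> ennreal (A powr p * B)"
      using p that by (auto simp: c_def)
  qed
  have fin: "AE t in lborel. c t < \<infinity>" using Young(1)[of "Q + 1"] Q by simp
  then show "AE t in lborel. t < T \<longrightarrow> (\<integral>\<^sup>+r. ennreal (rl_kernel \<alpha> r * \<bar>f (t - r)\<bar>) \<partial>lborel) < \<infinity>"
  proof eventually_elim
    case (elim t)
    show ?case
    proof
      assume "t < T"
      then show "(\<integral>\<^sup>+r. ennreal (rl_kernel \<alpha> r * \<bar>f (t - r)\<bar>) \<partial>lborel) < \<infinity>"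
        using elim by (simp add: c_def KF)
    qed
  qed
  have "(\<integral>\<^sup>+t. ennreal (indicator {0<..<T} t * \<bar>\<integral>r. rl_kernel \<alpha> r * f (t - r) \<partial>lborel\<bar> powr p) \<partial>lborel)
     \<le> (\<integral>\<^sup>+t. ennreal (enn2real (c t) powr p) \<partial>lborel)"
  proof (rule nn_integral_mono_AE, use fin in eventually_elim)
    case (elim t)
    show ?case
    proof (cases "0 < t \<and> t < T")
      case True
      have "ennreal \<bar>\<integral>r. rl_kernel \<alpha> r * f (t - r) \<partial>lborel\<bar> \<le> c t"
      proof -
        have nn: "(\<integral>\<^sup>+r. ennreal (norm (rl_kernel \<alpha> r * f (t - r))) \<partial>lborel) = c t"
          unfolding c_def
        proof (rule nn_integral_cong)
          fix r
          have "norm (rl_kernel \<alpha> r * f (t - r)) = rl_kernel \<alpha> r * \<bar>f (t - r)\<bar>"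
            using \<alpha> by (simp add: abs_mult rl_kernel_nonneg)
          also have "\<dots> = K r * \<bar>f (t - r)\<bar>" using True by (intro KF[symmetric]) simp
          finally show "ennreal (norm (rl_kernel \<alpha> r * f (t - r))) = ennreal (K r * \<bar>f (t - r)\<bar>)"
            by (rule arg_cong)
        qed
        then have "integrable lborel (\<lambda>r. rl_kernel \<alpha> r * f (t - r))"
          using elim by (intro integrableI_bounded) auto
        from integral_norm_bound_ennreal[OF this] show ?thesis unfolding nn by simp
      qed
      then have "\<bar>\<integral>r. rl_kernel \<alpha> r * f (t - r) \<partial>lborel\<bar> \<le> enn2real (c t)"
        using elim by (metis abs_ge_zero enn2real_ennreal enn2real_mono infinity_ennreal_def)
      then show ?thesis using p True by (intro ennreal_leI) (auto intro!: powr_mono2)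
    qed auto
  qed
  also have "\<dots> \<le> ennreal (A powr p * Q)"
  proof (rule ennreal_le_epsilon)
    fix e :: real assume "e > 0"
    define B where "B = Q + e / A powr p"
    have "B > 0" "B \<ge> Q" using \<open>e > 0\<close> A Q by (auto simp: B_def add_nonneg_pos)
    have "A powr p * B = A powr p * Q + e" using A by (simp add: B_def distrib_left)
    then show "(\<integral>\<^sup>+t. ennreal (enn2real (c t) powr p) \<partial>lborel) \<le> ennreal (A powr p * Q) + ennreal e"
      using Young(2)[OF \<open>B > 0\<close> \<open>B \<ge> Q\<close>] Q \<open>e > 0\<close> by (simp add: ennreal_plus[symmetric] del: ennreal_plus)
  qed
  finally show "(\<integral>\<^sup>+t. ennreal (indicator {0<..<T} t * \<bar>\<integral>r. rl_kernel \<alpha> r * f (t - r) \<partial>lborel\<bar> powr p) \<partial>lborel)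
      \<le> ennreal ((T powr \<alpha> / (\<alpha> * Gamma \<alpha>)) powr p * Q)" unfolding A_def .
qed

text \<open>The identity \<open>u(t) - u(t-s) = \<integral> (k(r) - k(r-s)) f(t-r) dr\<close> is averaged over \<open>s \<in> (0,h)\<close>.
Taking absolute values first leaves only nonnegative integrands to interchange.\<close>

lemma rl_convolution_average_bound:
  fixes f u :: "real \<Rightarrow> real"
  assumes \<alpha>: "0 < \<alpha>" "\<alpha> < 1" and p: "1 \<le> p" and T: "0 < T" and h: "0 < h"
    and [measurable]: "f \<in> borel_measurable borel" and f0: "\<And>t. t \<notin> {0<..<T} \<Longrightarrow> f t = 0"
    and [measurable]: "u \<in> borel_measurable borel" and u0: "\<And>t. t \<notin> {0<..<T} \<Longrightarrow> u t = 0"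
    and u: "AE t in lborel. t \<in> {0<..<T} \<longrightarrow> u t = (\<integral>r. rl_kernel \<alpha> r * f (t - r) \<partial>lborel)"
    and intf: "(\<integral>\<^sup>+t. ennreal (\<bar>f t\<bar> powr p) \<partial>lborel) \<le> ennreal Q"
  shows "AE t in lborel. ennreal \<bar>u t\<bar> \<le> (\<integral>\<^sup>+s. ennreal (indicator {0<..<h} s / h * \<bar>u (t - s)\<bar>) \<partial>lborel)
       + (\<integral>\<^sup>+r. ennreal (kernel_majorant \<alpha> h r * \<bar>f (t - r)\<bar>) \<partial>lborel)"
proof -
  define v where "v t = (\<integral>r. rl_kernel \<alpha> r * f (t - r) \<partial>lborel)" for t
  have v[measurable]: "v \<in> borel_measurable borel" unfolding v_def by measurable
  define c where "c t = (\<integral>\<^sup>+r. ennreal (rl_kernel \<alpha> r * \<bar>f (t - r)\<bar>) \<partial>lborel)" for t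
  have c[measurable]: "c \<in> borel_measurable borel" unfolding c_def by measurable
  have k0: "rl_kernel \<alpha> r \<ge> 0" for r using \<alpha> by (simp add: rl_kernel_nonneg)
  define good where "good t \<longleftrightarrow> (t < T \<longrightarrow> c t < \<infinity>) \<and> (t < T \<longrightarrow> u t = v t)" for t
  have [measurable]: "Measurable.pred borel good" unfolding good_def by measurable
  have v0: "v t = 0" if "t \<le> 0" for t
  proof -
    have "rl_kernel \<alpha> r * f (t - r) = 0" for r
      using that f0[of "t - r"] by (cases "r \<le> 0") (auto simp: rl_kernel_nonpos)
    then show ?thesis unfolding v_def by (simp only:) simp
  qed
  have intf': "(\<integral>\<^sup>+t. ennreal (\<bar>f t\<bar> powr p) \<partial>lborel) \<le> ennreal (max Q 0)"
  proof -
    have "ennreal Q = ennreal (max Q 0)" by (cases "Q \<ge> 0") (auto simp: ennreal_neg)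
    then show ?thesis using intf by simp
  qed
  have "AE t in lborel. t < T \<longrightarrow> (\<integral>\<^sup>+r. ennreal (rl_kernel \<alpha> r * \<bar>f (t - r)\<bar>) \<partial>lborel) < \<infinity>"
    by (rule rl_convolution_Lp(1)[OF \<alpha>(1) p T _ f0 _ intf']) auto
  then have good: "AE t in lborel. good t"
    using u
  proof eventually_elim
    case (elim t)
    then show ?case using v0[of t] u0[of t]
      by (cases "t \<le> 0") (auto simp: good_def c_def v_def)
  qed
  have int: "integrable lborel (\<lambda>r. rl_kernel \<alpha> r * f (t - r))" if "c t < \<infinity>" for t
    using that k0 by (intro integrableI_bounded) (auto simp: abs_mult c_def)
  show ?thesis
    using good
  proof eventually_elim
    case (elim t)
    show ?case
    proof (cases "0 < t \<and> t < T")
      case False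
      then show ?thesis using u0[of t] by auto
    next
      case True
      have good': "AE s in lborel. good (t - s)"
        using AE_borel_affine[of "-1" good t] good by simp
      have pt: "ennreal \<bar>u t\<bar> \<le> ennreal \<bar>u (t - s)\<bar>
          + (\<integral>\<^sup>+r. ennreal (\<bar>rl_kernel \<alpha> r - rl_kernel \<alpha> (r - s)\<bar> * \<bar>f (t - r)\<bar>) \<partial>lborel)"
        if s: "good (t - s)" "0 < s" for s
      proof -
        have i1: "integrable lborel (\<lambda>r. rl_kernel \<alpha> r * f (t - r))"
          using int elim True by (auto simp: good_def)
        have "integrable lborel (\<lambda>r. rl_kernel \<alpha> r * f ((t - s) - r))"
          using int s True by (auto simp: good_def)
        from lborel_integrable_real_affine[OF this, of 1 "- s"]
        have i2: "integrable lborel (\<lambda>r. rl_kernel \<alpha> (r - s) * f (t - r))" by simp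
        have "v (t - s) = (\<integral>r. rl_kernel \<alpha> (r - s) * f (t - r) \<partial>lborel)"
          unfolding v_def by (subst lborel_integral_real_affine[of 1 _ "- s"]) auto
        then have eq: "u t - u (t - s) = (\<integral>r. rl_kernel \<alpha> r * f (t - r) - rl_kernel \<alpha> (r - s) * f (t - r) \<partial>lborel)"
          using elim s True i1 i2 by (simp add: good_def v_def)
        have "ennreal \<bar>u t - u (t - s)\<bar>
            \<le> (\<integral>\<^sup>+r. norm (rl_kernel \<alpha> r * f (t - r) - rl_kernel \<alpha> (r - s) * f (t - r)) \<partial>lborel)"
          using integral_norm_bound_ennreal[OF Bochner_Integration.integrable_diff[OF i1 i2]] unfolding eq by simp
        also have "\<dots> = (\<integral>\<^sup>+r. ennreal (\<bar>rl_kernel \<alpha> r - rl_kernel \<alpha> (r - s)\<bar> * \<bar>f (t - r)\<bar>) \<partial>lborel)"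
          by (rule nn_integral_cong) (metis abs_mult left_diff_distrib real_norm_def)
        finally have *: "ennreal \<bar>u t - u (t - s)\<bar> \<le> \<dots>" .
        have "ennreal \<bar>u t\<bar> \<le> ennreal (\<bar>u (t - s)\<bar> + \<bar>u t - u (t - s)\<bar>)"
          by (intro ennreal_leI) linarith
        also have "\<dots> = ennreal \<bar>u (t - s)\<bar> + ennreal \<bar>u t - u (t - s)\<bar>" by simp
        finally show ?thesis using * by (meson add_left_mono order_trans)
      qed
      define w where "w s = indicator {0<..<h} s / h" for s :: real
      have w[measurable]: "w \<in> borel_measurable borel" unfolding w_def by measurable
      have w0: "w s \<ge> 0" for s using h by (simp add: w_def)
      have "(\<integral>\<^sup>+s. ennreal (w s) \<partial>lborel) = (\<integral>\<^sup>+s. ennreal (1/h) * indicator {0<..<h} s \<partial>lborel)"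
        using h by (intro nn_integral_cong) (auto simp: w_def indicator_def)
      also have "\<dots> = 1"
        using h by (simp add: nn_integral_cmult ennreal_mult'[symmetric])
      finally have w1: "(\<integral>\<^sup>+s. ennreal (w s) \<partial>lborel) = 1" .
      have "ennreal \<bar>u t\<bar> = (\<integral>\<^sup>+s. ennreal (w s) * ennreal \<bar>u t\<bar> \<partial>lborel)"
        using w1 by (simp add: nn_integral_multc)
      also have "\<dots> \<le> (\<integral>\<^sup>+s. ennreal (w s) * ennreal \<bar>u (t - s)\<bar>
          + (\<integral>\<^sup>+r. ennreal (w s) * ennreal (\<bar>rl_kernel \<alpha> r - rl_kernel \<alpha> (r - s)\<bar> * \<bar>f (t - r)\<bar>) \<partial>lborel) \<partial>lborel)"
      proof (rule nn_integral_mono_AE, use good' in eventually_elim)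
        case (elim s)
        show ?case
        proof (cases "0 < s \<and> s < h")
          case True
          show ?thesis
            using mult_left_mono[OF pt[OF elim], of "ennreal (w s)"] True
            by (simp add: nn_integral_cmult distrib_left)
        qed (auto simp: w_def)
      qed
      also have "\<dots> = (\<integral>\<^sup>+s. ennreal (w s) * ennreal \<bar>u (t - s)\<bar> \<partial>lborel)
          + (\<integral>\<^sup>+s. \<integral>\<^sup>+r. ennreal (w s) * ennreal (\<bar>rl_kernel \<alpha> r - rl_kernel \<alpha> (r - s)\<bar> * \<bar>f (t - r)\<bar>) \<partial>lborel \<partial>lborel)"
        by (rule nn_integral_add) measurable
      also have "(\<integral>\<^sup>+s. \<integral>\<^sup>+r. ennreal (w s) * ennreal (\<bar>rl_kernel \<alpha> r - rl_kernel \<alpha> (r - s)\<bar> * \<bar>f (t - r)\<bar>) \<partial>lborel \<partial>lborel)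
         = (\<integral>\<^sup>+r. \<integral>\<^sup>+s. ennreal (w s) * ennreal (\<bar>rl_kernel \<alpha> r - rl_kernel \<alpha> (r - s)\<bar> * \<bar>f (t - r)\<bar>) \<partial>lborel \<partial>lborel)"
        by (rule lborel_pair.Fubini') measurable
      also have "\<dots> = (\<integral>\<^sup>+r. (\<integral>\<^sup>+s. ennreal (w s * \<bar>rl_kernel \<alpha> r - rl_kernel \<alpha> (r - s)\<bar>) \<partial>lborel) * ennreal \<bar>f (t - r)\<bar> \<partial>lborel)"
      proof (rule nn_integral_cong)
        fix r
        have "(\<integral>\<^sup>+s. ennreal (w s) * ennreal (\<bar>rl_kernel \<alpha> r - rl_kernel \<alpha> (r - s)\<bar> * \<bar>f (t - r)\<bar>) \<partial>lborel)
           = (\<integral>\<^sup>+s. ennreal (w s * \<bar>rl_kernel \<alpha> r - rl_kernel \<alpha> (r - s)\<bar>) * ennreal \<bar>f (t - r)\<bar> \<partial>lborel)"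
          using w0 by (intro nn_integral_cong) (simp add: ennreal_mult mult_ac)
        also have "\<dots> = (\<integral>\<^sup>+s. ennreal (w s * \<bar>rl_kernel \<alpha> r - rl_kernel \<alpha> (r - s)\<bar>) \<partial>lborel) * ennreal \<bar>f (t - r)\<bar>"
          by (rule nn_integral_multc) measurable
        finally show "(\<integral>\<^sup>+s. ennreal (w s) * ennreal (\<bar>rl_kernel \<alpha> r - rl_kernel \<alpha> (r - s)\<bar> * \<bar>f (t - r)\<bar>) \<partial>lborel)
           = (\<integral>\<^sup>+s. ennreal (w s * \<bar>rl_kernel \<alpha> r - rl_kernel \<alpha> (r - s)\<bar>) \<partial>lborel) * ennreal \<bar>f (t - r)\<bar>" .
      qed
      also have "\<dots> \<le> (\<integral>\<^sup>+r. ennreal (kernel_majorant \<alpha> h r) * ennreal \<bar>f (t - r)\<bar> \<partial>lborel)"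
        using kernel_average_le_majorant[OF \<alpha> h] unfolding w_def
        by (intro nn_integral_mono mult_right_mono) auto
      finally show ?thesis
        using w0 kernel_majorant_nonneg[OF \<alpha>(1) less_imp_le[OF h]] by (simp add: ennreal_mult w_def add_left_mono del: times_divide_eq_left)
    qed
  qed
qed

text \<open>The exponent \<open>s\<close> below is the one for which convolution
with an \<open>L\<^sub>s\<close> kernel maps \<open>L\<^sub>p\<close> to \<open>L\<^sub>q\<close>. The assumption \<open>1/p - 1/q < \<alpha>\<close> says that
\<open>(1-\<alpha>)s < 1\<close>, so that the majorant of the averaged kernel lies in \<open>L\<^sub>s\<close>.\<close>

lemma time_gagliardo_nirenberg:
  fixes \<alpha> p q :: real
  assumes \<alpha>: "0 < \<alpha>" "\<alpha> < 1" and pq: "1 < p" "p < q" and sub: "1 / p - 1 / q < \<alpha>"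
  obtains C where "0 < C"
    "\<And>T f u P Q. 0 < T \<Longrightarrow> f \<in> borel_measurable borel \<Longrightarrow> u \<in> borel_measurable borel \<Longrightarrow>
      (\<And>t. t \<notin> {0<..<T} \<Longrightarrow> f t = 0) \<Longrightarrow> (\<And>t. t \<notin> {0<..<T} \<Longrightarrow> u t = 0) \<Longrightarrow>
      (AE t in lborel. t \<in> {0<..<T} \<longrightarrow> u t = (\<integral>r. rl_kernel \<alpha> r * f (t - r) \<partial>lborel)) \<Longrightarrow>
      0 \<le> P \<Longrightarrow> 0 \<le> Q \<Longrightarrow>
      (\<integral>\<^sup>+t. ennreal (\<bar>u t\<bar> powr p) \<partial>lborel) \<le> ennreal P \<Longrightarrow>
      (\<integral>\<^sup>+t. ennreal (\<bar>f t\<bar> powr p) \<partial>lborel) \<le> ennreal Q \<Longrightarrow>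
      (\<integral>\<^sup>+t. ennreal (\<bar>u t\<bar> powr q) \<partial>lborel)
        \<le> ennreal (C * P powr ((1 - 1 / \<alpha> * (1 / p - 1 / q)) * q / p)
                     * Q powr (1 / \<alpha> * (1 / p - 1 / q) * q / p))"
proof -
  define \<theta> where "\<theta> = 1 / \<alpha> * (1 / p - 1 / q)"
  define s where "s = 1 / (1 + 1 / q - 1 / p)"
  have ps: "1 / q < 1 / p" "1 / p < 1" "0 < 1 / q" using pq by (auto simp: frac_less2)
  have s_inv: "1 / s = 1 + 1 / q - 1 / p" by (simp add: s_def)
  have d: "0 < 1 + 1 / q - 1 / p" "1 + 1 / q - 1 / p < 1" using ps by linarith+
  have s: "1 < s" unfolding s_def using d by simp
  have sub': "(1 - \<alpha>) * s < 1"
    using sub d by (simp add: s_def pos_divide_less_eq)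
  obtain C0 where C0: "C0 > 0" and majorant: "\<And>h. h > 0 \<Longrightarrow>
      (\<integral>\<^sup>+r. ennreal (kernel_majorant \<alpha> h r powr s) \<partial>lborel) \<le> ennreal (C0 * h powr (1 - (1 - \<alpha>) * s))"
    using kernel_majorant_Lp[OF \<alpha> less_imp_le[OF s] sub'] by blast
  define C where "C = 2 powr q * (1 + C0 powr (q / s))"
  have C: "C > 0" using C0 by (simp add: C_def add_pos_pos)
  have \<alpha>\<theta>: "1 / s - 1 = - \<alpha> * \<theta>" using \<alpha> by (simp add: s_inv \<theta>_def)
  show thesis
  proof (rule that[OF C])
    fix T f u P Q
    assume T: "0 < T" and f[measurable]: "f \<in> borel_measurable borel" and u[measurable]: "u \<in> borel_measurable borel"
      and f0: "\<And>t. t \<notin> {0<..<T} \<Longrightarrow> f t = 0" and u0: "\<And>t. t \<notin> {0<..<T} \<Longrightarrow> u t = 0"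
      and uf: "AE t in lborel. t \<in> {0<..<T} \<longrightarrow> u t = (\<integral>r. rl_kernel \<alpha> r * f (t - r) \<partial>lborel)"
      and PQ0: "0 \<le> P" "0 \<le> Q"
      and intu: "(\<integral>\<^sup>+t. ennreal (\<bar>u t\<bar> powr p) \<partial>lborel) \<le> ennreal P"
      and intf: "(\<integral>\<^sup>+t. ennreal (\<bar>f t\<bar> powr p) \<partial>lborel) \<le> ennreal Q"
    let ?G = "(\<integral>\<^sup>+t. ennreal (\<bar>u t\<bar> powr q) \<partial>lborel)
        \<le> ennreal (C * P powr ((1 - 1 / \<alpha> * (1 / p - 1 / q)) * q / p)
                     * Q powr (1 / \<alpha> * (1 / p - 1 / q) * q / p))"
    have zero: ?G if "P = 0 \<or> Q = 0"
    proof -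
      have "(\<integral>\<^sup>+t. ennreal (\<bar>u t\<bar> powr p) \<partial>lborel) = 0"
      proof (cases "P = 0")
        case True
        then show ?thesis using intu by simp
      next
        case False
        then have "Q = 0" using that by simp
        have "(\<integral>\<^sup>+t. ennreal (\<bar>u t\<bar> powr p) \<partial>lborel)
          = (\<integral>\<^sup>+t. ennreal (indicator {0<..<T} t * \<bar>\<integral>r. rl_kernel \<alpha> r * f (t - r) \<partial>lborel\<bar> powr p) \<partial>lborel)"
        proof (rule nn_integral_cong_AE, use uf in eventually_elim)
          case (elim t)
          then show ?case using u0[of t] by (cases "t \<in> {0<..<T}") auto
        qed
        also have "\<dots> \<le> 0"
          using rl_convolution_Lp(2)[OF \<alpha>(1) _ T f f0 PQ0(2) intf] pq \<open>Q = 0\<close> by simp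
        finally show ?thesis by simp
      qed
      then have "AE t in lborel. ennreal (\<bar>u t\<bar> powr p) = 0" by (subst (asm) nn_integral_0_iff_AE) auto
      then have "AE t in lborel. ennreal (\<bar>u t\<bar> powr q) = 0"
        by eventually_elim (auto simp: ennreal_eq_0_iff)
      then have "(\<integral>\<^sup>+t. ennreal (\<bar>u t\<bar> powr q) \<partial>lborel) = 0"
        by (subst nn_integral_0_iff_AE) auto
      then show ?thesis by simp
    qed
    have main: ?G if P: "P > 0" and Q: "Q > 0"
    proof -
      \<comment> \<open>This \<open>h\<close> equates the two bounds, which up to constants are \<open>h\<^sup>-\<^sup>\<alpha>\<^sup>\<theta> P\<^sup>1\<^sup>/\<^sup>p\<close> and \<open>h\<^sup>\<alpha>\<^sup>-\<^sup>\<alpha>\<^sup>\<theta> Q\<^sup>1\<^sup>/\<^sup>p\<close>.\<close>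
      define h where "h = (P / Q) powr (1 / (\<alpha> * p))"
      have h: "h > 0" using P Q by (simp add: h_def)
      define X where "X t = (\<integral>\<^sup>+s. ennreal (indicator {0<..<h} s / h * \<bar>u (t - s)\<bar>) \<partial>lborel)" for t
      define Y where "Y t = (\<integral>\<^sup>+r. ennreal (kernel_majorant \<alpha> h r * \<bar>f (t - r)\<bar>) \<partial>lborel)" for t
      have [measurable]: "X \<in> borel_measurable borel" "Y \<in> borel_measurable borel"
        unfolding X_def Y_def by measurable
      have intw: "(\<integral>\<^sup>+r. ennreal ((indicator {0<..<h} r / h) powr s) \<partial>lborel) \<le> ennreal (h powr (1 - s))"
      proof -
        have "(\<integral>\<^sup>+r. ennreal ((indicator {0<..<h} r / h) powr s) \<partial>lborel)
          = (\<integral>\<^sup>+r. ennreal (h powr (- s)) * indicator {0<..<h} r \<partial>lborel)"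
          using h by (intro nn_integral_cong) (auto simp: indicator_def powr_divide powr_minus_divide)
        also have "\<dots> = ennreal (h powr (- s) * h)"
          using h by (simp add: nn_integral_cmult ennreal_mult')
        also have "h powr (- s) * h = h powr (1 - s)"
          using h by (simp add: powr_diff powr_minus field_simps)
        finally show ?thesis by simp
      qed
      have Xb: "AE t in lborel. X t < \<infinity>" "(\<integral>\<^sup>+t. ennreal (enn2real (X t) powr q) \<partial>lborel)
          \<le> ennreal ((h powr (1 - s)) powr (q / s) * P powr (q / p))"
        unfolding X_def using h pq s P s_inv intw intu
        by (intro Young_convolution[where s = s and p = p]; simp)+
      have Yb: "AE t in lborel. Y t < \<infinity>" "(\<integral>\<^sup>+t. ennreal (enn2real (Y t) powr q) \<partial>lborel)
          \<le> ennreal ((C0 * h powr (1 - (1 - \<alpha>) * s)) powr (q / s) * Q powr (q / p))"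
        unfolding Y_def using h pq s Q s_inv C0 majorant[OF h] intf kernel_majorant_nonneg[OF \<alpha>(1) less_imp_le[OF h]]
        by (intro Young_convolution[where s = s and p = p]; simp)+
      have ae: "AE t in lborel. ennreal \<bar>u t\<bar> \<le> X t + Y t"
        unfolding X_def Y_def
        by (rule rl_convolution_average_bound[OF \<alpha> _ T h f f0 u u0 uf intf]) (use pq in auto)
      have "(\<integral>\<^sup>+t. ennreal (\<bar>u t\<bar> powr q) \<partial>lborel)
         \<le> (\<integral>\<^sup>+t. ennreal (2 powr q) * (ennreal (enn2real (X t) powr q) + ennreal (enn2real (Y t) powr q)) \<partial>lborel)"
      proof (rule nn_integral_mono_AE, use ae Xb(1) Yb(1) in eventually_elim)
        case (elim t)
        then have "ennreal \<bar>u t\<bar> \<le> ennreal (enn2real (X t) + enn2real (Y t))"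
          by (simp add: ennreal_plus)
        then have "\<bar>u t\<bar> \<le> enn2real (X t) + enn2real (Y t)"
          by (subst (asm) ennreal_le_iff) auto
        then have "\<bar>u t\<bar> powr q \<le> (enn2real (X t) + enn2real (Y t)) powr q"
          using pq by (intro powr_mono2) auto
        also have "\<dots> \<le> 2 powr q * (enn2real (X t) powr q + enn2real (Y t) powr q)"
          using pq by (intro powr_add_le) auto
        finally show ?case
          by (simp add: ennreal_mult'[symmetric] ennreal_plus[symmetric] ennreal_leI del: ennreal_plus)
      qed
      also have "\<dots> = ennreal (2 powr q) * ((\<integral>\<^sup>+t. ennreal (enn2real (X t) powr q) \<partial>lborel)
           + (\<integral>\<^sup>+t. ennreal (enn2real (Y t) powr q) \<partial>lborel))"
        by (simp add: nn_integral_cmult nn_integral_add)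
      also have "\<dots> \<le> ennreal (2 powr q) * (ennreal ((h powr (1 - s)) powr (q / s) * P powr (q / p))
           + ennreal ((C0 * h powr (1 - (1 - \<alpha>) * s)) powr (q / s) * Q powr (q / p)))"
        by (intro mult_left_mono add_mono Xb Yb) auto
      also have "\<dots> = ennreal (2 powr q * ((h powr (1 - s)) powr (q / s) * P powr (q / p)
           + (C0 * h powr (1 - (1 - \<alpha>) * s)) powr (q / s) * Q powr (q / p)))"
        by (simp add: ennreal_mult'[symmetric] ennreal_plus[symmetric] del: ennreal_plus)
      also have "2 powr q * ((h powr (1 - s)) powr (q / s) * P powr (q / p)
           + (C0 * h powr (1 - (1 - \<alpha>) * s)) powr (q / s) * Q powr (q / p))
         = C * P powr ((1 - \<theta>) * q / p) * Q powr (\<theta> * q / p)"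
      proof -
        have e1: "(1 - s) * (q / s) = - (\<alpha> * \<theta> * q)"
        proof -
          have "(1 - s) * (q / s) = (1 / s - 1) * q" using s by (simp add: field_simps)
          then show ?thesis by (simp add: \<alpha>\<theta>)
        qed
        have e2: "(1 - (1 - \<alpha>) * s) * (q / s) = - (\<alpha> * \<theta> * q) + \<alpha> * q"
        proof -
          have "(1 - (1 - \<alpha>) * s) * (q / s) = (1 / s - 1) * q + \<alpha> * q" using s by (simp add: field_simps)
          then show ?thesis by (simp add: \<alpha>\<theta>)
        qed
        have h1: "h powr (- (\<alpha> * \<theta> * q)) = P powr (- (\<theta> * q / p)) * Q powr (\<theta> * q / p)"
          using P Q \<alpha> pq by (simp add: h_def powr_powr powr_divide powr_minus field_simps)
        have h2: "h powr (\<alpha> * q) = P powr (q / p) / Q powr (q / p)"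
          using P Q \<alpha> pq by (simp add: h_def powr_powr powr_divide)
        have P1: "P powr (- (\<theta> * q / p)) * P powr (q / p) = P powr ((1 - \<theta>) * q / p)"
          by (simp add: powr_add[symmetric] left_diff_distrib diff_divide_distrib)
        have A: "(h powr (1 - s)) powr (q / s) = P powr (- (\<theta> * q / p)) * Q powr (\<theta> * q / p)"
          by (simp only: powr_powr e1 h1)
        have B: "(C0 * h powr (1 - (1 - \<alpha>) * s)) powr (q / s)
          = C0 powr (q / s) * (P powr (- (\<theta> * q / p)) * Q powr (\<theta> * q / p) * (P powr (q / p) / Q powr (q / p)))"
          using C0 by (simp only: powr_mult powr_powr e2 powr_add h1 h2 less_imp_le powr_ge_zero)
        have "(h powr (1 - s)) powr (q / s) * P powr (q / p) = P powr ((1 - \<theta>) * q / p) * Q powr (\<theta> * q / p)"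
          unfolding A P1[symmetric] by simp
        moreover have "(C0 * h powr (1 - (1 - \<alpha>) * s)) powr (q / s) * Q powr (q / p)
          = C0 powr (q / s) * (P powr ((1 - \<theta>) * q / p) * Q powr (\<theta> * q / p))"
          unfolding B P1[symmetric] using Q by simp
        ultimately show ?thesis by (simp add: C_def algebra_simps)
      qed
      finally show ?thesis unfolding \<theta>_def .
    qed
    show ?G
      using zero main PQ0 by linarith
  qed
qed

section \<open>Smooth bumps and the fundamental lemma of the calculus of variations\<close>

lemma Ck_on_cong:
  assumes "open U" "\<And>z. z \<in> U \<Longrightarrow> f z = g z" "Ck_on k U f"
  shows "Ck_on k U g"
  using assms(2,3)
proof (induction k arbitrary: f g)
  case 0
  then show ?case using continuous_on_cong by force
next
  case (Suc k)
  have "(g has_derivative frechet_derivative f (at z)) (at z)" if "z \<in> U" for z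
    using Suc.prems that assms(1)
    by (auto intro!: has_derivative_transform_within_open[of f _ z UNIV U g] simp: frechet_derivative_works[symmetric])
  then have "g differentiable at z" "frechet_derivative g (at z) = frechet_derivative f (at z)" if "z \<in> U" for z
    using that frechet_derivative_at by (blast intro: differentiableI, metis)
  then show ?case using Suc by auto
qed

lemma Ck_on_SucI:
  assumes "open U" "\<And>z. z \<in> U \<Longrightarrow> (f has_derivative f' z) (at z)" "\<And>v. Ck_on k U (\<lambda>z. f' z v)"
  shows "Ck_on (Suc k) U f"
proof -
  have "frechet_derivative f (at z) = f' z" if "z \<in> U" for z
    using frechet_derivative_at[OF assms(2)[OF that]] by simp
  then show ?thesis
    using assms by (auto intro: differentiableI intro!: Ck_on_cong[OF assms(1) _ assms(3)])
qed

lemma Ck_on_SucD: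
  assumes "Ck_on (Suc k) U f"
  shows "Ck_on k U f"
  using assms
proof (induction k arbitrary: f)
  case 0
  then show ?case
    by (auto simp: continuous_on_eq_continuous_at intro!: continuous_at_imp_continuous_on differentiable_imp_continuous_within)
qed simp

lemma Ck_on_has_derivative:
  "Ck_on (Suc k) U f \<Longrightarrow> z \<in> U \<Longrightarrow> (f has_derivative frechet_derivative f (at z)) (at z)"
  by (simp add: frechet_derivative_works[symmetric])

lemma Ck_on_imp_continuous_on: "Ck_on k U f \<Longrightarrow> continuous_on U f"
  by (induction k) (auto dest: Ck_on_SucD simp del: Ck_on.simps(2))

lemma Ck_on_subset:
  assumes "Ck_on k U f" "V \<subseteq> U"
  shows "Ck_on k V f"
  using assms by (induction k arbitrary: f) (auto intro: continuous_on_subset)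

lemma Ck_on_const: "open U \<Longrightarrow> Ck_on k U (\<lambda>z. c)"
proof (induction k arbitrary: c)
  case (Suc k)
  show ?case by (rule Ck_on_SucI[where f' = "\<lambda>_ _. 0"]) (use Suc in auto)
qed simp

lemma Ck_on_add:
  assumes "open U" "Ck_on k U f" "Ck_on k U g"
  shows "Ck_on k U (\<lambda>z. f z + g z)"
  using assms(2,3)
proof (induction k arbitrary: f g)
  case (Suc k)
  show ?case
    by (rule Ck_on_SucI[where f' = "\<lambda>z v. frechet_derivative f (at z) v + frechet_derivative g (at z) v"])
       (use assms(1) Suc in \<open>auto intro!: has_derivative_add simp: frechet_derivative_works[symmetric]\<close>)
qed (auto intro: continuous_intros)

lemma Ck_on_mult:
  assumes "open U" "Ck_on k U f" "Ck_on k U g"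
  shows "Ck_on k U (\<lambda>z. f z * g z)"
  using assms(2,3)
proof (induction k arbitrary: f g)
  case (Suc k)
  show ?case
  proof (rule Ck_on_SucI[where f' = "\<lambda>z v. f z * frechet_derivative g (at z) v + frechet_derivative f (at z) v * g z"])
    fix z assume "z \<in> U"
    then show "((\<lambda>z. f z * g z) has_derivative
        (\<lambda>v. f z * frechet_derivative g (at z) v + frechet_derivative f (at z) v * g z)) (at z)"
      using Suc.prems by (intro has_derivative_mult) (auto simp: frechet_derivative_works[symmetric])
  next
    fix v
    show "Ck_on k U (\<lambda>z. f z * frechet_derivative g (at z) v + frechet_derivative f (at z) v * g z)"
      using Suc.prems by (intro Ck_on_add assms Suc.IH) (auto intro: Ck_on_SucD simp del: Ck_on.simps(2), simp_all)
  qed (rule assms)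
qed (auto intro: continuous_intros)

lemma Ck_on_prod:
  assumes "open U" "finite I" "\<And>i. i \<in> I \<Longrightarrow> Ck_on k U (f i)"
  shows "Ck_on k U (\<lambda>z. \<Prod>i\<in>I. f i z)"
  using assms(2,3) by (induction I) (auto intro!: Ck_on_const Ck_on_mult assms(1))

text \<open>The derivatives of \<open>exp(-1/x)\<close> are linear combinations of the functions \<open>x\<^sup>-\<^sup>j exp(-1/x)\<close>. The index
\<open>j\<close> makes the family closed under differentiation, so smoothness follows by induction for all members at once.\<close>

definition exp_inv :: "nat \<Rightarrow> real \<Rightarrow> real" where
  "exp_inv j x = (if 0 < x then (1 / x) ^ j * exp (- (1 / x)) else 0)"

lemma exp_inv_tendsto_0: "(exp_inv j \<longlongrightarrow> 0) (at 0)"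
proof (rule filterlim_split_at)
  show "(exp_inv j \<longlongrightarrow> 0) (at_left 0)"
  proof (rule tendsto_eventually)
    show "\<forall>\<^sub>F x in at_left 0. exp_inv j x = 0"
      by (auto simp: eventually_at_filter exp_inv_def)
  qed
  have "((\<lambda>x. inverse x ^ j / exp (inverse x)) \<longlongrightarrow> (0::real)) (at_right 0)"
    by (rule filterlim_compose[OF tendsto_power_div_exp_0 filterlim_inverse_at_top_right])
  then show "(exp_inv j \<longlongrightarrow> 0) (at_right 0)"
  proof (rule Lim_transform_eventually)
    show "\<forall>\<^sub>F x in at_right 0. inverse x ^ j / exp (inverse x) = exp_inv j x"
      by (auto simp: eventually_at_filter exp_inv_def exp_minus field_simps)
  qed
qed

lemma exp_inv_has_derivative:
  "(exp_inv j has_real_derivative exp_inv (j + 2) x - real j * exp_inv (j + 1) x) (at x)"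
proof -
  consider "x > 0" | "x < 0" | "x = 0" by linarith
  then show ?thesis
  proof cases
    case 1
    have "((\<lambda>x. (1 / x) ^ j * exp (- (1 / x))) has_real_derivative
        exp_inv (j + 2) x - real j * exp_inv (j + 1) x) (at x)"
    proof -
      have d: "((\<lambda>x. 1 / x) has_real_derivative - ((1 / x)\<^sup>2)) (at x)"
        using 1 by (auto intro!: derivative_eq_intros simp: power2_eq_square)
      have "((\<lambda>x. (1 / x) ^ j * exp (- (1 / x))) has_real_derivative
          real j * (- ((1 / x)\<^sup>2) * (1 / x) ^ (j - Suc 0)) * exp (- (1 / x))
          + exp (- (1 / x)) * (- (- ((1 / x)\<^sup>2))) * (1 / x) ^ j) (at x)"
        by (intro DERIV_mult DERIV_power DERIV_fun_exp DERIV_minus d)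
      moreover have "real j * (- ((1 / x)\<^sup>2) * (1 / x) ^ (j - Suc 0)) * exp (- (1 / x))
          + exp (- (1 / x)) * (- (- ((1 / x)\<^sup>2))) * (1 / x) ^ j = exp_inv (j + 2) x - real j * exp_inv (j + 1) x"
      proof -
        define u where "u = 1 / x"
        show ?thesis
          using 1 unfolding exp_inv_def u_def[symmetric]
          by (cases j) (simp_all add: power2_eq_square algebra_simps)
      qed
      ultimately show ?thesis by metis
    qed
    then show ?thesis
      by (rule has_field_derivative_transform_within_open[of _ _ _ "{0<..}"]) (use 1 in \<open>auto simp: exp_inv_def\<close>)
  next
    case 2
    have "((\<lambda>x. 0) has_real_derivative exp_inv (j + 2) x - real j * exp_inv (j + 1) x) (at x)"
      using 2 by (simp add: exp_inv_def)
    then show ?thesis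
      by (rule has_field_derivative_transform_within_open[of _ _ _ "{..<0}"]) (use 2 in \<open>auto simp: exp_inv_def\<close>)
  next
    case 3
    have "((\<lambda>h. (exp_inv j (0 + h) - exp_inv j 0) / h) \<longlongrightarrow> 0) (at 0)"
    proof (rule Lim_transform_eventually[OF exp_inv_tendsto_0[of "j + 1"]])
      show "\<forall>\<^sub>F h in at 0. exp_inv (j + 1) h = (exp_inv j (0 + h) - exp_inv j 0) / h"
        by (auto simp: eventually_at_filter exp_inv_def)
    qed
    then show ?thesis unfolding DERIV_def using 3 by (simp add: exp_inv_def)
  qed
qed

lemma Ck_on_exp_inv_affine:
  fixes b :: "'b::euclidean_space"
  shows "Ck_on k UNIV (\<lambda>z. exp_inv j (l + m * (z \<bullet> b)))"
proof (induction k arbitrary: j)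
  case 0
  have "continuous_on UNIV (exp_inv j)"
    by (meson DERIV_isCont continuous_at_imp_continuous_on exp_inv_has_derivative)
  then have "continuous_on UNIV (\<lambda>z::'b. exp_inv j (l + m * (z \<bullet> b)))"
    by (rule continuous_on_compose2) (auto intro!: continuous_intros)
  then show ?case by simp
next
  case (Suc k)
  show ?case
  proof (rule Ck_on_SucI[where f' = "\<lambda>z v. (m * (v \<bullet> b)) * (exp_inv (j + 2) (l + m * (z \<bullet> b)) + (- real j) * exp_inv (j + 1) (l + m * (z \<bullet> b)))"])
    fix z :: 'b
    have "((\<lambda>z. l + m * (z \<bullet> b)) has_derivative (\<lambda>v. m * (v \<bullet> b))) (at z)"
      by (auto intro!: derivative_eq_intros)
    from has_derivative_compose[OF this exp_inv_has_derivative[unfolded has_field_derivative_def]]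
    show "((\<lambda>z. exp_inv j (l + m * (z \<bullet> b))) has_derivative
       (\<lambda>v. (m * (v \<bullet> b)) * (exp_inv (j + 2) (l + m * (z \<bullet> b)) + (- real j) * exp_inv (j + 1) (l + m * (z \<bullet> b))))) (at z)"
      by (rule has_derivative_eq_rhs) (auto simp: algebra_simps)
  qed (intro Ck_on_mult Ck_on_add Ck_on_const Suc open_UNIV)+
qed

text \<open>As \<open>n\<close> grows, \<open>exp(-1/(n y))\<close> increases to \<open>1\<close> for each \<open>y > 0\<close>; therefore these bumps, all
supported in the same box, converge to its indicator function.\<close>

definition box_bump :: "'b::euclidean_space \<Rightarrow> 'b \<Rightarrow> nat \<Rightarrow> 'b \<Rightarrow> real" where
  "box_bump a c n z = (\<Prod>b\<in>Basis. exp_inv 0 (real n * (z \<bullet> b - a \<bullet> b)) * exp_inv 0 (real n * (c \<bullet> b - z \<bullet> b)))"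

lemma Ck_on_box_bump: "Ck_on k UNIV (box_bump a c n)"
proof -
  have "Ck_on k UNIV (\<lambda>z. \<Prod>b\<in>Basis. exp_inv 0 (- real n * (a \<bullet> b) + real n * (z \<bullet> b)) * exp_inv 0 (real n * (c \<bullet> b) + (- real n) * (z \<bullet> b)))"
    by (intro Ck_on_prod Ck_on_mult Ck_on_exp_inv_affine) auto
  then show ?thesis unfolding box_bump_def[abs_def] by (simp add: algebra_simps)
qed

lemma box_bump_outside: "z \<notin> box a c \<Longrightarrow> box_bump a c n z = 0"
proof -
  assume "z \<notin> box a c"
  then obtain b where b: "b \<in> Basis" "z \<bullet> b \<le> a \<bullet> b \<or> c \<bullet> b \<le> z \<bullet> b" by (auto simp: mem_box not_less)
  then have "real n * (z \<bullet> b - a \<bullet> b) \<le> 0 \<or> real n * (c \<bullet> b - z \<bullet> b) \<le> 0"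
    by (auto simp: mult_le_0_iff)
  then have "exp_inv 0 (real n * (z \<bullet> b - a \<bullet> b)) * exp_inv 0 (real n * (c \<bullet> b - z \<bullet> b)) = 0"
    by (auto simp: exp_inv_def)
  then show ?thesis using b by (auto simp: box_bump_def intro!: prod_zero)
qed

lemma exp_inv_0_bounds: "0 \<le> exp_inv 0 x" "exp_inv 0 x \<le> 1"
  by (auto simp: exp_inv_def)

lemma box_bump_bounds: "0 \<le> box_bump a c n z" "box_bump a c n z \<le> 1"
  unfolding box_bump_def using exp_inv_0_bounds by (auto intro!: prod_nonneg prod_le_1 mult_le_one)

lemma box_bump_tendsto: "(\<lambda>n. box_bump a c n z) \<longlonglongrightarrow> indicator (box a c) z"
proof (cases "z \<in> box a c")
  case False
  then show ?thesis by (simp add: box_bump_outside)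
next
  case True
  have lim: "(\<lambda>n. exp_inv 0 (real n * y)) \<longlonglongrightarrow> 1" if "y > 0" for y
  proof (rule Lim_transform_eventually)
    have "(\<lambda>n. exp (- ((1 / y) * (1 / real n)))) \<longlonglongrightarrow> exp (- ((1 / y) * 0))"
      by (intro tendsto_intros lim_1_over_n)
    then show "(\<lambda>n. exp (- ((1 / y) * (1 / real n)))) \<longlonglongrightarrow> 1" by simp
    show "\<forall>\<^sub>F n in sequentially. exp (- ((1 / y) * (1 / real n))) = exp_inv 0 (real n * y)"
      using eventually_gt_at_top[of 0] by eventually_elim (use that in \<open>simp add: exp_inv_def mult.commute\<close>)
  qed
  have "(\<lambda>n. box_bump a c n z) \<longlonglongrightarrow> (\<Prod>b\<in>(Basis::'a set). 1 * 1)"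
    unfolding box_bump_def using True by (intro tendsto_prod tendsto_mult lim) (auto simp: mem_box)
  then show ?thesis using True by simp
qed

text \<open>Boxes form an intersection-stable generator of the Borel sets. The whole space has to be assumed separately, as it
is not a box.\<close>

lemma AE_eq_0_if_box_integrals_eq_0:
  fixes g :: "'b::euclidean_space \<Rightarrow> real"
  assumes g: "integrable lborel g" and UNIV0: "(\<integral>z. g z \<partial>lborel) = 0"
    and box0: "\<And>c d. (\<integral>z. indicator (box c d) z * g z \<partial>lborel) = 0"
  shows "AE z in lborel. g z = 0"
proof (rule sigma_finite_measure.density_zero[OF sigma_finite_lborel g])
  fix A :: "'b set" assume "A \<in> sets lborel"
  then have A: "A \<in> sigma_sets UNIV (range (\<lambda>(a, b). box a b))"
    by (simp add: borel_eq_box)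
  have "Int_stable (range (\<lambda>(a, b). box a b :: 'b set))" "range (\<lambda>(a, b). box a b :: 'b set) \<subseteq> Pow UNIV"
    by (auto simp: Int_stable_def box_Int_box)
  from this A show "set_lebesgue_integral lborel A g = 0"
  proof (induction rule: sigma_sets_induct_disjoint)
    case (basic A)
    then show ?case using box0 by (auto simp: set_lebesgue_integral_def)
  next
    case empty
    show ?case by (simp add: set_lebesgue_integral_def)
  next
    case (compl A)
    then have [measurable]: "A \<in> sets borel" by (simp add: borel_eq_box)
    have "set_lebesgue_integral lborel (UNIV - A) g = (\<integral>z. g z - indicator A z *\<^sub>R g z \<partial>lborel)"
      unfolding set_lebesgue_integral_def by (intro Bochner_Integration.integral_cong) (auto simp: indicator_def)
    also have "\<dots> = 0"
      using compl UNIV0 g by (subst Bochner_Integration.integral_diff)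
        (auto simp: set_lebesgue_integral_def intro!: integrable_mult_indicator[of A lborel g, simplified])
    finally show ?case .
  next
    case (union A)
    then have [measurable]: "A i \<in> sets borel" for i by (auto simp: borel_eq_box)
    have "set_lebesgue_integral lborel (\<Union>i. A i) g = (\<Sum>i. set_lebesgue_integral lborel (A i) g)"
    proof (rule lebesgue_integral_countable_add)
      show "set_integrable lborel (\<Union>i. A i) g"
        unfolding set_integrable_def by (intro integrable_mult_indicator g) auto
    qed (use union in \<open>auto simp: disjoint_family_on_def\<close>)
    then show ?case using union by simp
  qed
qed

text \<open>The closed box is contained in the set, so these functions are compactly supported test functions for it.\<close>

definition bump_in :: "'b::euclidean_space set \<Rightarrow> ('b \<Rightarrow> real) \<Rightarrow> bool" where
  "bump_in \<Omega> \<zeta> \<longleftrightarrow> (\<forall>k. Ck_on k UNIV \<zeta>) \<and> (\<exists>a b. cbox a b \<subseteq> \<Omega> \<and> (\<forall>z. z \<notin> box a b \<longrightarrow> \<zeta> z = 0))"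

text \<open>The bumps of a box converge to its indicator, so the integral over every open box whose closure lies in the open set
vanishes; countably many such boxes, with their null boundaries, cover the set.\<close>

lemma fundamental_lemma_variations:
  fixes f :: "'b::euclidean_space \<Rightarrow> real"
  assumes "open \<Omega>" and [measurable]: "f \<in> borel_measurable borel"
    and loc: "\<And>a b. cbox a b \<subseteq> \<Omega> \<Longrightarrow> set_integrable lborel (cbox a b) f"
    and test: "\<And>\<zeta>. bump_in \<Omega> \<zeta> \<Longrightarrow> (\<integral>z. f z * \<zeta> z \<partial>lborel) = 0"
  shows "AE z in lborel. z \<in> \<Omega> \<longrightarrow> f z = 0"
proof -
  have box0: "(\<integral>z. indicator (box a b) z * f z \<partial>lborel) = 0" if sub: "cbox a b \<subseteq> \<Omega>" for a b
  proof -
    have int: "integrable lborel (\<lambda>z. indicator (cbox a b) z * f z)"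
      using loc[OF sub] by (simp add: set_integrable_def)
    have [measurable]: "box_bump a b n \<in> borel_measurable borel" for n
      using Ck_on_imp_continuous_on[OF Ck_on_box_bump] by (rule borel_measurable_continuous_onI)
    have "(\<lambda>n. \<integral>z. f z * box_bump a b n z \<partial>lborel) \<longlonglongrightarrow> (\<integral>z. f z * indicator (box a b) z \<partial>lborel)"
    proof (rule integral_dominated_convergence[where w = "\<lambda>z. norm (indicator (cbox a b) z * f z)"])
      show "AE z in lborel. (\<lambda>n. f z * box_bump a b n z) \<longlonglongrightarrow> f z * indicator (box a b) z"
        by (intro AE_I2 tendsto_intros box_bump_tendsto)
      show "AE z in lborel. norm (f z * box_bump a b n z) \<le> norm (indicator (cbox a b) z * f z)" for n
      proof (intro AE_I2)
        fix z
        show "norm (f z * box_bump a b n z) \<le> norm (indicator (cbox a b) z * f z)"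
        proof (cases "z \<in> box a b")
          case True
          then have "z \<in> cbox a b" using box_subset_cbox by auto
          then show ?thesis using box_bump_bounds[of a b n z]
            by (auto simp: abs_mult mult_left_le)
        qed (simp add: box_bump_outside)
      qed
    qed (use int in auto)
    moreover have "(\<integral>z. f z * box_bump a b n z \<partial>lborel) = 0" for n
      using sub by (intro test) (use Ck_on_box_bump box_bump_outside in \<open>unfold bump_in_def, blast\<close>)
    ultimately show ?thesis by (simp add: LIMSEQ_const_iff mult.commute)
  qed
  have ae: "AE z in lborel. z \<in> cbox a b \<longrightarrow> f z = 0" if sub: "cbox a b \<subseteq> \<Omega>" for a b
  proof -
    have bb: "AE z in lborel. indicator (box a b) z * f z = 0"
    proof (rule AE_eq_0_if_box_integrals_eq_0)
      have "integrable lborel (\<lambda>z. indicator (box a b) z *\<^sub>R (indicator (cbox a b) z * f z))"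
        using loc[OF sub] by (intro integrable_mult_indicator) (auto simp: set_integrable_def)
      then show "integrable lborel (\<lambda>z. indicator (box a b) z * f z)"
        by (rule Bochner_Integration.integrable_cong[THEN iffD1, rotated -1])
           (use box_subset_cbox in \<open>auto simp: indicator_def\<close>)
      show "(\<integral>z. indicator (box a b) z * f z \<partial>lborel) = 0" by (rule box0[OF sub])
      fix c d :: 'b
      obtain a' b' where ab: "box c d \<inter> box a b = box a' b'" "cbox a' b' \<subseteq> cbox a b"
      proof -
        let ?a = "\<Sum>i\<in>Basis. max (c \<bullet> i) (a \<bullet> i) *\<^sub>R i :: 'b" and ?b = "\<Sum>i\<in>Basis. min (d \<bullet> i) (b \<bullet> i) *\<^sub>R i :: 'b"
        have "box c d \<inter> box a b = box ?a ?b" by (rule box_Int_box)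
        moreover have "cbox ?a ?b \<subseteq> cbox a b" by (auto simp: mem_box)
        ultimately show thesis by (rule that)
      qed
      have "(\<integral>z. indicator (box c d) z * (indicator (box a b) z * f z) \<partial>lborel)
         = (\<integral>z. indicator (box a' b') z * f z \<partial>lborel)"
        unfolding ab(1)[symmetric] by (simp add: indicator_inter_arith mult.assoc)
      also have "\<dots> = 0" using ab sub by (intro box0) auto
      finally show "(\<integral>z. indicator (box c d) z * (indicator (box a b) z * f z) \<partial>lborel) = 0" .
    qed
    have "AE z in lborel. z \<notin> cbox a b - box a b"
    proof (rule AE_not_in)
      have "cbox a b - box a b \<in> null_sets lebesgue"
        using negligible_frontier_interval by (simp add: negligible_iff_null_sets)
      then show "cbox a b - box a b \<in> null_sets lborel"
        by (auto simp: null_sets_def)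
    qed
    then show ?thesis using bb by eventually_elim (auto simp: indicator_def split: if_splits)
  qed
  obtain D where D: "countable D" "D \<subseteq> Pow \<Omega>" "\<And>X. X \<in> D \<Longrightarrow> \<exists>a b. X = cbox a b" "\<Union>D = \<Omega>"
    using open_countable_Union_open_cbox[OF \<open>open \<Omega>\<close>] by metis
  have "AE z in lborel. \<forall>X\<in>D. z \<in> X \<longrightarrow> f z = 0"
  proof (rule AE_ball_countable[OF D(1), THEN iffD2], intro ballI)
    fix X assume "X \<in> D"
    then obtain a b where "X = cbox a b" "X \<subseteq> \<Omega>" using D by blast
    then show "AE z in lborel. z \<in> X \<longrightarrow> f z = 0" using ae by auto
  qed
  then show ?thesis by eventually_elim (use D(4) in blast)
qed

text \<open>By translation invariance every difference quotient of the function has integral \<open>0\<close>. The quotients converge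
boundedly to the derivative and vanish outside a fixed ball.\<close>

lemma integral_directional_derivative_eq_0:
  fixes F :: "'b::euclidean_space \<Rightarrow> real"
  assumes F: "Ck_on 1 UNIV F" and supp: "\<And>z. z \<notin> cbox a b \<Longrightarrow> F z = 0"
  shows "(\<integral>z. frechet_derivative F (at z) v \<partial>lborel) = 0"
proof -
  define F' where "F' z = frechet_derivative F (at z) v" for z
  have der: "(F has_derivative frechet_derivative F (at z)) (at z)" for z
    using F by (simp add: frechet_derivative_works[symmetric])
  have contF: "continuous_on UNIV F" by (rule Ck_on_imp_continuous_on[OF F])
  have contF': "continuous_on UNIV F'" using F by (simp add: F'_def[abs_def])
  have [measurable]: "F \<in> borel_measurable borel" "F' \<in> borel_measurable borel"
    using contF contF' by (auto intro: borel_measurable_continuous_onI)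
  have F'0: "F' z = 0" if "z \<notin> cbox a b" for z
  proof -
    have "((\<lambda>_. 0) has_derivative frechet_derivative F (at z)) (at z)"
      by (rule has_derivative_transform_within_open[OF der[of z], of "- cbox a b"]) (use that supp in \<open>auto intro: closed_cbox\<close>)
    then have "frechet_derivative F (at z) = (\<lambda>_. 0)"
      using has_derivative_unique has_derivative_const by blast
    then show ?thesis by (simp add: F'_def)
  qed
  obtain M where M: "\<And>z. \<bar>F' z\<bar> \<le> M"
  proof -
    have "bounded (F' ` cbox a b)"
      using contF' by (intro compact_imp_bounded compact_continuous_image) (auto intro: continuous_on_subset)
    then obtain M where M0: "\<And>z. z \<in> cbox a b \<Longrightarrow> \<bar>F' z\<bar> \<le> M" by (auto simp: bounded_iff)
    have "\<bar>F' z\<bar> \<le> max M 0" for z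
      using F'0[of z] M0[of z] by (cases "z \<in> cbox a b") (auto simp: le_max_iff_disj)
    then show thesis by (rule that)
  qed
  obtain R where R: "cbox a b \<subseteq> cball 0 R"
    by (meson ball_subset_cball bounded_cbox bounded_subset_ballD order_trans)
  define q where "q n z = (F (z + (1 / real (Suc n)) *\<^sub>R v) - F z) * real (Suc n)" for n z
  have mvt: "\<exists>\<xi>. q n z = F' (z + \<xi> *\<^sub>R v) \<and> 0 \<le> \<xi> \<and> \<xi> \<le> 1" for n z
  proof -
    define d where "d = 1 / real (Suc n)"
    have d: "0 < d" "d \<le> 1" by (auto simp: d_def)
    have "\<exists>\<xi>. \<xi> > 0 \<and> \<xi> < d \<and> F (z + d *\<^sub>R v) - F (z + 0 *\<^sub>R v) = (d - 0) * F' (z + \<xi> *\<^sub>R v)"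
    proof (rule MVT2[OF d(1)])
      fix x :: real
      have "((\<lambda>x. z + x *\<^sub>R v) has_derivative (\<lambda>h. h *\<^sub>R v)) (at x)"
        by (auto intro!: derivative_eq_intros)
      from has_derivative_compose[OF this der]
      have "((\<lambda>x. F (z + x *\<^sub>R v)) has_derivative (\<lambda>h. frechet_derivative F (at (z + x *\<^sub>R v)) (h *\<^sub>R v))) (at x)" .
      moreover have "frechet_derivative F (at y) (h *\<^sub>R v) = h * F' y" for h y
        using linear_scale[OF linear_frechet_derivative[of F "at y"], of h v] F by (simp add: F'_def)
      ultimately show "((\<lambda>x. F (z + x *\<^sub>R v)) has_real_derivative F' (z + x *\<^sub>R v)) (at x)"
        by (simp add: has_field_derivative_def mult.commute[of _ "F' _"])
    qed
    then obtain \<xi> where "0 < \<xi>" "\<xi> < d" "F (z + d *\<^sub>R v) - F z = d * F' (z + \<xi> *\<^sub>R v)" by auto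
    moreover have "q n z = (F (z + d *\<^sub>R v) - F z) * real (Suc n)" by (simp add: q_def d_def)
    moreover have "d * F' (z + \<xi> *\<^sub>R v) * real (Suc n) = F' (z + \<xi> *\<^sub>R v)" by (simp add: d_def del: of_nat_Suc)
    ultimately show ?thesis using d by (intro exI[of _ \<xi>]) auto
  qed
  have lim: "(\<lambda>n. q n z) \<longlonglongrightarrow> F' z" for z
  proof -
    have "((\<lambda>x. z + x *\<^sub>R v) has_derivative (\<lambda>h. h *\<^sub>R v)) (at 0)"
      by (auto intro!: derivative_eq_intros)
    from has_derivative_compose[OF this der]
    have "((\<lambda>x. F (z + x *\<^sub>R v)) has_derivative (\<lambda>h. frechet_derivative F (at z) (h *\<^sub>R v))) (at 0)" by simp
    moreover have "frechet_derivative F (at y) (h *\<^sub>R v) = h * F' y" for h y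
      using linear_scale[OF linear_frechet_derivative[of F "at y"], of h v] F by (simp add: F'_def)
    ultimately have "((\<lambda>x. F (z + x *\<^sub>R v)) has_real_derivative F' z) (at 0)"
      by (simp add: has_field_derivative_def mult.commute[of _ "F' _"])
    then have "((\<lambda>h. (F (z + h *\<^sub>R v) - F z) / h) \<longlongrightarrow> F' z) (at 0)"
      by (simp add: DERIV_def)
    moreover have "filterlim (\<lambda>n. 1 / real (Suc n)) (at 0) sequentially"
      using LIMSEQ_inverse_real_of_nat by (auto simp: filterlim_at inverse_eq_divide)
    ultimately have "(\<lambda>n. (F (z + (1 / real (Suc n)) *\<^sub>R v) - F z) / (1 / real (Suc n))) \<longlonglongrightarrow> F' z"
      by (rule filterlim_compose)
    then show ?thesis by (simp add: q_def)
  qed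
  have intF: "integrable lborel F"
  proof -
    have "integrable lborel (\<lambda>z. indicator (cbox a b) z *\<^sub>R F z)"
      using borel_integrable_compact[OF compact_cbox continuous_on_subset[OF contF subset_UNIV], of a b] by simp
    then show ?thesis
      by (rule Bochner_Integration.integrable_cong[THEN iffD1, rotated -1]) (use supp in \<open>auto simp: indicator_def\<close>)
  qed
  have shift: "integrable lborel (\<lambda>z. F (z + w))" "(\<integral>z. F (z + w) \<partial>lborel) = (\<integral>z. F z \<partial>lborel)" for w
  proof -
    have "integrable (distr lborel borel ((+) w)) F" using intF by (simp add: lborel_distr_plus)
    then show "integrable lborel (\<lambda>z. F (z + w))" by (subst (asm) integrable_distr_eq) (auto simp: add.commute)
    have "(\<integral>z. F z \<partial>distr lborel borel ((+) w)) = (\<integral>z. F (w + z) \<partial>lborel)" by (subst integral_distr) auto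
    then show "(\<integral>z. F (z + w) \<partial>lborel) = (\<integral>z. F z \<partial>lborel)" by (simp add: lborel_distr_plus add.commute)
  qed
  have "(\<integral>z. q n z \<partial>lborel) = 0" for n
    unfolding q_def by (simp add: shift intF del: of_nat_Suc)
  moreover have "(\<lambda>n. \<integral>z. q n z \<partial>lborel) \<longlonglongrightarrow> (\<integral>z. F' z \<partial>lborel)"
  proof (rule integral_dominated_convergence[where w = "\<lambda>z. M * indicator (cball 0 (R + norm v)) z"])
    show "q n \<in> borel_measurable lborel" for n unfolding q_def by measurable
    show "integrable lborel (\<lambda>z. M * indicator (cball 0 (R + norm v)) z)"
      by (intro integrable_mult_right integrable_real_indicator) (use emeasure_bounded_finite[OF bounded_cball] in auto)
    show "AE z in lborel. norm (q n z) \<le> M * indicator (cball 0 (R + norm v)) z" for n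
    proof (intro AE_I2)
      fix z :: 'b
      obtain \<xi> where \<xi>: "q n z = F' (z + \<xi> *\<^sub>R v)" "0 \<le> \<xi>" "\<xi> \<le> 1" using mvt[of n z] by blast
      show "norm (q n z) \<le> M * indicator (cball 0 (R + norm v)) z"
      proof (cases "norm z \<le> R + norm v")
        case True
        then show ?thesis using M \<xi> by simp
      next
        case False
        have "norm z \<le> norm (z + \<xi> *\<^sub>R v) + norm (\<xi> *\<^sub>R v)"
          by (metis add_diff_cancel norm_triangle_ineq4)
        also have "norm (\<xi> *\<^sub>R v) \<le> norm v" using \<xi> by (simp add: mult_left_le_one_le)
        finally have "z + \<xi> *\<^sub>R v \<notin> cbox a b" using False R by (auto simp: subset_iff)
        then show ?thesis using F'0 \<xi> False by simp
      qed
    qed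
  qed (use lim in auto)
  ultimately show ?thesis by (simp add: LIMSEQ_const_iff F'_def)
qed

section \<open>A sup bound on the unit ball for exponents above the dimension\<close>

lemma nn_integral_Jensen_set:
  fixes F :: "'b::euclidean_space \<Rightarrow> real"
  assumes [measurable]: "F \<in> borel_measurable borel" "B \<in> sets borel" and F0: "\<And>x. 0 \<le> F x"
    and p: "1 \<le> p" and V: "0 < V" "emeasure lborel B \<le> ennreal V"
    and Q: "0 \<le> Q" "(\<integral>\<^sup>+z. ennreal (indicator B z * F z powr p) \<partial>lborel) \<le> ennreal Q"
  shows "(\<integral>\<^sup>+z. ennreal (indicator B z * F z) \<partial>lborel) \<le> ennreal (V powr (1 - 1 / p) * Q powr (1 / p))"
proof -
  have i: "(indicator B z * F z) powr p = indicator B z * F z powr p"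
      "indicator B z powr 1 * (indicator B z * F z powr p) = indicator B z * F z powr p"
      "indicator B z * (indicator B z * F z) = indicator B z * F z" for z
    by (auto simp: indicator_def)
  have "(\<integral>\<^sup>+z. ennreal (indicator B z * (indicator B z * F z)) \<partial>lborel)
      \<le> ennreal (V powr (1 / 1 - 1 / p) * (Q + 1) powr (1 / p - 1 / p) * Q powr (1 / p))"
  proof (rule nn_integral_mult_three_exponents)
    have "ennreal Q \<le> ennreal (Q + 1)" by (intro ennreal_leI) simp
    with Q(2) show "(\<integral>\<^sup>+z. ennreal ((indicator B z * F z) powr p) \<partial>lborel) \<le> ennreal (Q + 1)"
      unfolding i by (rule order_trans)
    show "(\<integral>\<^sup>+z. ennreal (indicator B z powr 1) \<partial>lborel) \<le> ennreal V"
      using V by (simp add: ennreal_indicator)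
    show "(\<integral>\<^sup>+z. ennreal (indicator B z powr 1 * (indicator B z * F z) powr p) \<partial>lborel) \<le> ennreal Q"
      using Q(2) unfolding i .
  qed (use p F0 V Q in auto)
  then show ?thesis using Q by (simp add: i)
qed

text \<open>Dilation by \<open>c\<close> is written with the real power \<open>c powr - d\<close> because the factor is later raised to the
power \<open>1/p\<close>.\<close>

lemma nn_integral_lborel_affine:
  fixes f :: "'b::euclidean_space \<Rightarrow> ennreal"
  assumes [measurable]: "f \<in> borel_measurable borel" and c: "0 < c"
  shows "(\<integral>\<^sup>+z. f (t + c *\<^sub>R z) \<partial>lborel) = ennreal (c powr - real DIM('b)) * (\<integral>\<^sup>+z. f z \<partial>lborel)"
proof -
  have "(\<integral>\<^sup>+z. f z \<partial>lborel) = ennreal (c ^ DIM('b)) * (\<integral>\<^sup>+z. f (t + c *\<^sub>R z) \<partial>lborel)"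
    using c by (subst lborel_affine[of c t]) (simp_all add: nn_integral_density nn_integral_distr nn_integral_cmult)
  then have "ennreal (c powr - real DIM('b)) * (\<integral>\<^sup>+z. f z \<partial>lborel)
    = ennreal (c powr - real DIM('b) * c ^ DIM('b)) * (\<integral>\<^sup>+z. f (t + c *\<^sub>R z) \<partial>lborel)"
    by (simp add: ennreal_mult' mult.assoc)
  also have "c powr - real DIM('b) * c ^ DIM('b) = 1"
    using c by (simp add: powr_minus powr_realpow)
  finally show ?thesis by simp
qed

lemma segment_increment_bound:
  fixes w :: "'b::euclidean_space \<Rightarrow> real"
  assumes S: "convex S" "open S"
    and D: "\<And>y. y \<in> S \<Longrightarrow> (w has_derivative D y) (at y)"
    and cont: "\<And>v. continuous_on S (\<lambda>y. D y v)"
    and xz: "x \<in> S" "z \<in> S"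
  shows "ennreal \<bar>w x\<bar> \<le> ennreal \<bar>w z\<bar>
     + (\<integral>\<^sup>+s. ennreal (indicator {0<..<1} s * (norm (z - x) * (\<Sum>b\<in>Basis. \<bar>D (x + s *\<^sub>R (z - x)) b\<bar>))) \<partial>lborel)"
proof -
  have seg: "x + s *\<^sub>R (z - x) \<in> S" if "0 \<le> s" "s \<le> 1" for s
    using convexD_alt[OF S(1) xz that] by (simp add: algebra_simps)
  define \<phi> where "\<phi> s = D (x + s *\<^sub>R (z - x)) (z - x)" for s
  have der: "((\<lambda>s. w (x + s *\<^sub>R (z - x))) has_vector_derivative \<phi> s) (at s within {0..1})" if "0 \<le> s" "s \<le> 1" for s
  proof -
    have "((\<lambda>s. x + s *\<^sub>R (z - x)) has_derivative (\<lambda>h. h *\<^sub>R (z - x))) (at s within {0..1})"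
      by (auto intro!: derivative_eq_intros)
    from has_derivative_compose[OF this D[OF seg[OF that]]]
    have "((\<lambda>s. w (x + s *\<^sub>R (z - x))) has_derivative (\<lambda>h. D (x + s *\<^sub>R (z - x)) (h *\<^sub>R (z - x)))) (at s within {0..1})" .
    moreover have "D (x + s *\<^sub>R (z - x)) (h *\<^sub>R (z - x)) = h *\<^sub>R \<phi> s" for h
      using linear_scale[OF has_derivative_linear[OF D[OF seg[OF that]]]] by (simp add: \<phi>_def)
    ultimately show ?thesis by (simp add: has_vector_derivative_def)
  qed
  have cont\<phi>: "continuous_on {0..1} \<phi>"
    unfolding \<phi>_def by (rule continuous_on_compose2[OF cont]) (use seg in \<open>auto intro!: continuous_intros\<close>)
  have bnd: "\<bar>\<phi> s\<bar> \<le> norm (z - x) * (\<Sum>b\<in>Basis. \<bar>D (x + s *\<^sub>R (z - x)) b\<bar>)" if "0 \<le> s" "s \<le> 1" for s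
  proof -
    have lin: "linear (D (x + s *\<^sub>R (z - x)))" by (rule has_derivative_linear[OF D[OF seg[OF that]]])
    have "\<phi> s = D (x + s *\<^sub>R (z - x)) (\<Sum>b\<in>Basis. ((z - x) \<bullet> b) *\<^sub>R b)"
      unfolding \<phi>_def by (simp only: euclidean_representation)
    also have "\<dots> = (\<Sum>b\<in>Basis. ((z - x) \<bullet> b) * D (x + s *\<^sub>R (z - x)) b)"
      by (subst linear_sum[OF lin]) (simp add: linear_scale[OF lin])
    finally have "\<bar>\<phi> s\<bar> \<le> (\<Sum>b\<in>Basis. \<bar>((z - x) \<bullet> b) * D (x + s *\<^sub>R (z - x)) b\<bar>)"
      by (simp add: sum_abs)
    also have "\<dots> \<le> (\<Sum>b\<in>Basis. norm (z - x) * \<bar>D (x + s *\<^sub>R (z - x)) b\<bar>)"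
      by (intro sum_mono) (auto simp: abs_mult intro!: mult_right_mono Basis_le_norm)
    finally show ?thesis by (simp add: sum_distrib_left)
  qed
  have bi: "has_bochner_integral lborel (\<lambda>s. indicator {0..1} s *\<^sub>R \<phi> s) (w (x + 1 *\<^sub>R (z - x)) - w (x + 0 *\<^sub>R (z - x)))"
    by (rule has_bochner_integral_FTC_Icc[where F = "\<lambda>s. w (x + s *\<^sub>R (z - x))"]) (use der cont\<phi> in auto)
  then have i: "integrable lborel (\<lambda>s. indicator {0..1} s *\<^sub>R \<phi> s)" and "(\<integral>s. indicator {0..1} s *\<^sub>R \<phi> s \<partial>lborel) = w z - w x"
    by (auto simp: has_bochner_integral_iff)
  then have "ennreal (norm (w z - w x)) \<le> (\<integral>\<^sup>+s. ennreal (norm (indicator {0..1} s *\<^sub>R \<phi> s)) \<partial>lborel)"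
    using integral_norm_bound_ennreal[OF i] by simp
  also have "\<dots> \<le> (\<integral>\<^sup>+s. ennreal (indicator {0<..<1} s * (norm (z - x) * (\<Sum>b\<in>Basis. \<bar>D (x + s *\<^sub>R (z - x)) b\<bar>))) \<partial>lborel)"
  proof (rule nn_integral_mono_AE, use AE_lborel_singleton[of 0] AE_lborel_singleton[of 1] in eventually_elim)
    case (elim s)
    then show ?case using bnd[of s] by (intro ennreal_leI) (auto simp: indicator_def)
  qed
  finally have *: "ennreal \<bar>w z - w x\<bar> \<le> \<dots>" by simp
  have "ennreal \<bar>w x\<bar> \<le> ennreal (\<bar>w z\<bar> + \<bar>w z - w x\<bar>)"
    by (intro ennreal_leI) linarith
  also have "\<dots> = ennreal \<bar>w z\<bar> + ennreal \<bar>w z - w x\<bar>" by simp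
  finally show ?thesis using * by (meson add_left_mono order_trans)
qed

text \<open>The value at \<open>x\<close> is compared with the values at all points \<open>z\<close> of the ball along the segments from \<open>x\<close> to \<open>z\<close>.
For fixed \<open>s\<close> the map \<open>z \<mapsto> x + s(z-x)\<close> sends the ball into itself and contracts volumes by
\<open>s\<^sup>d\<close>, so that Jensen's inequality leaves the factor \<open>s\<^sup>-\<^sup>d\<^sup>/\<^sup>p\<close>, which is integrable at \<open>0\<close>
exactly when \<open>p > d\<close>.\<close>

lemma sup_bound_unit_ball:
  fixes w :: "'a::euclidean_space \<Rightarrow> real" and p :: real
  assumes p: "1 < p" "real DIM('a) < p"
    and V: "emeasure lborel (ball (0::'a) 1) = ennreal V" "0 < V"
    and D: "\<And>y. y \<in> ball 0 1 \<Longrightarrow> (w has_derivative D y) (at y)"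
    and cont: "\<And>v. continuous_on (ball 0 1) (\<lambda>y. D y v)"
    and P: "0 \<le> P" "(\<integral>\<^sup>+y. ennreal (indicator (ball 0 1) y * \<bar>w y\<bar> powr p) \<partial>lborel) \<le> ennreal P"
    and Q: "0 \<le> Q" "(\<integral>\<^sup>+y. ennreal (indicator (ball 0 1) y * (\<Sum>b\<in>Basis. \<bar>D y b\<bar>) powr p) \<partial>lborel) \<le> ennreal Q"
    and x: "x \<in> ball 0 1"
  shows "\<bar>w x\<bar> \<le> V powr (- 1 / p) * P powr (1 / p) + 2 * V powr (- 1 / p) / (1 - real DIM('a) / p) * Q powr (1 / p)"
proof -
  let ?B = "ball (0::'a) 1"
  define d where "d = real DIM('a)"
  have d: "d / p < 1" using p by (simp add: d_def)
  have cw: "continuous_on ?B w"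
    by (rule has_derivative_continuous_on) (use D has_derivative_at_withinI in blast)
  define W where "W y = indicator ?B y * \<bar>w y\<bar>" for y
  define H where "H y = indicator ?B y * (\<Sum>b\<in>Basis. \<bar>D y b\<bar>)" for y
  have W[measurable]: "W \<in> borel_measurable borel"
  proof -
    have "continuous_on ?B (\<lambda>y. \<bar>w y\<bar>)" using cw by (intro continuous_intros)
    from borel_measurable_continuous_on_indicator[OF _ this] show ?thesis by (simp add: W_def[abs_def])
  qed
  have H[measurable]: "H \<in> borel_measurable borel"
  proof -
    have "continuous_on ?B (\<lambda>y. \<Sum>b\<in>Basis. \<bar>D y b\<bar>)" by (intro continuous_intros cont)
    from borel_measurable_continuous_on_indicator[OF _ this] show ?thesis by (simp add: H_def[abs_def])
  qed
  have B[measurable]: "?B \<in> sets borel" by simp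
  have nn: "0 \<le> W y" "0 \<le> H y" for y by (auto simp: W_def H_def sum_nonneg)
  have Hp: "(\<integral>\<^sup>+y. ennreal (H y powr p) \<partial>lborel) \<le> ennreal Q"
  proof -
    have "H y powr p = indicator ?B y * (\<Sum>b\<in>Basis. \<bar>D y b\<bar>) powr p" for y by (simp add: H_def indicator_def)
    then show ?thesis using Q(2) by (simp only:)
  qed
  have Wint: "(\<integral>\<^sup>+z. ennreal (indicator ?B z * W z) \<partial>lborel) \<le> ennreal (V powr (1 - 1 / p) * P powr (1 / p))"
  proof (rule nn_integral_Jensen_set)
    have "indicator ?B z * W z powr p = indicator ?B z * \<bar>w z\<bar> powr p" for z by (simp add: W_def indicator_def)
    then show "(\<integral>\<^sup>+z. ennreal (indicator ?B z * W z powr p) \<partial>lborel) \<le> ennreal P" using P(2) by (simp only:)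
  qed (use p V P nn in auto)
  have Hint: "(\<integral>\<^sup>+z. ennreal (indicator ?B z * H (x + s *\<^sub>R (z - x))) \<partial>lborel)
      \<le> ennreal (V powr (1 - 1 / p) * Q powr (1 / p) * s powr (- (d / p)))" if s: "0 < s" for s
  proof -
    have "(\<integral>\<^sup>+z. ennreal (indicator ?B z * H (x + s *\<^sub>R (z - x)) powr p) \<partial>lborel)
       \<le> (\<integral>\<^sup>+z. ennreal (H ((x - s *\<^sub>R x) + s *\<^sub>R z) powr p) \<partial>lborel)"
      by (intro nn_integral_mono ennreal_leI) (auto simp: indicator_def algebra_simps)
    also have "\<dots> = ennreal (s powr - d) * (\<integral>\<^sup>+z. ennreal (H z powr p) \<partial>lborel)"
      unfolding d_def by (rule nn_integral_lborel_affine[where f = "\<lambda>z. ennreal (H z powr p)"]) (use s in auto)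
    also have "\<dots> \<le> ennreal (s powr - d) * ennreal Q" by (intro mult_left_mono Hp) auto
    also have "\<dots> = ennreal (s powr - d * Q)" by (simp add: ennreal_mult')
    finally have "(\<integral>\<^sup>+z. ennreal (indicator ?B z * H (x + s *\<^sub>R (z - x)) powr p) \<partial>lborel) \<le> ennreal (s powr - d * Q)" .
    then have "(\<integral>\<^sup>+z. ennreal (indicator ?B z * H (x + s *\<^sub>R (z - x))) \<partial>lborel)
       \<le> ennreal (V powr (1 - 1 / p) * (s powr - d * Q) powr (1 / p))"
      using p V Q nn by (intro nn_integral_Jensen_set) auto
    also have "V powr (1 - 1 / p) * (s powr - d * Q) powr (1 / p) = V powr (1 - 1 / p) * Q powr (1 / p) * s powr (- (d / p))"
      using Q by (simp add: powr_mult powr_powr)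
    finally show ?thesis .
  qed
  have "(\<integral>\<^sup>+z. \<integral>\<^sup>+s. ennreal (indicator {0<..<1} s * (2 * (indicator ?B z * H (x + s *\<^sub>R (z - x))))) \<partial>lborel \<partial>lborel)
      = (\<integral>\<^sup>+s. \<integral>\<^sup>+z. ennreal (indicator {0<..<1} s * (2 * (indicator ?B z * H (x + s *\<^sub>R (z - x))))) \<partial>lborel \<partial>lborel)"
    by (rule lborel_pair.Fubini') measurable
  also have "\<dots> \<le> (\<integral>\<^sup>+s. ennreal (2 * V powr (1 - 1 / p) * Q powr (1 / p)) * ennreal (indicator {0<..<1} s * s powr (- (d / p))) \<partial>lborel)"
  proof (rule nn_integral_mono)
    fix s :: real
    show "(\<integral>\<^sup>+z. ennreal (indicator {0<..<1} s * (2 * (indicator ?B z * H (x + s *\<^sub>R (z - x))))) \<partial>lborel)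
       \<le> ennreal (2 * V powr (1 - 1 / p) * Q powr (1 / p)) * ennreal (indicator {0<..<1} s * s powr (- (d / p)))"
    proof (cases "0 < s \<and> s < 1")
      case True
      have "(\<integral>\<^sup>+z. ennreal (2 * (indicator ?B z * H (x + s *\<^sub>R (z - x)))) \<partial>lborel)
        = ennreal 2 * (\<integral>\<^sup>+z. ennreal (indicator ?B z * H (x + s *\<^sub>R (z - x))) \<partial>lborel)"
        using nn by (subst nn_integral_cmult[symmetric]) (auto simp: ennreal_mult')
      also have "\<dots> \<le> ennreal 2 * ennreal (V powr (1 - 1 / p) * Q powr (1 / p) * s powr (- (d / p)))"
        using True by (intro mult_left_mono Hint) auto
      also have "\<dots> = ennreal (2 * V powr (1 - 1 / p) * Q powr (1 / p)) * ennreal (s powr (- (d / p)))"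
      proof -
        have "ennreal 2 * ennreal (V powr (1 - 1 / p) * Q powr (1 / p) * s powr (- (d / p)))
          = ennreal (2 * (V powr (1 - 1 / p) * Q powr (1 / p) * s powr (- (d / p))))"
          by (rule ennreal_mult[symmetric]) auto
        also have "2 * (V powr (1 - 1 / p) * Q powr (1 / p) * s powr (- (d / p)))
          = (2 * V powr (1 - 1 / p) * Q powr (1 / p)) * s powr (- (d / p))" by simp
        also have "ennreal \<dots> = ennreal (2 * V powr (1 - 1 / p) * Q powr (1 / p)) * ennreal (s powr (- (d / p)))"
          by (rule ennreal_mult) auto
        finally show ?thesis .
      qed
      finally show ?thesis using True by simp
    qed auto
  qed
  also have "\<dots> = ennreal (2 * V powr (1 - 1 / p) * Q powr (1 / p)) * ennreal (1 / (1 - d / p))"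
    using nn_integral_powr_from_0[of "- (d / p)" 1] d by (simp add: nn_integral_cmult)
  finally have gradient_part: "(\<integral>\<^sup>+z. \<integral>\<^sup>+s. ennreal (indicator {0<..<1} s * (2 * (indicator ?B z * H (x + s *\<^sub>R (z - x))))) \<partial>lborel \<partial>lborel)
      \<le> ennreal (2 * V powr (1 - 1 / p) * Q powr (1 / p)) * ennreal (1 / (1 - d / p))" .
  have "ennreal (\<bar>w x\<bar> * V) = (\<integral>\<^sup>+z. ennreal \<bar>w x\<bar> * indicator ?B z \<partial>lborel)"
    using V by (subst nn_integral_cmult_indicator) (simp_all add: ennreal_mult)
  also have "\<dots> \<le> (\<integral>\<^sup>+z. ennreal (indicator ?B z * W z)
       + (\<integral>\<^sup>+s. ennreal (indicator {0<..<1} s * (2 * (indicator ?B z * H (x + s *\<^sub>R (z - x))))) \<partial>lborel) \<partial>lborel)"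
  proof (rule nn_integral_mono)
    fix z :: 'a
    show "ennreal \<bar>w x\<bar> * indicator ?B z \<le> ennreal (indicator ?B z * W z)
       + (\<integral>\<^sup>+s. ennreal (indicator {0<..<1} s * (2 * (indicator ?B z * H (x + s *\<^sub>R (z - x))))) \<partial>lborel)"
    proof (cases "z \<in> ?B")
      case True
      have "norm (z - x) \<le> 2"
        using norm_triangle_ineq4[of z x] True x by simp
      have seg: "x + s *\<^sub>R (z - x) \<in> ?B" if "0 \<le> s" "s \<le> 1" for s
        using convexD_alt[OF convex_ball x True that] by (simp add: algebra_simps)
      have "ennreal \<bar>w x\<bar> \<le> ennreal \<bar>w z\<bar>
         + (\<integral>\<^sup>+s. ennreal (indicator {0<..<1} s * (norm (z - x) * (\<Sum>b\<in>Basis. \<bar>D (x + s *\<^sub>R (z - x)) b\<bar>))) \<partial>lborel)"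
        by (rule segment_increment_bound[OF convex_ball open_ball D cont x True])
      also have "\<dots> \<le> ennreal \<bar>w z\<bar>
         + (\<integral>\<^sup>+s. ennreal (indicator {0<..<1} s * (2 * H (x + s *\<^sub>R (z - x)))) \<partial>lborel)"
      proof (intro add_left_mono nn_integral_mono ennreal_leI)
        fix s :: real
        show "indicator {0<..<1} s * (norm (z - x) * (\<Sum>b\<in>Basis. \<bar>D (x + s *\<^sub>R (z - x)) b\<bar>))
            \<le> indicator {0<..<1} s * (2 * H (x + s *\<^sub>R (z - x)))"
        proof (cases "0 < s \<and> s < 1")
          case True
          then show ?thesis using seg[of s] \<open>norm (z - x) \<le> 2\<close>
            by (auto simp: H_def intro!: mult_right_mono sum_nonneg)
        qed auto
      qed
      finally show ?thesis using True by (simp add: W_def)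
    qed simp
  qed
  also have "\<dots> = (\<integral>\<^sup>+z. ennreal (indicator ?B z * W z) \<partial>lborel)
       + (\<integral>\<^sup>+z. \<integral>\<^sup>+s. ennreal (indicator {0<..<1} s * (2 * (indicator ?B z * H (x + s *\<^sub>R (z - x))))) \<partial>lborel \<partial>lborel)"
    by (rule nn_integral_add) measurable
  also have "\<dots> \<le> ennreal (V powr (1 - 1 / p) * P powr (1 / p))
      + ennreal (2 * V powr (1 - 1 / p) * Q powr (1 / p)) * ennreal (1 / (1 - d / p))"
    by (intro add_mono Wint gradient_part)
  also have "\<dots> = ennreal (V powr (1 - 1 / p) * P powr (1 / p) + 2 * V powr (1 - 1 / p) * Q powr (1 / p) * (1 / (1 - d / p)))"
  proof -
    have "ennreal (2 * V powr (1 - 1 / p) * Q powr (1 / p)) * ennreal (1 / (1 - d / p))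
      = ennreal (2 * V powr (1 - 1 / p) * Q powr (1 / p) * (1 / (1 - d / p)))"
      by (rule ennreal_mult[symmetric]) (use d in auto)
    then show ?thesis using d by (subst ennreal_plus) auto
  qed
  finally have "\<bar>w x\<bar> * V \<le> V powr (1 - 1 / p) * P powr (1 / p) + 2 * V powr (1 - 1 / p) * Q powr (1 / p) * (1 / (1 - d / p))"
    using d V by (subst (asm) ennreal_le_iff) auto
  then have "\<bar>w x\<bar> \<le> (V powr (1 - 1 / p) * P powr (1 / p) + 2 * V powr (1 - 1 / p) * Q powr (1 / p) * (1 / (1 - d / p))) / V"
    using V by (simp add: pos_le_divide_eq)
  also have "V powr (1 - 1 / p) = V * V powr (- 1 / p)"
    using V by (simp add: powr_diff powr_minus_divide)
  finally show ?thesis using V by (simp add: add_divide_distrib d_def mult_ac)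
qed

lemma power_bound_unit_ball:
  fixes p :: real
  assumes p: "1 < p" "real DIM('a::euclidean_space) < p"
  obtains C where "0 < C"
    "\<And>(w :: 'a \<Rightarrow> real) D x. (\<And>y. y \<in> ball 0 1 \<Longrightarrow> (w has_derivative D y) (at y)) \<Longrightarrow>
       (\<And>v. continuous_on (ball 0 1) (\<lambda>y. D y v)) \<Longrightarrow> x \<in> ball 0 1 \<Longrightarrow>
       ennreal (\<bar>w x\<bar> powr p) \<le> ennreal C * ((\<integral>\<^sup>+y. ennreal (indicator (ball 0 1) y * \<bar>w y\<bar> powr p) \<partial>lborel)
         + (\<integral>\<^sup>+y. ennreal (indicator (ball 0 1) y * (\<Sum>b\<in>Basis. \<bar>D y b\<bar>) powr p) \<partial>lborel))"
proof -
  obtain V where V: "emeasure lborel (ball (0::'a) 1) = ennreal V" "0 < V"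
  proof
    show "emeasure lborel (ball (0::'a) 1) = ennreal (measure lborel (ball (0::'a) 1))"
      using emeasure_bounded_finite[OF bounded_ball, of "0::'a" 1] by (intro emeasure_eq_ennreal_measure) auto
    show "0 < measure lborel (ball (0::'a) 1)"
      by (rule content_ball_pos) simp
  qed
  define c1 where "c1 = V powr (- 1 / p)"
  define c2 where "c2 = 2 * V powr (- 1 / p) / (1 - real DIM('a) / p)"
  have c: "c1 > 0" "c2 > 0" using V p by (auto simp: c1_def c2_def)
  define C where "C = 2 powr p * (c1 powr p + c2 powr p)"
  have C: "C > 0" using c by (simp add: C_def add_pos_pos)
  show thesis
  proof (rule that[OF C])
    fix w :: "'a \<Rightarrow> real" and D :: "'a \<Rightarrow> 'a \<Rightarrow> real" and x :: 'a
    assume D: "\<And>y. y \<in> ball 0 1 \<Longrightarrow> (w has_derivative D y) (at y)"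
      and cont: "\<And>v. continuous_on (ball 0 1) (\<lambda>y. D y v)" and x: "x \<in> ball 0 1"
    define I where "I = (\<integral>\<^sup>+y. ennreal (indicator (ball 0 1) y * \<bar>w y\<bar> powr p) \<partial>lborel)"
    define J where "J = (\<integral>\<^sup>+y. ennreal (indicator (ball 0 1) y * (\<Sum>b\<in>Basis. \<bar>D y b\<bar>) powr p) \<partial>lborel)"
    have "ennreal (\<bar>w x\<bar> powr p) \<le> ennreal C * (I + J)"
    proof (cases "I < \<infinity> \<and> J < \<infinity>")
      case False
      then have "ennreal C * (I + J) = top" using C by (auto simp: less_top[symmetric] ennreal_mult_eq_top_iff)
      then show ?thesis by simp
    next
      case True
      define P Q where "P = enn2real I" and "Q = enn2real J"
      have PQ: "0 \<le> P" "0 \<le> Q" "I = ennreal P" "J = ennreal Q" using True by (auto simp: P_def Q_def)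
      have "\<bar>w x\<bar> \<le> c1 * P powr (1 / p) + c2 * Q powr (1 / p)"
        unfolding c1_def c2_def
        by (rule sup_bound_unit_ball[OF p V D cont PQ(1) _ PQ(2) _ x])
           (use PQ(3,4) in \<open>auto simp: I_def J_def\<close>)
      then have "\<bar>w x\<bar> powr p \<le> (c1 * P powr (1 / p) + c2 * Q powr (1 / p)) powr p"
        using p by (intro powr_mono2) auto
      also have "\<dots> \<le> 2 powr p * ((c1 * P powr (1 / p)) powr p + (c2 * Q powr (1 / p)) powr p)"
        using c p by (intro powr_add_le) auto
      also have "\<dots> = 2 powr p * (c1 powr p * P + c2 powr p * Q)"
        using c p PQ by (simp add: powr_mult powr_powr)
      also have "\<dots> \<le> 2 powr p * ((c1 powr p + c2 powr p) * P + (c1 powr p + c2 powr p) * Q)"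
        using PQ by (intro mult_left_mono add_mono mult_right_mono) auto
      also have "\<dots> = C * (P + Q)" by (simp add: C_def algebra_simps)
      finally have "ennreal (\<bar>w x\<bar> powr p) \<le> ennreal (C * (P + Q))" by (rule ennreal_leI)
      then show ?thesis using PQ C by (simp add: ennreal_mult)
    qed
    then show "ennreal (\<bar>w x\<bar> powr p) \<le> ennreal C * ((\<integral>\<^sup>+y. ennreal (indicator (ball 0 1) y * \<bar>w y\<bar> powr p) \<partial>lborel)
         + (\<integral>\<^sup>+y. ennreal (indicator (ball 0 1) y * (\<Sum>b\<in>Basis. \<bar>D y b\<bar>) powr p) \<partial>lborel))"
      unfolding I_def J_def .
  qed
qed

section \<open>Borel representatives and integration by parts\<close>

lemma bump_in_test_funs:
  assumes "bump_in X \<zeta>"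
  shows "\<zeta> \<in> test_funs X"
proof -
  obtain a b where ab: "cbox a b \<subseteq> X" "\<And>z. z \<notin> box a b \<Longrightarrow> \<zeta> z = 0" and k: "\<And>k. Ck_on k UNIV \<zeta>"
    using assms by (auto simp: bump_in_def)
  have sub: "{z \<in> X. \<zeta> z \<noteq> 0} \<subseteq> cbox a b" using ab(2) box_subset_cbox by blast
  then have "closure {z \<in> X. \<zeta> z \<noteq> 0} \<subseteq> cbox a b" by (rule closure_minimal) (rule closed_cbox)
  moreover have "smooth_on X \<zeta>" unfolding smooth_on_def using k by (intro exI[of _ UNIV] exI[of _ \<zeta>]) auto
  ultimately show ?thesis
    unfolding test_funs_def using sub ab(1) bounded_cbox bounded_subset by blast
qed

lemma directional_derivative_continuous:
  "Ck_on (Suc k) U f \<Longrightarrow> continuous_on U (\<lambda>z. frechet_derivative f (at z) v)"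
  using Ck_on_imp_continuous_on[of k U] by simp

lemma frechet_derivative_eq_0_on_open:
  assumes "open S" "z \<in> S" "\<And>y. y \<in> S \<Longrightarrow> f y = 0"
  shows "frechet_derivative f (at z) v = 0"
proof -
  have "((\<lambda>_. 0) has_derivative (\<lambda>_. 0)) (at z)" by simp
  then have "(f has_derivative (\<lambda>_. 0)) (at z)"
    by (rule has_derivative_transform_within_open[OF _ assms(1,2)]) (use assms in auto)
  from frechet_derivative_at[OF this] show ?thesis by (simp only: fun_eq_iff)
qed

text \<open>Outside the compact closure of its support a test function and its derivative vanish; on that closure both are
bounded by continuity.\<close>

lemma test_funs_regularity:
  fixes \<phi> :: "'b::euclidean_space \<Rightarrow> real"
  assumes X: "open X" and \<phi>: "\<phi> \<in> test_funs X"
  obtains M where "continuous_on X \<phi>" "continuous_on X (\<lambda>z. frechet_derivative \<phi> (at z) v)"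
    "\<And>z. z \<in> X \<Longrightarrow> \<bar>\<phi> z\<bar> \<le> M" "\<And>z. z \<in> X \<Longrightarrow> \<bar>frechet_derivative \<phi> (at z) v\<bar> \<le> M"
proof -
  obtain U h where U: "open U" "X \<subseteq> U" "\<And>k. Ck_on k U h" "\<And>z. z \<in> X \<Longrightarrow> h z = \<phi> z"
    using \<phi> unfolding test_funs_def smooth_on_def by blast
  have C: "Ck_on k X \<phi>" for k
    by (rule Ck_on_cong[OF X U(4) Ck_on_subset[OF U(3) U(2)]])
  have cont: "continuous_on X \<phi>" by (rule Ck_on_imp_continuous_on[OF C])
  have cont': "continuous_on X (\<lambda>z. frechet_derivative \<phi> (at z) v)" by (rule directional_derivative_continuous[OF C])
  define S where "S = closure {z \<in> X. \<phi> z \<noteq> 0}"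
  have S: "compact S" "S \<subseteq> X" using \<phi> by (auto simp: S_def test_funs_def compact_closure)
  have out: "\<phi> z = 0" if "z \<in> X" "z \<notin> S" for z using that closure_subset[of "{z \<in> X. \<phi> z \<noteq> 0}"] unfolding S_def by blast
  have out': "frechet_derivative \<phi> (at z) v = 0" if "z \<in> X" "z \<notin> S" for z
    by (rule frechet_derivative_eq_0_on_open[of "X \<inter> - S"])
       (use that X S(1) compact_imp_closed out in auto)
  have "bounded (\<phi> ` S)" "bounded ((\<lambda>z. frechet_derivative \<phi> (at z) v) ` S)"
    using S cont cont' by (auto intro!: compact_imp_bounded compact_continuous_image intro: continuous_on_subset)
  then obtain M1 M2 where M: "\<And>z. z \<in> S \<Longrightarrow> \<bar>\<phi> z\<bar> \<le> M1" "\<And>z. z \<in> S \<Longrightarrow> \<bar>frechet_derivative \<phi> (at z) v\<bar> \<le> M2"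
    unfolding bounded_iff by (metis imageI real_norm_def)
  show thesis
  proof (rule that[OF cont cont', of "max 0 (max M1 M2)"])
    fix z assume "z \<in> X"
    then show "\<bar>\<phi> z\<bar> \<le> max 0 (max M1 M2)" using M(1)[of z] out[of z] by (cases "z \<in> S") (auto simp: le_max_iff_disj)
    show "\<bar>frechet_derivative \<phi> (at z) v\<bar> \<le> max 0 (max M1 M2)"
      using \<open>z \<in> X\<close> M(2)[of z] out'[of z] by (cases "z \<in> S") (auto simp: le_max_iff_disj)
  qed
qed

text \<open>The product of \<open>h\<close> and the bump, which is \<open>0\<close> outside a closed box in \<open>X\<close>, is continuously
differentiable on the whole space although \<open>h\<close> is only so on \<open>X\<close>.\<close>

lemma integration_by_parts_bump:
  fixes h \<zeta> :: "'b::euclidean_space \<Rightarrow> real"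
  assumes X: "open X" and h: "Ck_on 1 X h" and \<zeta>: "bump_in X \<zeta>"
  shows "(\<integral>z. (indicator X z * frechet_derivative h (at z) v) * \<zeta> z \<partial>lborel)
    = - (\<integral>z. (indicator X z * h z) * frechet_derivative \<zeta> (at z) v \<partial>lborel)" (is ?ibp)
    and "integrable lborel (\<lambda>z. (indicator X z * frechet_derivative h (at z) v) * \<zeta> z)" (is ?int)
proof -
  obtain a b where ab: "cbox a b \<subseteq> X" "\<And>z. z \<notin> box a b \<Longrightarrow> \<zeta> z = 0" and k: "\<And>k. Ck_on k UNIV \<zeta>"
    using \<zeta> by (auto simp: bump_in_def)
  have out: "\<zeta> z = 0" if "z \<notin> cbox a b" for z using that ab(2) box_subset_cbox by blast
  have out': "frechet_derivative \<zeta> (at z) v = 0" if "z \<notin> cbox a b" for z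
    by (rule frechet_derivative_eq_0_on_open[of "- cbox a b"]) (use that out closed_cbox in auto)
  define F where "F z = h z * \<zeta> z" for z
  have 1: "Ck_on 1 X F"
    unfolding F_def by (intro Ck_on_mult X h Ck_on_subset[OF k]) simp
  have 2: "Ck_on 1 (- cbox a b) F"
    by (rule Ck_on_cong[of _ "\<lambda>_. 0", OF _ _ Ck_on_const]) (auto simp: F_def out open_Compl closed_cbox)
  have U: "X \<union> - cbox a b = UNIV" using ab by auto
  have F: "Ck_on 1 UNIV F"
  proof -
    have "F differentiable at z" for z
    proof -
      have "z \<in> X \<or> z \<in> - cbox a b" using U by blast
      then show ?thesis using Ck_on_has_derivative[of 0] 1 2 by (metis One_nat_def differentiableI)
    qed
    moreover have "continuous_on UNIV (\<lambda>z. frechet_derivative F (at z) v)" for v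
    proof -
      have "continuous_on (X \<union> - cbox a b) (\<lambda>z. frechet_derivative F (at z) v)"
        using directional_derivative_continuous[of 0 _ F v] 1 2
        by (intro continuous_on_open_Un X open_Compl closed_cbox) auto
      then show ?thesis by (simp only: U)
    qed
    ultimately show ?thesis by simp
  qed
  have prod: "frechet_derivative F (at z) v = h z * frechet_derivative \<zeta> (at z) v + frechet_derivative h (at z) v * \<zeta> z"
    if "z \<in> X" for z
  proof -
    have "(F has_derivative (\<lambda>v. h z * frechet_derivative \<zeta> (at z) v + frechet_derivative h (at z) v * \<zeta> z)) (at z)"
      unfolding F_def using h k[of 1] that
      by (intro has_derivative_mult Ck_on_has_derivative[of 0 UNIV \<zeta>] Ck_on_has_derivative[of 0 X h]) simp_all
    from frechet_derivative_at[OF this] show ?thesis by (simp only: fun_eq_iff)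
  qed
  define f1 where "f1 z = (indicator X z * h z) * frechet_derivative \<zeta> (at z) v" for z
  define f2 where "f2 z = (indicator X z * frechet_derivative h (at z) v) * \<zeta> z" for z
  have eq: "frechet_derivative F (at z) v = f1 z + f2 z" for z
  proof (cases "z \<in> X")
    case True
    then show ?thesis by (simp add: prod f1_def f2_def)
  next
    case False
    then have "z \<in> - cbox a b" using ab by auto
    then have "frechet_derivative F (at z) v = 0"
      by (intro frechet_derivative_eq_0_on_open[of "- cbox a b"]) (auto simp: F_def out open_Compl closed_cbox)
    then show ?thesis using False by (simp add: f1_def f2_def)
  qed
  have contK: "continuous_on (cbox a b) h" "continuous_on (cbox a b) (\<lambda>z. frechet_derivative h (at z) v)"
      "continuous_on (cbox a b) \<zeta>" "continuous_on (cbox a b) (\<lambda>z. frechet_derivative \<zeta> (at z) v)"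
    using Ck_on_imp_continuous_on[OF h] directional_derivative_continuous[of 0 X h v] h
      Ck_on_imp_continuous_on[OF k[of 0]] directional_derivative_continuous[OF k[of "Suc 0"]] ab(1)
    by (auto intro: continuous_on_subset)
  have "integrable lborel (\<lambda>z. indicator (cbox a b) z *\<^sub>R (h z * frechet_derivative \<zeta> (at z) v))"
    "integrable lborel (\<lambda>z. indicator (cbox a b) z *\<^sub>R (frechet_derivative h (at z) v * \<zeta> z))"
    using contK by (intro borel_integrable_compact compact_cbox continuous_on_mult; simp)+
  moreover have "(\<lambda>z. indicator (cbox a b) z *\<^sub>R (h z * frechet_derivative \<zeta> (at z) v)) = f1"
    "(\<lambda>z. indicator (cbox a b) z *\<^sub>R (frechet_derivative h (at z) v * \<zeta> z)) = f2"
    using ab(1) out out' by (auto simp: f1_def f2_def indicator_def fun_eq_iff)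
  ultimately have int: "integrable lborel f1" "integrable lborel f2" by simp_all
  have "0 = (\<integral>z. frechet_derivative F (at z) v \<partial>lborel)"
    by (rule integral_directional_derivative_eq_0[OF F, symmetric, of a b]) (simp add: F_def out)
  also have "\<dots> = (\<integral>z. f1 z \<partial>lborel) + (\<integral>z. f2 z \<partial>lborel)"
    unfolding eq using int by simp
  finally show ?ibp unfolding f1_def f2_def by simp
  show ?int using int(2) unfolding f2_def .
qed

text \<open>Functions on \<open>X\<close> are merely Lebesgue measurable. Slices of such functions need not be measurable, and Tonelli's
theorem is applied to the product of Borel measures. Every integral is therefore moved to a Borel function on the whole space that
vanishes outside \<open>X\<close>.\<close>

definition borel_version :: "'b::euclidean_space set \<Rightarrow> ('b \<Rightarrow> real) \<Rightarrow> ('b \<Rightarrow> real) \<Rightarrow> bool" where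
  "borel_version X f g \<longleftrightarrow> g \<in> borel_measurable borel \<and> (\<forall>z. z \<notin> X \<longrightarrow> g z = 0) \<and>
     f \<in> borel_measurable (lebesgue_on X) \<and> (AE z in lborel. z \<in> X \<longrightarrow> f z = g z)"

lemma borel_version_exists:
  fixes X :: "'b::euclidean_space set"
  assumes X: "X \<in> sets borel" and f: "f \<in> borel_measurable (lebesgue_on X)"
  obtains g where "borel_version X f g"
proof -
  have "(\<lambda>z. if z \<in> X then f z else 0) \<in> borel_measurable lebesgue"
    using f X by (subst borel_measurable_if) auto
  then obtain g where g: "g \<in> borel_measurable lborel" "AE z in lborel. (if z \<in> X then f z else 0) = g z"
    using completion_ex_borel_measurable_real by blast
  have "borel_version X f (\<lambda>z. indicator X z * g z)"
    unfolding borel_version_def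
  proof (intro conjI allI impI)
    show "AE z in lborel. z \<in> X \<longrightarrow> f z = indicator X z * g z"
      using g(2) by eventually_elim auto
  qed (use g X f in auto)
  then show thesis by (rule that)
qed

lemma borel_version_continuous:
  assumes X: "open X" and f: "continuous_on X f"
  shows "borel_version X f (\<lambda>z. indicator X z * f z)"
  unfolding borel_version_def
proof (intro conjI)
  show "(\<lambda>z. indicator X z * f z) \<in> borel_measurable borel"
    using borel_measurable_continuous_on_indicator[of X f] X f by simp
  show "f \<in> borel_measurable (lebesgue_on X)"
    using X f by (intro continuous_imp_measurable_on_sets_lebesgue) auto
qed auto

lemma borel_version_diff:
  "borel_version X f f' \<Longrightarrow> borel_version X g g' \<Longrightarrow> borel_version X (\<lambda>z. f z - g z) (\<lambda>z. f' z - g' z)"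
  unfolding borel_version_def by auto

lemma borel_version_mult:
  "borel_version X f f' \<Longrightarrow> \<phi> \<in> borel_measurable borel \<Longrightarrow>
    borel_version X (\<lambda>z. f z * \<phi> z) (\<lambda>z. f' z * \<phi> z)"
proof -
  assume f: "borel_version X f f'" and \<phi>[measurable]: "\<phi> \<in> borel_measurable borel"
  have [measurable]: "\<phi> \<in> borel_measurable (lebesgue_on X)"
    by (rule measurable_restrict_space1, rule measurable_completion) simp
  have [measurable]: "f \<in> borel_measurable (lebesgue_on X)" "f' \<in> borel_measurable borel"
    and *: "\<forall>z. z \<notin> X \<longrightarrow> f' z = 0" "AE z in lborel. z \<in> X \<longrightarrow> f z = f' z"
    using f by (auto simp: borel_version_def)
  show "borel_version X (\<lambda>z. f z * \<phi> z) (\<lambda>z. f' z * \<phi> z)"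
    unfolding borel_version_def
  proof (intro conjI)
    show "AE z in lborel. z \<in> X \<longrightarrow> f z * \<phi> z = f' z * \<phi> z"
      using *(2) by eventually_elim auto
  qed (use *(1) in \<open>auto, measurable\<close>)
qed

lemma borel_version_abs_powr:
  "borel_version X f f' \<Longrightarrow> borel_version X (\<lambda>z. \<bar>f z\<bar> powr p) (\<lambda>z. \<bar>f' z\<bar> powr p)"
  unfolding borel_version_def by auto

lemma borel_version_integral:
  assumes X: "X \<in> sets borel" and g: "borel_version X f g"
  shows "integral\<^sup>L (lebesgue_on X) f = integral\<^sup>L lborel g"
    "integrable (lebesgue_on X) f \<longleftrightarrow> integrable lborel g"
    "(\<integral>\<^sup>+z. ennreal (f z) \<partial>lebesgue_on X) = (\<integral>\<^sup>+z. ennreal (g z) \<partial>lborel)"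
proof -
  have [measurable]: "g \<in> borel_measurable borel" and g0: "\<And>z. z \<notin> X \<Longrightarrow> g z = 0"
    and f: "f \<in> borel_measurable (lebesgue_on X)" and ae: "AE z in lborel. z \<in> X \<longrightarrow> f z = g z"
    using g by (auto simp: borel_version_def)
  have XL: "X \<inter> space lebesgue \<in> sets lebesgue" using X by simp
  have gl: "g \<in> borel_measurable lebesgue" by (simp add: measurable_completion)
  have fl: "(\<lambda>z. indicator X z *\<^sub>R f z) \<in> borel_measurable lebesgue"
    using f X by (subst borel_measurable_restrict_space_iff[symmetric]) auto
  have AE: "AE z in lebesgue. indicator X z *\<^sub>R f z = g z"
    using AE_completion[OF ae] by eventually_elim (use g0 in \<open>auto simp: indicator_def\<close>)
  show "integral\<^sup>L (lebesgue_on X) f = integral\<^sup>L lborel g"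
    using integral_cong_AE[OF fl gl AE] by (simp add: integral_restrict_space[OF XL] integral_completion)
  show "integrable (lebesgue_on X) f \<longleftrightarrow> integrable lborel g"
    using integrable_cong_AE[OF fl gl AE] by (simp add: integrable_restrict_space[OF XL] integrable_completion)
  have "(\<integral>\<^sup>+z. ennreal (f z) \<partial>lebesgue_on X) = (\<integral>\<^sup>+z. ennreal (indicator X z *\<^sub>R f z) \<partial>lebesgue)"
    by (subst nn_integral_restrict_space[OF XL]) (auto intro!: nn_integral_cong simp: indicator_def)
  also have "\<dots> = (\<integral>\<^sup>+z. ennreal (g z) \<partial>lebesgue)"
    by (rule nn_integral_cong_AE) (use AE in eventually_elim, simp)
  finally show "(\<integral>\<^sup>+z. ennreal (f z) \<partial>lebesgue_on X) = (\<integral>\<^sup>+z. ennreal (g z) \<partial>lborel)"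
    by (simp add: nn_integral_completion)
qed

lemma borel_version_Lp:
  assumes X: "X \<in> sets borel" and p: "0 < p" and g: "borel_version X f g" and f: "f \<in> Lp_space p X"
  shows "(\<integral>\<^sup>+z. ennreal (\<bar>g z\<bar> powr p) \<partial>lborel) = ennreal (Lp_norm p X f powr p)"
proof -
  note v = borel_version_abs_powr[OF g, of p]
  have int: "integrable lborel (\<lambda>z. \<bar>g z\<bar> powr p)"
    using f borel_version_integral(2)[OF X v] by (simp add: Lp_space_def)
  have "Lp_norm p X f powr p = (\<integral>z. \<bar>g z\<bar> powr p \<partial>lborel)"
    using p borel_version_integral(1)[OF X v] by (simp add: Lp_norm_def powr_powr)
  then show ?thesis using nn_integral_eq_integral[OF int] by simp
qed

lemma borel_version_Lp_space:
  assumes X: "X \<in> sets borel" and g: "borel_version X f g"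
    and fin: "(\<integral>\<^sup>+z. ennreal (\<bar>g z\<bar> powr p) \<partial>lborel) < \<infinity>"
  shows "f \<in> Lp_space p X"
proof -
  note v = borel_version_abs_powr[OF g, of p]
  have "integrable lborel (\<lambda>z. \<bar>g z\<bar> powr p)"
    using fin g by (intro integrableI_bounded) (auto simp: borel_version_def)
  then show ?thesis
    using borel_version_integral(2)[OF X v] g by (simp add: Lp_space_def borel_version_def)
qed

lemma Lp_norm_nonneg: "0 \<le> Lp_norm p X f"
  by (simp add: Lp_norm_def)

text \<open>On \<open>X\<close>, which has finite measure, \<open>\<bar>g\<bar> \<le> 1 + \<bar>g\<bar>\<^sup>p\<close>.\<close>

lemma Lp_integrable_bounded_set:
  fixes g :: "'b::euclidean_space \<Rightarrow> real"
  assumes g[measurable]: "g \<in> borel_measurable borel" and p: "1 \<le> p"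
    and fin: "(\<integral>\<^sup>+z. ennreal (\<bar>g z\<bar> powr p) \<partial>lborel) < \<infinity>"
    and X: "X \<in> sets borel" "bounded X" and g0: "\<And>z. z \<notin> X \<Longrightarrow> g z = 0"
  shows "integrable lborel g"
proof (rule Bochner_Integration.integrable_bound[where f = "\<lambda>z. indicator X z + \<bar>g z\<bar> powr p"])
  show "integrable lborel (\<lambda>z. indicator X z + \<bar>g z\<bar> powr p)"
  proof (intro Bochner_Integration.integrable_add)
    show "integrable lborel (indicator X :: 'b \<Rightarrow> real)"
      using X emeasure_bounded_finite by (intro integrable_real_indicator) auto
    show "integrable lborel (\<lambda>z. \<bar>g z\<bar> powr p)"
      using fin by (intro integrableI_bounded) auto
  qed
  have "\<bar>g z\<bar> \<le> indicator X z + \<bar>g z\<bar> powr p" for z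
  proof (cases "z \<in> X")
    case True
    have "\<bar>g z\<bar> \<le> 1 + \<bar>g z\<bar> powr p"
    proof (cases "\<bar>g z\<bar> \<le> 1")
      case False
      then have "\<bar>g z\<bar> powr 1 \<le> \<bar>g z\<bar> powr p" using p by (intro powr_mono) auto
      then show ?thesis using False by simp
    qed (simp add: add_increasing2)
    then show ?thesis using True by simp
  qed (simp add: g0)
  then show "AE z in lborel. norm (g z) \<le> norm (indicator X z + \<bar>g z\<bar> powr p)"
    by (intro AE_I2) (smt (verit) indicator_pos_le powr_ge_zero real_norm_def)
qed simp

section \<open>Weak spatial derivatives\<close>

lemma borel_version_eq_0: "borel_version X f g \<Longrightarrow> z \<notin> X \<Longrightarrow> g z = 0"
  by (simp add: borel_version_def)

lemma bump_in_bounded: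
  assumes "bump_in X \<zeta>"
  obtains M where "\<And>z. \<bar>\<zeta> z\<bar> \<le> M" "\<And>z. \<bar>frechet_derivative \<zeta> (at z) v\<bar> \<le> M"
proof -
  have "bump_in UNIV \<zeta>" using assms by (auto simp: bump_in_def)
  then have "\<zeta> \<in> test_funs UNIV" by (rule bump_in_test_funs)
  then show thesis using test_funs_regularity[OF open_UNIV, of \<zeta> v] that by (metis UNIV_I)
qed

lemma bump_in_measurable:
  assumes "bump_in X \<zeta>"
  shows "\<zeta> \<in> borel_measurable borel" "(\<lambda>z. frechet_derivative \<zeta> (at z) v) \<in> borel_measurable borel"
  using assms Ck_on_imp_continuous_on[of 0 UNIV \<zeta>] directional_derivative_continuous[of 0 UNIV \<zeta> v]
  unfolding bump_in_def by (metis borel_measurable_continuous_onI)+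

lemma open_cyl: "open \<Omega> \<Longrightarrow> open (cyl T \<Omega>)"
  by (simp add: cyl_def open_Times)

lemma bounded_cyl: "bounded \<Omega> \<Longrightarrow> bounded (cyl T \<Omega>)"
  by (simp add: cyl_def bounded_Times)

lemma Lp_space_integrable:
  assumes X: "X \<in> sets borel" "bounded X" and p: "1 \<le> p" and f: "f \<in> Lp_space p X"
    and g: "borel_version X f g"
  shows "integrable lborel g" "integrable (lebesgue_on X) f"
proof -
  have "(\<integral>\<^sup>+z. ennreal (\<bar>g z\<bar> powr p) \<partial>lborel) < \<infinity>"
    using borel_version_Lp[OF X(1) _ g f] p by simp
  with X p g show "integrable lborel g"
    by (intro Lp_integrable_bounded_set[where p = p and X = X]) (auto simp: borel_version_def)
  then show "integrable (lebesgue_on X) f" using borel_version_integral(2)[OF X(1) g] by simp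
qed

lemma abs_diff_powr_le:
  fixes a b p :: real
  assumes "0 \<le> p"
  shows "\<bar>a - b\<bar> powr p \<le> 2 powr p * (\<bar>a\<bar> powr p + \<bar>b\<bar> powr p)"
proof -
  have "\<bar>a - b\<bar> powr p \<le> (\<bar>a\<bar> + \<bar>b\<bar>) powr p" using assms by (intro powr_mono2) auto
  also have "\<dots> \<le> 2 powr p * (\<bar>a\<bar> powr p + \<bar>b\<bar> powr p)" using assms by (intro powr_add_le) auto
  finally show ?thesis .
qed

lemma Lp_space_diff:
  assumes p: "0 \<le> p" and f: "f \<in> Lp_space p X" and g: "g \<in> Lp_space p X"
  shows "(\<lambda>z. f z - g z) \<in> Lp_space p X"
proof -
  have [measurable]: "f \<in> borel_measurable (lebesgue_on X)" "g \<in> borel_measurable (lebesgue_on X)"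
    and i: "integrable (lebesgue_on X) (\<lambda>z. \<bar>f z\<bar> powr p)" "integrable (lebesgue_on X) (\<lambda>z. \<bar>g z\<bar> powr p)"
    using f g by (auto simp: Lp_space_def)
  have "integrable (lebesgue_on X) (\<lambda>z. \<bar>f z - g z\<bar> powr p)"
  proof (rule Bochner_Integration.integrable_bound)
    show "integrable (lebesgue_on X) (\<lambda>z. 2 powr p * (\<bar>f z\<bar> powr p + \<bar>g z\<bar> powr p))"
      using i by simp
    show "AE z in lebesgue_on X. norm (\<bar>f z - g z\<bar> powr p) \<le> norm (2 powr p * (\<bar>f z\<bar> powr p + \<bar>g z\<bar> powr p))"
      using abs_diff_powr_le[OF p] by (intro AE_I2) simp
  qed measurable
  then show ?thesis by (simp add: Lp_space_def)
qed

lemma integrable_mult_bounded_continuous: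
  fixes f \<phi> :: "'b::euclidean_space \<Rightarrow> real"
  assumes X: "open X" and f: "integrable (lebesgue_on X) f"
    and \<phi>: "continuous_on X \<phi>" "\<And>z. z \<in> X \<Longrightarrow> \<bar>\<phi> z\<bar> \<le> M"
  shows "integrable (lebesgue_on X) (\<lambda>z. f z * \<phi> z)"
proof (rule Bochner_Integration.integrable_bound)
  show "integrable (lebesgue_on X) (\<lambda>z. M * f z)" using f by simp
  have "\<phi> \<in> borel_measurable (lebesgue_on X)"
    using X \<phi>(1) by (intro continuous_imp_measurable_on_sets_lebesgue) auto
  then show "(\<lambda>z. f z * \<phi> z) \<in> borel_measurable (lebesgue_on X)" using f by measurable
  show "AE z in lebesgue_on X. norm (f z * \<phi> z) \<le> norm (M * f z)"
  proof (rule AE_I2)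
    fix z assume "z \<in> space (lebesgue_on X)"
    then have "\<bar>\<phi> z\<bar> \<le> \<bar>M\<bar>" using \<phi>(2)[of z] by (simp add: space_restrict_space)
    then show "norm (f z * \<phi> z) \<le> norm (M * f z)"
      by (simp add: abs_mult mult.commute mult_right_mono)
  qed
qed

text \<open>This is what makes \<open>weak_dx\<close> of a difference meaningful: the choice operator yields a weak derivative
only once one is known to exist.\<close>

lemma is_weak_dx_diff:
  assumes \<Omega>: "open \<Omega>" "bounded \<Omega>" and p: "1 \<le> p"
    and u: "u1 \<in> Lp_space p (cyl T \<Omega>)" "u2 \<in> Lp_space p (cyl T \<Omega>)"
    and v: "is_weak_dx p T \<Omega> b u1 v1" "is_weak_dx p T \<Omega> b u2 v2"
  shows "is_weak_dx p T \<Omega> b (\<lambda>z. u1 z - u2 z) (\<lambda>z. v1 z - v2 z)"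
proof -
  let ?X = "cyl T \<Omega>"
  have X: "open ?X" "?X \<in> sets borel" "bounded ?X" using \<Omega> open_cyl bounded_cyl borel_open by blast+
  have int: "integrable (lebesgue_on ?X) f" if "f \<in> Lp_space p ?X" for f
    using borel_version_exists[OF X(2), of f] Lp_space_integrable(2)[OF X(2,3) p that] that
    by (metis (no_types, lifting) Lp_space_def mem_Collect_eq)
  have vL: "v1 \<in> Lp_space p ?X" "v2 \<in> Lp_space p ?X" using v by (auto simp: is_weak_dx_def)
  show ?thesis
    unfolding is_weak_dx_def
  proof (intro conjI ballI)
    show "(\<lambda>z. v1 z - v2 z) \<in> Lp_space p ?X" using p vL by (intro Lp_space_diff) auto
    fix \<phi> assume \<phi>: "\<phi> \<in> test_funs ?X"
    obtain M where M: "continuous_on ?X \<phi>" "continuous_on ?X (\<lambda>z. frechet_derivative \<phi> (at z) (0, b))"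
      "\<And>z. z \<in> ?X \<Longrightarrow> \<bar>\<phi> z\<bar> \<le> M" "\<And>z. z \<in> ?X \<Longrightarrow> \<bar>frechet_derivative \<phi> (at z) (0, b)\<bar> \<le> M"
      using test_funs_regularity[OF X(1) \<phi>] by metis
    note i1 = integrable_mult_bounded_continuous[OF X(1) int M(1,3)]
    note i2 = integrable_mult_bounded_continuous[OF X(1) int M(2,4)]
    show "(\<integral>z. (v1 z - v2 z) * \<phi> z \<partial>lebesgue_on ?X) =
      - (\<integral>z. (u1 z - u2 z) * frechet_derivative \<phi> (at z) (0, b) \<partial>lebesgue_on ?X)"
      using v \<phi> i1[OF vL(1)] i1[OF vL(2)] i2[OF u(1)] i2[OF u(2)]
      by (simp add: left_diff_distrib is_weak_dx_def)
  qed
qed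

lemma weak_dx_bump:
  assumes X: "cyl T \<Omega> \<in> sets borel" and v: "is_weak_dx p T \<Omega> b u v"
    and u': "borel_version (cyl T \<Omega>) u u'" and v': "borel_version (cyl T \<Omega>) v v'"
    and \<zeta>: "bump_in (cyl T \<Omega>) \<zeta>"
  shows "(\<integral>z. v' z * \<zeta> z \<partial>lborel) = - (\<integral>z. u' z * frechet_derivative \<zeta> (at z) (0, b) \<partial>lborel)"
proof -
  have "(\<integral>z. v' z * \<zeta> z \<partial>lborel) = (\<integral>z. v z * \<zeta> z \<partial>lebesgue_on (cyl T \<Omega>))"
    by (rule borel_version_integral(1)[OF X borel_version_mult[OF v' bump_in_measurable(1)[OF \<zeta>]], symmetric])
  also have "\<dots> = - (\<integral>z. u z * frechet_derivative \<zeta> (at z) (0, b) \<partial>lebesgue_on (cyl T \<Omega>))"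
    using v bump_in_test_funs[OF \<zeta>] by (simp add: is_weak_dx_def)
  also have "(\<integral>z. u z * frechet_derivative \<zeta> (at z) (0, b) \<partial>lebesgue_on (cyl T \<Omega>))
     = (\<integral>z. u' z * frechet_derivative \<zeta> (at z) (0, b) \<partial>lborel)"
    by (rule borel_version_integral(1)[OF X borel_version_mult[OF u' bump_in_measurable(2)[OF \<zeta>]]])
  finally show ?thesis .
qed

lemma integrable_mult_bump:
  assumes f: "integrable lborel f" and \<zeta>: "bump_in X \<zeta>"
  shows "integrable lborel (\<lambda>z. f z * \<zeta> z)"
proof -
  obtain M where M: "\<And>z. \<bar>\<zeta> z\<bar> \<le> M" using bump_in_bounded[OF \<zeta>] by blast
  note [measurable] = bump_in_measurable(1)[OF \<zeta>]
  show ?thesis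
  proof (rule Bochner_Integration.integrable_bound)
    show "integrable lborel (\<lambda>z. M * f z)" using f by simp
    show "AE z in lborel. norm (f z * \<zeta> z) \<le> norm (M * f z)"
    proof (rule AE_I2)
      fix z
      have "\<bar>\<zeta> z\<bar> \<le> \<bar>M\<bar>" using M[of z] by simp
      then show "norm (f z * \<zeta> z) \<le> norm (M * f z)"
        by (simp add: abs_mult mult.commute mult_right_mono)
    qed
  qed (use f in measurable)
qed

lemma set_integrable_continuous_indicator:
  fixes f :: "'b::euclidean_space \<Rightarrow> real"
  assumes "continuous_on X f" "cbox a b \<subseteq> X"
  shows "set_integrable lborel (cbox a b) (\<lambda>z. indicator X z * f z)"
proof -
  have "integrable lborel (\<lambda>z. indicator (cbox a b) z *\<^sub>R f z)"
    using assms by (intro borel_integrable_compact compact_cbox) (auto intro: continuous_on_subset)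
  also have "(\<lambda>z. indicator (cbox a b) z *\<^sub>R f z) = (\<lambda>z. indicator (cbox a b) z *\<^sub>R (indicator X z * f z))"
    using assms(2) by (auto simp: indicator_def fun_eq_iff)
  finally show ?thesis unfolding set_integrable_def .
qed

lemma AE_eq_if_same_weak_dx:
  assumes \<Omega>: "open \<Omega>" "bounded \<Omega>" and p: "1 \<le> p"
    and v: "is_weak_dx p T \<Omega> b u v1" "is_weak_dx p T \<Omega> b u v2"
    and u': "borel_version (cyl T \<Omega>) u u'"
    and v': "borel_version (cyl T \<Omega>) v1 v1'" "borel_version (cyl T \<Omega>) v2 v2'"
  shows "AE z in lborel. v1' z = v2' z"
proof -
  let ?X = "cyl T \<Omega>"
  have X: "open ?X" "?X \<in> sets borel" "bounded ?X" using \<Omega> open_cyl bounded_cyl borel_open by blast+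
  have int: "integrable lborel v1'" "integrable lborel v2'"
    using v Lp_space_integrable(1)[OF X(2,3) p] v' by (auto simp: is_weak_dx_def)
  have "AE z in lborel. z \<in> ?X \<longrightarrow> v1' z - v2' z = 0"
  proof (rule fundamental_lemma_variations[OF X(1)])
    show "(\<lambda>z. v1' z - v2' z) \<in> borel_measurable borel" using int by simp
    show "set_integrable lborel (cbox a b) (\<lambda>z. v1' z - v2' z)" for a b
      unfolding set_integrable_def using int by (intro integrable_mult_indicator) auto
    fix \<zeta> assume \<zeta>: "bump_in ?X \<zeta>"
    show "(\<integral>z. (v1' z - v2' z) * \<zeta> z \<partial>lborel) = 0"
      using weak_dx_bump[OF X(2) v(1) u' v'(1) \<zeta>] weak_dx_bump[OF X(2) v(2) u' v'(2) \<zeta>]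
        integrable_mult_bump[OF int(1) \<zeta>] integrable_mult_bump[OF int(2) \<zeta>]
      by (simp add: left_diff_distrib)
  qed
  then show ?thesis
  proof eventually_elim
    case (elim z)
    have "v1' z = 0 \<and> v2' z = 0" if "z \<notin> ?X" for z using v' that borel_version_eq_0 by metis
    then show ?case using elim by (cases "z \<in> ?X") auto
  qed
qed

text \<open>Both sides have the same pairing with every bump, the right-hand side by integration by parts. The
classical derivative is only known to be integrable on compact subsets, which is all that bumps see.\<close>

lemma weak_dx_classical:
  assumes \<Omega>: "open \<Omega>" "bounded \<Omega>" and p: "1 \<le> p"
    and h: "Ck_on 1 (cyl T \<Omega>) h" and w: "borel_version (cyl T \<Omega>) w (\<lambda>z. indicator (cyl T \<Omega>) z * h z)"
    and v: "is_weak_dx p T \<Omega> b w v" and v': "borel_version (cyl T \<Omega>) v v'"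
  shows "AE z in lborel. v' z = indicator (cyl T \<Omega>) z * frechet_derivative h (at z) (0, b)"
proof -
  let ?X = "cyl T \<Omega>"
  have X: "open ?X" "?X \<in> sets borel" "bounded ?X" using \<Omega> open_cyl bounded_cyl borel_open by blast+
  define g where "g z = indicator ?X z * frechet_derivative h (at z) (0, b)" for z
  have cont: "continuous_on ?X (\<lambda>z. frechet_derivative h (at z) (0, b))"
    using directional_derivative_continuous[of 0 ?X h] h by simp
  have g[measurable]: "g \<in> borel_measurable borel"
    using borel_version_continuous[OF X(1) cont] by (simp add: borel_version_def g_def[abs_def])
  have int: "integrable lborel v'"
    using v Lp_space_integrable(1)[OF X(2,3) p _ v'] by (simp add: is_weak_dx_def)
  have "AE z in lborel. z \<in> ?X \<longrightarrow> v' z - g z = 0"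
  proof (rule fundamental_lemma_variations[OF X(1)])
    show "(\<lambda>z. v' z - g z) \<in> borel_measurable borel" using int by measurable
    show "set_integrable lborel (cbox c d) (\<lambda>z. v' z - g z)" if "cbox c d \<subseteq> ?X" for c d
    proof (rule set_integral_diff(1))
      show "set_integrable lborel (cbox c d) v'"
        unfolding set_integrable_def using int by (intro integrable_mult_indicator) auto
      show "set_integrable lborel (cbox c d) g"
        unfolding g_def[abs_def] by (rule set_integrable_continuous_indicator[OF cont that])
    qed
    fix \<zeta> assume \<zeta>: "bump_in ?X \<zeta>"
    show "(\<integral>z. (v' z - g z) * \<zeta> z \<partial>lborel) = 0"
      using weak_dx_bump[OF X(2) v w v' \<zeta>] integration_by_parts_bump[OF X(1) h \<zeta>, of "(0, b)"]
        integrable_mult_bump[OF int(1) \<zeta>]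
      by (simp add: left_diff_distrib g_def)
  qed
  then have "AE z in lborel. v' z = g z"
  proof eventually_elim
    case (elim z)
    have "v' z = 0 \<and> g z = 0" if "z \<notin> ?X" for z using borel_version_eq_0[OF v' that] that by (simp add: g_def)
    then show ?case using elim by (cases "z \<in> ?X") auto
  qed
  then show ?thesis unfolding g_def .
qed

lemma nn_integral_lborel_pair:
  fixes f :: "'c::euclidean_space \<times> 'b::euclidean_space \<Rightarrow> ennreal"
  assumes f[measurable]: "f \<in> borel_measurable borel"
  shows "(\<integral>\<^sup>+z. f z \<partial>lborel) = (\<integral>\<^sup>+t. \<integral>\<^sup>+x. f (t, x) \<partial>lborel \<partial>lborel)"
    "(\<integral>\<^sup>+z. f z \<partial>lborel) = (\<integral>\<^sup>+x. \<integral>\<^sup>+t. f (t, x) \<partial>lborel \<partial>lborel)"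
proof -
  have m: "f \<in> borel_measurable (lborel \<Otimes>\<^sub>M lborel)" by (simp add: lborel_prod)
  show *: "(\<integral>\<^sup>+z. f z \<partial>lborel) = (\<integral>\<^sup>+t. \<integral>\<^sup>+x. f (t, x) \<partial>lborel \<partial>lborel)"
    using lborel.nn_integral_fst[OF m] by (simp add: lborel_prod)
  show "(\<integral>\<^sup>+z. f z \<partial>lborel) = (\<integral>\<^sup>+x. \<integral>\<^sup>+t. f (t, x) \<partial>lborel \<partial>lborel)"
    unfolding * by (rule lborel_pair.Fubini') (use m in \<open>simp add: case_prod_beta'\<close>)
qed

section \<open>Time slices at almost every point of the ball\<close>

lemma sum_powr_le:
  fixes a :: "'i \<Rightarrow> real"
  assumes "finite I" "\<And>i. i \<in> I \<Longrightarrow> 0 \<le> a i" "0 < p"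
  shows "(\<Sum>i\<in>I. a i) powr p \<le> real (card I) powr p * (\<Sum>i\<in>I. a i powr p)"
proof (cases "I = {}")
  case False
  define m where "m = Max (a ` I)"
  have m: "\<And>i. i \<in> I \<Longrightarrow> a i \<le> m" "m \<in> a ` I" using assms False by (auto simp: m_def)
  then obtain j where j: "j \<in> I" "m = a j" by auto
  have "(\<Sum>i\<in>I. a i) \<le> real (card I) * m" using sum_bounded_above[of I a m] m by simp
  then have "(\<Sum>i\<in>I. a i) powr p \<le> (real (card I) * m) powr p"
    using assms by (intro powr_mono2 sum_nonneg) auto
  also have "\<dots> = real (card I) powr p * a j powr p" using assms j by (simp add: powr_mult)
  also have "a j powr p \<le> (\<Sum>i\<in>I. a i powr p)"
    using assms j by (intro member_le_sum) auto
  finally show ?thesis by (simp add: mult_left_mono)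
qed auto

lemma time_slices_bound:
  fixes p :: real
  assumes p: "1 < p" "real DIM('a::euclidean_space) < p"
  obtains C where "0 < C"
    "\<And>T (h :: real \<times> 'a \<Rightarrow> real) x. Ck_on 1 (cyl T (ball 0 1)) h \<Longrightarrow> x \<in> ball 0 1 \<Longrightarrow>
       (\<integral>\<^sup>+t. ennreal (\<bar>indicator (cyl T (ball 0 1)) (t, x) * h (t, x)\<bar> powr p) \<partial>lborel)
       \<le> ennreal C * ((\<integral>\<^sup>+z. ennreal (\<bar>indicator (cyl T (ball 0 1)) z * h z\<bar> powr p) \<partial>lborel)
         + (\<integral>\<^sup>+z. ennreal ((\<Sum>b\<in>Basis. \<bar>indicator (cyl T (ball 0 1)) z * frechet_derivative h (at z) (0, b)\<bar>) powr p) \<partial>lborel))"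
proof (rule power_bound_unit_ball[OF p])
  fix C :: real
  assume C: "0 < C" and bound: "\<And>(w :: 'a \<Rightarrow> real) D x.
       (\<And>y. y \<in> ball 0 1 \<Longrightarrow> (w has_derivative D y) (at y)) \<Longrightarrow>
       (\<And>v. continuous_on (ball 0 1) (\<lambda>y. D y v)) \<Longrightarrow> x \<in> ball 0 1 \<Longrightarrow>
       ennreal (\<bar>w x\<bar> powr p) \<le> ennreal C * ((\<integral>\<^sup>+y. ennreal (indicator (ball 0 1) y * \<bar>w y\<bar> powr p) \<partial>lborel)
         + (\<integral>\<^sup>+y. ennreal (indicator (ball 0 1) y * (\<Sum>b\<in>Basis. \<bar>D y b\<bar>) powr p) \<partial>lborel))"
  show thesis
  proof (rule that[OF C])
    fix T and h :: "real \<times> 'a \<Rightarrow> real" and x :: 'a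
    let ?X = "cyl T (ball 0 1) :: (real \<times> 'a) set"
    assume h: "Ck_on 1 ?X h" and x: "x \<in> ball 0 1"
    have X: "open ?X" by (simp add: open_cyl)
    define f where "f z = indicator ?X z * h z" for z
    define g where "g z = (\<Sum>b\<in>Basis. \<bar>indicator ?X z * frechet_derivative h (at z) (0, b)\<bar>)" for z
    have [measurable]: "f \<in> borel_measurable borel"
      using borel_version_continuous[OF X Ck_on_imp_continuous_on[OF h]] by (simp add: borel_version_def f_def[abs_def])
    have cont: "continuous_on ?X (\<lambda>z. frechet_derivative h (at z) v)" for v
      using directional_derivative_continuous[of 0 ?X h] h by simp
    have [measurable]: "(\<lambda>z. indicator ?X z * frechet_derivative h (at z) v) \<in> borel_measurable borel" for v
      using borel_version_continuous[OF X cont] by (simp add: borel_version_def)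
    have [measurable]: "g \<in> borel_measurable borel" unfolding g_def by measurable
    have slice: "ennreal (\<bar>f (t, x)\<bar> powr p) \<le> ennreal C * ((\<integral>\<^sup>+y. ennreal (\<bar>f (t, y)\<bar> powr p) \<partial>lborel)
         + (\<integral>\<^sup>+y. ennreal (g (t, y) powr p) \<partial>lborel))" for t
    proof (cases "0 < t \<and> t < T")
      case False
      then show ?thesis by (auto simp: f_def cyl_def)
    next
      case True
      have in_X: "(t, y) \<in> ?X" if "y \<in> ball 0 1" for y using True that by (simp add: cyl_def)
      have "ennreal (\<bar>h (t, x)\<bar> powr p) \<le> ennreal C *
         ((\<integral>\<^sup>+y. ennreal (indicator (ball 0 1) y * \<bar>h (t, y)\<bar> powr p) \<partial>lborel)
         + (\<integral>\<^sup>+y. ennreal (indicator (ball 0 1) y * (\<Sum>b\<in>Basis. \<bar>frechet_derivative h (at (t, y)) (0, b)\<bar>) powr p) \<partial>lborel))"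
      proof (rule bound[where w = "\<lambda>y. h (t, y)" and D = "\<lambda>y v. frechet_derivative h (at (t, y)) (0, v)"])
        fix y :: 'a assume y: "y \<in> ball 0 1"
        have "((\<lambda>y. (t, y)) has_derivative (\<lambda>v. (0, v))) (at y)"
          by (auto intro!: derivative_eq_intros)
        from has_derivative_compose[OF this Ck_on_has_derivative[of 0 ?X h]]
        show "((\<lambda>y. h (t, y)) has_derivative (\<lambda>v. frechet_derivative h (at (t, y)) (0, v))) (at y)"
          using h in_X[OF y] by simp
      next
        fix v :: 'a
        show "continuous_on (ball 0 1) (\<lambda>y. frechet_derivative h (at (t, y)) (0, v))"
          by (rule continuous_on_compose2[OF cont]) (use in_X in \<open>auto intro!: continuous_intros\<close>)
      qed (rule x)
      also have "(\<lambda>y. indicator (ball 0 1) y * \<bar>h (t, y)\<bar> powr p) = (\<lambda>y. \<bar>f (t, y)\<bar> powr p)"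
        using True by (auto simp: f_def cyl_def indicator_def fun_eq_iff)
      also have "(\<lambda>y. indicator (ball 0 1) y * (\<Sum>b\<in>Basis. \<bar>frechet_derivative h (at (t, y)) (0, b)\<bar>) powr p)
           = (\<lambda>y. g (t, y) powr p)"
        using True by (auto simp: g_def cyl_def indicator_def fun_eq_iff)
      also have "h (t, x) = f (t, x)" using in_X[OF x] by (simp add: f_def)
      finally show ?thesis .
    qed
    have "(\<integral>\<^sup>+t. ennreal (\<bar>f (t, x)\<bar> powr p) \<partial>lborel) \<le>
      (\<integral>\<^sup>+t. ennreal C * ((\<integral>\<^sup>+y. ennreal (\<bar>f (t, y)\<bar> powr p) \<partial>lborel)
         + (\<integral>\<^sup>+y. ennreal (g (t, y) powr p) \<partial>lborel)) \<partial>lborel)"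
      by (rule nn_integral_mono) (rule slice)
    also have "\<dots> = ennreal C * ((\<integral>\<^sup>+t. \<integral>\<^sup>+y. ennreal (\<bar>f (t, y)\<bar> powr p) \<partial>lborel \<partial>lborel)
         + (\<integral>\<^sup>+t. \<integral>\<^sup>+y. ennreal (g (t, y) powr p) \<partial>lborel \<partial>lborel))"
      by (simp add: nn_integral_cmult nn_integral_add)
    also have "(\<integral>\<^sup>+t. \<integral>\<^sup>+y. ennreal (\<bar>f (t, y)\<bar> powr p) \<partial>lborel \<partial>lborel) = (\<integral>\<^sup>+z. ennreal (\<bar>f z\<bar> powr p) \<partial>lborel)"
      by (rule nn_integral_lborel_pair(1)[symmetric]) measurable
    also have "(\<integral>\<^sup>+t. \<integral>\<^sup>+y. ennreal (g (t, y) powr p) \<partial>lborel \<partial>lborel) = (\<integral>\<^sup>+z. ennreal (g z powr p) \<partial>lborel)"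
      by (rule nn_integral_lborel_pair(1)[symmetric]) measurable
    finally show "(\<integral>\<^sup>+t. ennreal (\<bar>indicator ?X (t, x) * h (t, x)\<bar> powr p) \<partial>lborel)
       \<le> ennreal C * ((\<integral>\<^sup>+z. ennreal (\<bar>indicator ?X z * h z\<bar> powr p) \<partial>lborel)
         + (\<integral>\<^sup>+z. ennreal ((\<Sum>b\<in>Basis. \<bar>indicator ?X z * frechet_derivative h (at z) (0, b)\<bar>) powr p) \<partial>lborel))"
      unfolding f_def g_def .
  qed
qed

lemma Lp_norm_le_W1_norm:
  "Lp_norm p (cyl T \<Omega>) u \<le> W1_norm p T \<Omega> u"
  "b \<in> Basis \<Longrightarrow> Lp_norm p (cyl T \<Omega>) (weak_dx p T \<Omega> b u) \<le> W1_norm p T \<Omega> u"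
  "0 \<le> W1_norm p T \<Omega> u"
proof -
  have s: "0 \<le> (\<Sum>b\<in>Basis. Lp_norm p (cyl T \<Omega>) (weak_dx p T \<Omega> b u))"
    by (intro sum_nonneg Lp_norm_nonneg)
  show "Lp_norm p (cyl T \<Omega>) u \<le> W1_norm p T \<Omega> u" "0 \<le> W1_norm p T \<Omega> u"
    unfolding W1_norm_def using s Lp_norm_nonneg[of p "cyl T \<Omega>" u] by auto
  assume "b \<in> Basis"
  then have "Lp_norm p (cyl T \<Omega>) (weak_dx p T \<Omega> b u) \<le> (\<Sum>b\<in>Basis. Lp_norm p (cyl T \<Omega>) (weak_dx p T \<Omega> b u))"
    by (intro member_le_sum) (auto simp: Lp_norm_nonneg)
  then show "Lp_norm p (cyl T \<Omega>) (weak_dx p T \<Omega> b u) \<le> W1_norm p T \<Omega> u"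
    unfolding W1_norm_def using Lp_norm_nonneg[of p "cyl T \<Omega>" u] by auto
qed

lemma is_weak_dx_weak_dx:
  "\<exists>v. is_weak_dx p T \<Omega> b u v \<Longrightarrow> is_weak_dx p T \<Omega> b u (weak_dx p T \<Omega> b u)"
  unfolding weak_dx_def by (rule someI_ex[where P = "is_weak_dx p T \<Omega> b u"])

text \<open>The sup bound is applied to a smooth \<open>w\<close>, and the norms of \<open>w\<close> and of its derivatives are
estimated by those of \<open>u\<close> and \<open>u - w\<close>. The function \<open>E\<close> is \<open>x \<mapsto> \<integral> \<bar>u - w\<bar>\<^sup>p dt\<close>.\<close>

lemma time_slices_bound_smooth_approx:
  fixes p :: real
  assumes p: "1 < p" "real DIM('a::euclidean_space) < p"
  obtains K where "0 < K"
    "\<And>\<alpha> T (u :: real \<times> 'a \<Rightarrow> real) w u'. u \<in> H_space \<alpha> p T (ball 0 1) \<Longrightarrow> w \<in> H_space \<alpha> p T (ball 0 1) \<Longrightarrow>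
       smooth_on ({0..T} \<times> ball 0 1) w \<Longrightarrow> borel_version (cyl T (ball 0 1)) u u' \<Longrightarrow>
       \<exists>E \<in> borel_measurable borel.
         (\<integral>\<^sup>+x. E x \<partial>lborel) \<le> ennreal (W1_norm p T (ball 0 1) (\<lambda>z. u z - w z) powr p) \<and>
         (\<forall>x\<in>ball 0 1. (\<integral>\<^sup>+t. ennreal (\<bar>u' (t, x)\<bar> powr p) \<partial>lborel) \<le> ennreal (2 powr p) * E x
             + ennreal (K * (W1_norm p T (ball 0 1) u powr p + W1_norm p T (ball 0 1) (\<lambda>z. u z - w z) powr p)))"
proof (rule time_slices_bound[OF p])
  fix C :: real
  assume C: "0 < C" and slices:
    "\<And>T (h :: real \<times> 'a \<Rightarrow> real) x. Ck_on 1 (cyl T (ball 0 1)) h \<Longrightarrow> x \<in> ball 0 1 \<Longrightarrow>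
       (\<integral>\<^sup>+t. ennreal (\<bar>indicator (cyl T (ball 0 1)) (t, x) * h (t, x)\<bar> powr p) \<partial>lborel)
       \<le> ennreal C * ((\<integral>\<^sup>+z. ennreal (\<bar>indicator (cyl T (ball 0 1)) z * h z\<bar> powr p) \<partial>lborel)
         + (\<integral>\<^sup>+z. ennreal ((\<Sum>b\<in>Basis. \<bar>indicator (cyl T (ball 0 1)) z * frechet_derivative h (at z) (0, b)\<bar>) powr p) \<partial>lborel))"
  define d where "d = real DIM('a)"
  have d: "d > 0" by (simp add: d_def)
  define L where "L = d powr p * 2 powr p"
  have L: "L > 0" using d by (simp add: L_def)
  define K where "K = 2 powr p * (C * (2 powr p + L * d))"
  have K: "K > 0" using C L d by (simp add: K_def add_pos_pos)
  show thesis
  proof (rule that[OF K])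
    fix \<alpha> T and u w u' :: "real \<times> 'a \<Rightarrow> real"
    let ?B = "ball 0 1 :: 'a set" and ?X = "cyl T (ball 0 1) :: (real \<times> 'a) set"
    assume u: "u \<in> H_space \<alpha> p T ?B" and w: "w \<in> H_space \<alpha> p T ?B"
      and sm: "smooth_on ({0..T} \<times> ?B) w" and u': "borel_version ?X u u'"
    have X: "open ?X" "?X \<in> sets borel" "bounded ?X"
      using open_cyl[OF open_ball] bounded_cyl[OF bounded_ball] borel_open by blast+
    have p0: "0 < p" "1 \<le> p" "0 \<le> p" using p by auto
    define e where "e z = u z - w z" for z
    have uL: "u \<in> Lp_space p ?X" "w \<in> Lp_space p ?X" using u w by (auto simp: H_space_def)
    have eL: "e \<in> Lp_space p ?X" unfolding e_def[abs_def] by (rule Lp_space_diff[OF p0(3) uL])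
    define v where "v b = weak_dx p T ?B b u" for b
    define vw where "vw b = weak_dx p T ?B b w" for b
    define ve where "ve b = weak_dx p T ?B b e" for b
    have v: "is_weak_dx p T ?B b u (v b)" and vw: "is_weak_dx p T ?B b w (vw b)" if "b \<in> Basis" for b
      using u w that by (auto simp: H_space_def v_def vw_def intro!: is_weak_dx_weak_dx)
    have diff: "is_weak_dx p T ?B b e (\<lambda>z. v b z - vw b z)" if "b \<in> Basis" for b
      unfolding e_def[abs_def]
      by (rule is_weak_dx_diff[OF open_ball bounded_ball p0(2) uL v[OF that] vw[OF that]])
    have ve: "is_weak_dx p T ?B b e (ve b)" if "b \<in> Basis" for b
      unfolding ve_def by (rule is_weak_dx_weak_dx) (use diff[OF that] in blast)
    obtain U h where U: "open U" "{0..T} \<times> ?B \<subseteq> U" "\<And>k. Ck_on k U h" "\<And>z. z \<in> {0..T} \<times> ?B \<Longrightarrow> h z = w z"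
      using sm unfolding smooth_on_def by blast
    have sub: "?X \<subseteq> {0..T} \<times> ?B" by (auto simp: cyl_def)
    have h: "Ck_on 1 ?X h" by (rule Ck_on_subset[OF U(3)]) (use sub U(2) in blast)
    define w' where "w' z = indicator ?X z * h z" for z
    have w'v: "borel_version ?X w w'"
    proof -
      have hw: "\<And>z. z \<in> ?X \<Longrightarrow> h z = w z" using U(4) sub by blast
      have "w \<in> borel_measurable (lebesgue_on ?X)" using uL by (simp add: Lp_space_def)
      then show ?thesis
        using borel_version_continuous[OF X(1) Ck_on_imp_continuous_on[OF h]] hw
        unfolding borel_version_def w'_def by auto
    qed
    have ev: "borel_version ?X e (\<lambda>z. u' z - w' z)"
      unfolding e_def[abs_def] by (rule borel_version_diff[OF u' w'v])
    have meas: "f \<in> borel_measurable (lebesgue_on ?X)" if "is_weak_dx p T ?B b g f" for b g f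
      using that by (simp add: is_weak_dx_def Lp_space_def)
    have "\<forall>b\<in>Basis. \<exists>g. borel_version ?X (v b) g" using borel_version_exists[OF X(2) meas[OF v]] by metis
    then obtain v' where v': "\<And>b. b \<in> Basis \<Longrightarrow> borel_version ?X (v b) (v' b)" by metis
    have "\<forall>b\<in>Basis. \<exists>g. borel_version ?X (vw b) g" using borel_version_exists[OF X(2) meas[OF vw]] by metis
    then obtain vw' where vw': "\<And>b. b \<in> Basis \<Longrightarrow> borel_version ?X (vw b) (vw' b)" by metis
    have "\<forall>b\<in>Basis. \<exists>g. borel_version ?X (ve b) g" using borel_version_exists[OF X(2) meas[OF ve]] by metis
    then obtain ve' where ve': "\<And>b. b \<in> Basis \<Longrightarrow> borel_version ?X (ve b) (ve' b)" by metis
    define W where "W = W1_norm p T ?B u"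
    define We where "We = W1_norm p T ?B e"
    have W0: "0 \<le> W" "0 \<le> We" by (simp_all add: W_def We_def Lp_norm_le_W1_norm)
    have bnd: "(\<integral>\<^sup>+z. ennreal (\<bar>g z\<bar> powr p) \<partial>lborel) \<le> ennreal (c powr p)"
      if "borel_version ?X f g" "f \<in> Lp_space p ?X" "Lp_norm p ?X f \<le> c" for f g c
      unfolding borel_version_Lp[OF X(2) p0(1) that(1,2)]
      using that(3) p0 by (intro ennreal_leI powr_mono2) (auto simp: Lp_norm_nonneg)
    have b_u: "(\<integral>\<^sup>+z. ennreal (\<bar>u' z\<bar> powr p) \<partial>lborel) \<le> ennreal (W powr p)"
      by (rule bnd[OF u' uL(1)]) (simp add: W_def Lp_norm_le_W1_norm)
    have b_e: "(\<integral>\<^sup>+z. ennreal (\<bar>u' z - w' z\<bar> powr p) \<partial>lborel) \<le> ennreal (We powr p)"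
      by (rule bnd[OF ev eL]) (simp add: We_def Lp_norm_le_W1_norm)
    have b_v: "(\<integral>\<^sup>+z. ennreal (\<bar>v' b z\<bar> powr p) \<partial>lborel) \<le> ennreal (W powr p)" if "b \<in> Basis" for b
      by (rule bnd[OF v'[OF that]]) (use v[OF that] that in \<open>auto simp: is_weak_dx_def W_def v_def Lp_norm_le_W1_norm\<close>)
    have b_ve: "(\<integral>\<^sup>+z. ennreal (\<bar>ve' b z\<bar> powr p) \<partial>lborel) \<le> ennreal (We powr p)" if "b \<in> Basis" for b
      by (rule bnd[OF ve'[OF that]]) (use ve[OF that] that in \<open>auto simp: is_weak_dx_def We_def ve_def Lp_norm_le_W1_norm\<close>)
    have [measurable]: "u' \<in> borel_measurable borel" "w' \<in> borel_measurable borel"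
      using u' w'v by (auto simp: borel_version_def)
    have m_v[measurable]: "v' b \<in> borel_measurable borel" "ve' b \<in> borel_measurable borel" if "b \<in> Basis" for b
      using v'[OF that] ve'[OF that] by (auto simp: borel_version_def)
    have grad: "AE z in lborel. \<forall>b\<in>Basis. indicator ?X z * frechet_derivative h (at z) (0, b) = v' b z - ve' b z"
    proof (subst AE_ball_countable)
      show "countable (Basis :: 'a set)" by (simp add: countable_finite)
      show "\<forall>b\<in>Basis. AE z in lborel. indicator ?X z * frechet_derivative h (at z) (0, b) = v' b z - ve' b z"
      proof
        fix b :: 'a assume b: "b \<in> Basis"
        have "AE z in lborel. vw' b z = indicator ?X z * frechet_derivative h (at z) (0, b)"
          by (rule weak_dx_classical[OF open_ball bounded_ball p0(2) h w'v[unfolded w'_def[abs_def]] vw[OF b] vw'[OF b]])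
        moreover have "AE z in lborel. ve' b z = v' b z - vw' b z"
          by (rule AE_eq_if_same_weak_dx[OF open_ball bounded_ball p0(2) ve[OF b] diff[OF b] ev ve'[OF b]
              borel_version_diff[OF v'[OF b] vw'[OF b]]])
        ultimately show "AE z in lborel. indicator ?X z * frechet_derivative h (at z) (0, b) = v' b z - ve' b z"
          by eventually_elim simp
      qed
    qed
    have b_w: "(\<integral>\<^sup>+z. ennreal (\<bar>w' z\<bar> powr p) \<partial>lborel) \<le> ennreal (2 powr p * (W powr p + We powr p))"
    proof -
      have "(\<integral>\<^sup>+z. ennreal (\<bar>w' z\<bar> powr p) \<partial>lborel)
        \<le> (\<integral>\<^sup>+z. ennreal (2 powr p) * (ennreal (\<bar>u' z\<bar> powr p) + ennreal (\<bar>u' z - w' z\<bar> powr p)) \<partial>lborel)"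
      proof (rule nn_integral_mono)
        fix z
        show "ennreal (\<bar>w' z\<bar> powr p) \<le> ennreal (2 powr p) * (ennreal (\<bar>u' z\<bar> powr p) + ennreal (\<bar>u' z - w' z\<bar> powr p))"
          using abs_diff_powr_le[OF p0(3), of "u' z" "u' z - w' z"]
          by (simp add: ennreal_mult'[symmetric] ennreal_plus[symmetric] ennreal_leI del: ennreal_plus)
      qed
      also have "\<dots> = ennreal (2 powr p) * ((\<integral>\<^sup>+z. ennreal (\<bar>u' z\<bar> powr p) \<partial>lborel) + (\<integral>\<^sup>+z. ennreal (\<bar>u' z - w' z\<bar> powr p) \<partial>lborel))"
        by (simp add: nn_integral_cmult nn_integral_add)
      also have "\<dots> \<le> ennreal (2 powr p) * (ennreal (W powr p) + ennreal (We powr p))"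
        by (intro mult_left_mono add_mono b_u b_e) auto
      also have "\<dots> = ennreal (2 powr p * (W powr p + We powr p))"
        by (simp add: ennreal_mult'[symmetric] ennreal_plus[symmetric] del: ennreal_plus)
      finally show ?thesis .
    qed
    have b_g: "(\<integral>\<^sup>+z. ennreal ((\<Sum>b\<in>Basis. \<bar>indicator ?X z * frechet_derivative h (at z) (0, b)\<bar>) powr p) \<partial>lborel)
       \<le> ennreal (L * (d * (W powr p + We powr p)))"
    proof -
      have "(\<integral>\<^sup>+z. ennreal ((\<Sum>b\<in>Basis. \<bar>indicator ?X z * frechet_derivative h (at z) (0, b)\<bar>) powr p) \<partial>lborel)
        \<le> (\<integral>\<^sup>+z. ennreal L * (\<Sum>b\<in>Basis. ennreal (\<bar>v' b z\<bar> powr p) + ennreal (\<bar>ve' b z\<bar> powr p)) \<partial>lborel)"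
      proof (rule nn_integral_mono_AE, use grad in eventually_elim)
        case (elim z)
        have "(\<Sum>b\<in>Basis. \<bar>indicator ?X z * frechet_derivative h (at z) (0, b)\<bar>) powr p
           = (\<Sum>b\<in>Basis. \<bar>v' b z - ve' b z\<bar>) powr p"
          using elim by simp
        also have "\<dots> \<le> d powr p * (\<Sum>b\<in>Basis. \<bar>v' b z - ve' b z\<bar> powr p)"
          unfolding d_def using p0 by (intro sum_powr_le) auto
        also have "\<dots> \<le> d powr p * (\<Sum>b\<in>Basis. 2 powr p * (\<bar>v' b z\<bar> powr p + \<bar>ve' b z\<bar> powr p))"
          by (intro mult_left_mono sum_mono abs_diff_powr_le p0) auto
        also have "\<dots> = L * (\<Sum>b\<in>Basis. \<bar>v' b z\<bar> powr p + \<bar>ve' b z\<bar> powr p)"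
          by (simp only: L_def sum_distrib_left[symmetric] mult.assoc)
        finally have "ennreal ((\<Sum>b\<in>Basis. \<bar>indicator ?X z * frechet_derivative h (at z) (0, b)\<bar>) powr p)
          \<le> ennreal (L * (\<Sum>b\<in>Basis. \<bar>v' b z\<bar> powr p + \<bar>ve' b z\<bar> powr p))" by (rule ennreal_leI)
        also have "\<dots> = ennreal L * (\<Sum>b\<in>Basis. ennreal (\<bar>v' b z\<bar> powr p + \<bar>ve' b z\<bar> powr p))"
          using L by (subst sum_ennreal) (auto simp: ennreal_mult')
        finally show ?case by simp
      qed
      also have "\<dots> = ennreal L * (\<Sum>b\<in>Basis. (\<integral>\<^sup>+z. ennreal (\<bar>v' b z\<bar> powr p) \<partial>lborel) + (\<integral>\<^sup>+z. ennreal (\<bar>ve' b z\<bar> powr p) \<partial>lborel))"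
        by (simp add: nn_integral_cmult nn_integral_sum nn_integral_add)
      also have "\<dots> \<le> ennreal L * (\<Sum>b\<in>(Basis::'a set). ennreal (W powr p) + ennreal (We powr p))"
        by (intro mult_left_mono sum_mono add_mono b_v b_ve) auto
      also have "\<dots> = ennreal (L * (d * (W powr p + We powr p)))"
        using L d by (simp add: ennreal_mult'[symmetric] ennreal_plus[symmetric] d_def ennreal_of_nat_eq_real_of_nat del: ennreal_plus)
      finally show ?thesis .
    qed
    define E where "E x = (\<integral>\<^sup>+t. ennreal (\<bar>u' (t, x) - w' (t, x)\<bar> powr p) \<partial>lborel)" for x
    show "\<exists>E \<in> borel_measurable borel.
         (\<integral>\<^sup>+x. E x \<partial>lborel) \<le> ennreal (W1_norm p T ?B (\<lambda>z. u z - w z) powr p) \<and>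
         (\<forall>x\<in>?B. (\<integral>\<^sup>+t. ennreal (\<bar>u' (t, x)\<bar> powr p) \<partial>lborel) \<le> ennreal (2 powr p) * E x
             + ennreal (K * (W1_norm p T ?B u powr p + W1_norm p T ?B (\<lambda>z. u z - w z) powr p)))"
      unfolding e_def[symmetric] W_def[symmetric] We_def[symmetric]
    proof (intro bexI[of _ E] conjI ballI)
      show "E \<in> borel_measurable borel" unfolding E_def by measurable
      have "(\<integral>\<^sup>+x. E x \<partial>lborel) = (\<integral>\<^sup>+z. ennreal (\<bar>u' z - w' z\<bar> powr p) \<partial>lborel)"
        unfolding E_def by (rule nn_integral_lborel_pair(2)[symmetric, where f = "\<lambda>z. ennreal (\<bar>u' z - w' z\<bar> powr p)"]) measurable
      then show "(\<integral>\<^sup>+x. E x \<partial>lborel) \<le> ennreal (We powr p)" using b_e by simp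
      fix x :: 'a assume x: "x \<in> ?B"
      have "(\<integral>\<^sup>+t. ennreal (\<bar>w' (t, x)\<bar> powr p) \<partial>lborel)
         \<le> ennreal C * (ennreal (2 powr p * (W powr p + We powr p)) + ennreal (L * (d * (W powr p + We powr p))))"
        using slices[OF h x] unfolding w'_def[symmetric]
        by (rule order_trans) (intro mult_left_mono add_mono b_w b_g, simp)
      also have "\<dots> = ennreal (C * (2 powr p * (W powr p + We powr p) + L * (d * (W powr p + We powr p))))"
        using C L d by (simp add: ennreal_mult ennreal_plus)
      finally have w_slice: "(\<integral>\<^sup>+t. ennreal (\<bar>w' (t, x)\<bar> powr p) \<partial>lborel) \<le> \<dots>" .
      have "(\<integral>\<^sup>+t. ennreal (\<bar>u' (t, x)\<bar> powr p) \<partial>lborel)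
        \<le> (\<integral>\<^sup>+t. ennreal (2 powr p) * (ennreal (\<bar>u' (t, x) - w' (t, x)\<bar> powr p) + ennreal (\<bar>w' (t, x)\<bar> powr p)) \<partial>lborel)"
      proof (rule nn_integral_mono)
        fix t
        show "ennreal (\<bar>u' (t, x)\<bar> powr p) \<le> ennreal (2 powr p) * (ennreal (\<bar>u' (t, x) - w' (t, x)\<bar> powr p) + ennreal (\<bar>w' (t, x)\<bar> powr p))"
          using abs_diff_powr_le[OF p0(3), of "u' (t, x) - w' (t, x)" "- w' (t, x)"]
          by (simp add: ennreal_mult'[symmetric] ennreal_plus[symmetric] ennreal_leI del: ennreal_plus)
      qed
      also have "\<dots> = ennreal (2 powr p) * (E x + (\<integral>\<^sup>+t. ennreal (\<bar>w' (t, x)\<bar> powr p) \<partial>lborel))"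
        unfolding E_def by (simp add: nn_integral_cmult nn_integral_add)
      also have "\<dots> \<le> ennreal (2 powr p) * (E x + ennreal (C * (2 powr p * (W powr p + We powr p) + L * (d * (W powr p + We powr p)))))"
        by (intro mult_left_mono add_left_mono w_slice) auto
      also have "\<dots> = ennreal (2 powr p) * E x + ennreal (K * (W powr p + We powr p))"
      proof -
        have "2 powr p * (C * (2 powr p * (W powr p + We powr p) + L * (d * (W powr p + We powr p)))) = K * (W powr p + We powr p)"
          by (simp add: K_def algebra_simps)
        then show ?thesis by (simp add: distrib_left ennreal_mult'[symmetric])
      qed
      finally show "(\<integral>\<^sup>+t. ennreal (\<bar>u' (t, x)\<bar> powr p) \<partial>lborel) \<le> ennreal (2 powr p) * E x + ennreal (K * (W powr p + We powr p))" .
    qed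
  qed
qed

text \<open>Along the approximating sequence the error term tends to \<open>0\<close> only in the mean over \<open>x\<close>. So the excess of the
slice integral over the claimed bound, cut off at \<open>0\<close>, has integral \<open>0\<close>. The subtraction of extended
nonnegative reals is this cut-off difference.\<close>

lemma sup_time_Lp_bound:
  fixes p :: real
  assumes p: "1 < p" "real DIM('a::euclidean_space) < p"
  obtains K where "0 < K"
    "\<And>\<alpha> T (u :: real \<times> 'a \<Rightarrow> real) u'. u \<in> H0_space \<alpha> p T (ball 0 1) \<Longrightarrow>
       borel_version (cyl T (ball 0 1)) u u' \<Longrightarrow>
       AE x in lborel. (\<integral>\<^sup>+t. ennreal (\<bar>u' (t, x)\<bar> powr p) \<partial>lborel) \<le> ennreal (K * W1_norm p T (ball 0 1) u powr p)"
proof (rule time_slices_bound_smooth_approx[OF p])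
  fix K :: real
  assume K: "0 < K" and approx:
    "\<And>\<alpha> T (u :: real \<times> 'a \<Rightarrow> real) w u'. u \<in> H_space \<alpha> p T (ball 0 1) \<Longrightarrow> w \<in> H_space \<alpha> p T (ball 0 1) \<Longrightarrow>
       smooth_on ({0..T} \<times> ball 0 1) w \<Longrightarrow> borel_version (cyl T (ball 0 1)) u u' \<Longrightarrow>
       \<exists>E \<in> borel_measurable borel.
         (\<integral>\<^sup>+x. E x \<partial>lborel) \<le> ennreal (W1_norm p T (ball 0 1) (\<lambda>z. u z - w z) powr p) \<and>
         (\<forall>x\<in>ball 0 1. (\<integral>\<^sup>+t. ennreal (\<bar>u' (t, x)\<bar> powr p) \<partial>lborel) \<le> ennreal (2 powr p) * E x
             + ennreal (K * (W1_norm p T (ball 0 1) u powr p + W1_norm p T (ball 0 1) (\<lambda>z. u z - w z) powr p)))"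
  define V where "V = measure lborel (ball (0::'a) 1)"
  have V: "emeasure lborel (ball (0::'a) 1) = ennreal V"
    unfolding V_def using emeasure_bounded_finite[OF bounded_ball, of "0::'a" 1] by (intro emeasure_eq_ennreal_measure) auto
  show thesis
  proof (rule that[OF K])
    fix \<alpha> T and u u' :: "real \<times> 'a \<Rightarrow> real"
    let ?B = "ball 0 1 :: 'a set" and ?X = "cyl T (ball 0 1) :: (real \<times> 'a) set"
    assume u: "u \<in> H0_space \<alpha> p T ?B" and u': "borel_version ?X u u'"
    have [measurable]: "u' \<in> borel_measurable borel" using u' by (simp add: borel_version_def)
    have B[measurable]: "?B \<in> sets borel" by simp
    obtain w where w: "\<And>n. w n \<in> H_space \<alpha> p T ?B" "\<And>n. smooth_on ({0..T} \<times> ?B) (w n)"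
      and lim: "(\<lambda>n. H_norm \<alpha> p T ?B (\<lambda>z. u z - w n z)) \<longlonglongrightarrow> 0" and uH: "u \<in> H_space \<alpha> p T ?B"
      using u unfolding H0_space_def by blast
    define We where "We n = W1_norm p T ?B (\<lambda>z. u z - w n z)" for n :: nat
    define W where "W = W1_norm p T ?B u"
    have We: "We \<longlonglongrightarrow> 0"
    proof (rule tendsto_sandwich[OF _ _ tendsto_const lim])
      show "\<forall>\<^sub>F n in sequentially. 0 \<le> We n" by (simp add: We_def Lp_norm_le_W1_norm)
      show "\<forall>\<^sub>F n in sequentially. We n \<le> H_norm \<alpha> p T ?B (\<lambda>z. u z - w n z)"
        by (simp add: We_def H_norm_def Lp_norm_nonneg)
    qed
    define Ux where "Ux x = (\<integral>\<^sup>+t. ennreal (\<bar>u' (t, x)\<bar> powr p) \<partial>lborel)" for x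
    have [measurable]: "Ux \<in> borel_measurable borel" unfolding Ux_def by measurable
    define c where "c = K * W powr p"
    have out: "Ux x = 0" if "x \<notin> ?B" for x
    proof -
      have "u' (t, x) = 0" for t using u' that by (auto simp: borel_version_def cyl_def)
      then show ?thesis by (simp add: Ux_def)
    qed
    have le: "(\<integral>\<^sup>+x. Ux x - ennreal c \<partial>lborel) \<le> ennreal ((2 powr p + K * V) * We n powr p)" for n
    proof -
      obtain E where [measurable]: "E \<in> borel_measurable borel"
        and E: "(\<integral>\<^sup>+x. E x \<partial>lborel) \<le> ennreal (We n powr p)"
        and Ub: "\<And>x. x \<in> ?B \<Longrightarrow> Ux x \<le> ennreal (2 powr p) * E x + ennreal (K * (W powr p + We n powr p))"
        using approx[OF uH w(1)[of n] w(2)[of n] u'] unfolding We_def W_def Ux_def by blast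
      have "(\<integral>\<^sup>+x. Ux x - ennreal c \<partial>lborel) \<le> (\<integral>\<^sup>+x. ennreal (2 powr p) * E x + ennreal (K * We n powr p) * indicator ?B x \<partial>lborel)"
      proof (rule nn_integral_mono)
        fix x
        show "Ux x - ennreal c \<le> ennreal (2 powr p) * E x + ennreal (K * We n powr p) * indicator ?B x"
        proof (cases "x \<in> ?B")
          case True
          have "ennreal (K * (W powr p + We n powr p)) = ennreal c + ennreal (K * We n powr p)"
            using K by (simp add: c_def distrib_left)
          then have "Ux x \<le> ennreal c + (ennreal (2 powr p) * E x + ennreal (K * We n powr p))"
            using Ub[OF True] by (simp add: add_ac)
          then show ?thesis using True by (simp add: ennreal_minus_le_iff)
        qed (simp add: out)
      qed
      also have "\<dots> = ennreal (2 powr p) * (\<integral>\<^sup>+x. E x \<partial>lborel) + ennreal (K * We n powr p) * ennreal V"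
      proof -
        have "(\<integral>\<^sup>+x. ennreal (K * We n powr p) * indicator ?B x \<partial>lborel) = ennreal (K * We n powr p) * ennreal V"
          by (subst nn_integral_cmult_indicator) (simp_all only: V, simp)
        moreover have "(\<integral>\<^sup>+x. ennreal (2 powr p) * E x \<partial>lborel) = ennreal (2 powr p) * (\<integral>\<^sup>+x. E x \<partial>lborel)"
          by (rule nn_integral_cmult) measurable
        moreover have "(\<integral>\<^sup>+x. ennreal (2 powr p) * E x + ennreal (K * We n powr p) * indicator ?B x \<partial>lborel)
           = (\<integral>\<^sup>+x. ennreal (2 powr p) * E x \<partial>lborel) + (\<integral>\<^sup>+x. ennreal (K * We n powr p) * indicator ?B x \<partial>lborel)"
          by (rule nn_integral_add) (use B in \<open>simp_all\<close>)
        ultimately show ?thesis by (simp only:)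
      qed
      also have "\<dots> \<le> ennreal (2 powr p) * ennreal (We n powr p) + ennreal (K * We n powr p) * ennreal V"
        by (intro add_right_mono mult_left_mono E) auto
      also have "\<dots> = ennreal ((2 powr p + K * V) * We n powr p)"
      proof -
        have "V \<ge> 0" by (simp add: V_def)
        have eq: "(2 powr p + K * V) * We n powr p = 2 powr p * We n powr p + K * We n powr p * V"
          by (simp add: algebra_simps)
        show ?thesis
          unfolding eq by (rule ennreal_mult_add) (use K \<open>V \<ge> 0\<close> in auto)
      qed
      finally show ?thesis .
    qed
    have small: "(\<integral>\<^sup>+x. Ux x - ennreal c \<partial>lborel) \<le> 0 + ennreal \<epsilon>" if "\<epsilon> > 0" for \<epsilon>
    proof -
      have "(\<lambda>n. (2 powr p + K * V) * We n powr p) \<longlonglongrightarrow> (2 powr p + K * V) * 0 powr p"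
        using p by (intro tendsto_intros We tendsto_powr') (auto simp: We_def Lp_norm_le_W1_norm)
      then have "\<forall>\<^sub>F n in sequentially. (2 powr p + K * V) * We n powr p < \<epsilon>"
        using that by (simp add: order_tendstoD)
      then obtain n where "(2 powr p + K * V) * We n powr p < \<epsilon>"
        by (auto simp: eventually_sequentially)
      then show ?thesis using le[of n] by (simp add: ennreal_leI order_trans less_imp_le)
    qed
    have "(\<integral>\<^sup>+x. Ux x - ennreal c \<partial>lborel) \<le> 0"
      by (rule ennreal_le_epsilon) (rule small)
    then have "(\<integral>\<^sup>+x. Ux x - ennreal c \<partial>lborel) = 0" by simp
    then have "AE x in lborel. Ux x - ennreal c = 0"
      by (subst (asm) nn_integral_0_iff_AE) auto
    then show "AE x in lborel. (\<integral>\<^sup>+t. ennreal (\<bar>u' (t, x)\<bar> powr p) \<partial>lborel) \<le> ennreal (K * W1_norm p T ?B u powr p)"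
      by eventually_elim (auto simp: Ux_def c_def W_def diff_eq_0_iff_ennreal)
  qed
qed

section \<open>Convolution and correlation in time\<close>

lemma AE_lborel_pair_snd:
  fixes P :: "'c::euclidean_space \<times> 'b::euclidean_space \<Rightarrow> bool"
  assumes "AE z in lborel. P z"
  shows "AE x in lborel. AE t in lborel. P (t, x)"
proof -
  obtain N where N: "{z \<in> space lborel. \<not> P z} \<subseteq> N" "N \<in> null_sets lborel"
    using assms by (auto elim!: AE_E simp: null_sets_def)
  have [measurable]: "N \<in> sets borel" using N(2) by auto
  have "(\<integral>\<^sup>+x. \<integral>\<^sup>+t. indicator N (t, x) \<partial>lborel \<partial>lborel) = (\<integral>\<^sup>+z. indicator N z \<partial>lborel)"
    by (rule nn_integral_lborel_pair(2)[symmetric]) measurable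
  also have "\<dots> = 0" using N(2) by auto
  finally have "AE x in lborel. (\<integral>\<^sup>+t. indicator N (t, x) \<partial>lborel) = 0"
    by (subst (asm) nn_integral_0_iff_AE) auto
  then show ?thesis
  proof eventually_elim
    case (elim x)
    then have "AE t in lborel. indicator N (t, x) = (0::ennreal)"
      by (subst (asm) nn_integral_0_iff_AE) auto
    then show ?case
    proof eventually_elim
      case (elim t)
      then show ?case using N(1) by (auto simp: indicator_def split: if_splits)
    qed
  qed
qed

definition time_conv :: "(real \<Rightarrow> real) \<Rightarrow> (real \<times> 'a::euclidean_space \<Rightarrow> real) \<Rightarrow> real \<times> 'a \<Rightarrow> real" where
  "time_conv k f z = (\<integral>r. k r * f (z - (r, 0)) \<partial>lborel)"

text \<open>Correlation with \<open>k\<close> is the adjoint of convolution with \<open>k\<close>. For the Riemann-Liouville kernel it is the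
right-sided fractional integral.\<close>

definition time_corr :: "(real \<Rightarrow> real) \<Rightarrow> (real \<times> 'a::euclidean_space \<Rightarrow> real) \<Rightarrow> real \<times> 'a \<Rightarrow> real" where
  "time_corr k f z = (\<integral>r. k r * f (z + (r, 0)) \<partial>lborel)"

lemma lborel_integral_translate:
  fixes f :: "'b::euclidean_space \<Rightarrow> real"
  assumes [measurable]: "f \<in> borel_measurable borel"
  shows "(\<integral>z. f (z + w) \<partial>lborel) = (\<integral>z. f z \<partial>lborel)"
proof -
  have "(\<integral>z. f z \<partial>distr lborel borel ((+) w)) = (\<integral>z. f (w + z) \<partial>lborel)" by (subst integral_distr) auto
  then show ?thesis by (simp add: lborel_distr_plus add.commute)
qed

lemma lborel_integrable_translate:
  fixes f :: "'b::euclidean_space \<Rightarrow> real"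
  assumes "integrable lborel f"
  shows "integrable lborel (\<lambda>z. f (z + w))"
proof -
  have "integrable (distr lborel borel ((+) w)) f" using assms by (simp add: lborel_distr_plus)
  then show ?thesis
    using assms by (subst (asm) integrable_distr_eq) (auto simp: add.commute)
qed

lemma integrable_time_conv_kernel:
  fixes f :: "real \<times> 'a::euclidean_space \<Rightarrow> real"
  assumes k: "integrable lborel k" and f: "integrable lborel f"
  shows "integrable (lborel \<Otimes>\<^sub>M lborel) (\<lambda>(r, z). k r * f (z + (c * r, 0)))"
proof -
  have [measurable]: "k \<in> borel_measurable borel" "f \<in> borel_measurable borel" using k f by auto
  show ?thesis
  proof (rule lborel_pair.Fubini_integrable)
    have "(\<integral>z. norm (k r * f (z + (c * r, 0))) \<partial>lborel) = \<bar>k r\<bar> * (\<integral>z. \<bar>f z\<bar> \<partial>lborel)" for r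
      using lborel_integral_translate[of "\<lambda>z. \<bar>f z\<bar>" "(c * r, 0)"] by (simp add: abs_mult)
    then show "integrable lborel (\<lambda>r. \<integral>z. norm (case (r, z) of (r, z) \<Rightarrow> k r * f (z + (c * r, 0))) \<partial>lborel)"
      using k by simp
    show "AE r in lborel. integrable lborel (\<lambda>z. case (r, z) of (r, z) \<Rightarrow> k r * f (z + (c * r, 0)))"
      using lborel_integrable_translate[OF f] by (intro AE_I2) simp
  qed measurable
qed

lemma integrable_time_conv:
  fixes f :: "real \<times> 'a::euclidean_space \<Rightarrow> real"
  assumes k: "integrable lborel k" and f: "integrable lborel f"
  shows "integrable lborel (time_conv k f)"
  using lborel_pair.integrable_snd[OF integrable_time_conv_kernel[OF k f, of "-1"]]
  by (simp add: time_conv_def[abs_def] diff_conv_add_uminus del: add_uminus_conv_diff)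

lemma time_conv_adjoint:
  fixes f \<eta> :: "real \<times> 'a::euclidean_space \<Rightarrow> real"
  assumes k: "integrable lborel k" and f: "integrable lborel f"
    and [measurable]: "\<eta> \<in> borel_measurable borel" and M: "\<And>z. \<bar>\<eta> z\<bar> \<le> M"
  shows "(\<integral>z. time_conv k f z * \<eta> z \<partial>lborel) = (\<integral>z. f z * time_corr k \<eta> z \<partial>lborel)"
proof -
  have [measurable]: "k \<in> borel_measurable borel" "f \<in> borel_measurable borel" using k f by auto
  have bound: "integrable (lborel \<Otimes>\<^sub>M lborel) (\<lambda>(r, z). k r * f (z + (c * r, 0)) * \<eta> (z + (d * r, 0)))" for c d
  proof (rule Bochner_Integration.integrable_bound)
    show "integrable (lborel \<Otimes>\<^sub>M lborel) (\<lambda>z. M * (case z of (r, z) \<Rightarrow> k r * f (z + (c * r, 0))))"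
      using integrable_time_conv_kernel[OF k f] by simp
    show "AE z in lborel \<Otimes>\<^sub>M lborel. norm (case z of (r, z) \<Rightarrow> k r * f (z + (c * r, 0)) * \<eta> (z + (d * r, 0)))
       \<le> norm (M * (case z of (r, z) \<Rightarrow> k r * f (z + (c * r, 0))))"
    proof (rule AE_I2, clarify)
      fix r :: real and t :: real and x :: 'a
      have "\<bar>\<eta> ((t, x) + (d * r, 0))\<bar> \<le> \<bar>M\<bar>" using M[of "(t, x) + (d * r, 0)"] by linarith
      then show "norm (k r * f ((t, x) + (c * r, 0)) * \<eta> ((t, x) + (d * r, 0)))
         \<le> norm (M * (k r * f ((t, x) + (c * r, 0))))"
        using mult_left_mono[OF _ abs_ge_zero[of "k r * f ((t, x) + (c * r, 0))"]]
        by (fastforce simp: abs_mult mult_ac)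
    qed
  qed measurable
  have "(\<integral>z. time_conv k f z * \<eta> z \<partial>lborel) = (\<integral>z. \<integral>r. k r * f (z + (- 1 * r, 0)) * \<eta> (z + (0 * r, 0)) \<partial>lborel \<partial>lborel)"
    by (simp add: time_conv_def diff_conv_add_uminus zero_prod_def[symmetric] del: add_uminus_conv_diff)
  also have "\<dots> = (\<integral>r. \<integral>z. k r * f (z + (- 1 * r, 0)) * \<eta> (z + (0 * r, 0)) \<partial>lborel \<partial>lborel)"
    by (rule lborel_pair.Fubini_integral[OF bound])
  also have "\<dots> = (\<integral>r. \<integral>z. k r * f (z + (0 * r, 0)) * \<eta> (z + (1 * r, 0)) \<partial>lborel \<partial>lborel)"
  proof (rule Bochner_Integration.integral_cong[OF refl])
    fix r
    show "(\<integral>z. k r * f (z + (- 1 * r, 0)) * \<eta> (z + (0 * r, 0)) \<partial>lborel)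
      = (\<integral>z. k r * f (z + (0 * r, 0)) * \<eta> (z + (1 * r, 0)) \<partial>lborel)"
      using lborel_integral_translate[of "\<lambda>z. k r * f (z + (- 1 * r, 0)) * \<eta> (z + (0 * r, 0))" "(r, 0)"]
      by (simp add: add.assoc)
  qed
  also have "\<dots> = (\<integral>z. \<integral>r. k r * f (z + (0 * r, 0)) * \<eta> (z + (1 * r, 0)) \<partial>lborel \<partial>lborel)"
    by (rule lborel_pair.Fubini_integral[OF bound, symmetric])
  also have "\<dots> = (\<integral>z. f z * time_corr k \<eta> z \<partial>lborel)"
  proof (rule Bochner_Integration.integral_cong[OF refl])
    fix z :: "real \<times> 'a"
    have "(\<lambda>r. k r * f (z + (0 * r, 0)) * \<eta> (z + (1 * r, 0))) = (\<lambda>r. f z * (k r * \<eta> (z + (r, 0))))"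
      by (simp add: zero_prod_def[symmetric] mult_ac)
    then show "(\<integral>r. k r * f (z + (0 * r, 0)) * \<eta> (z + (1 * r, 0)) \<partial>lborel) = f z * time_corr k \<eta> z"
      by (simp only: time_corr_def integral_mult_right_zero)
  qed
  finally show ?thesis .
qed

definition smooth_supported :: "'b::euclidean_space set \<Rightarrow> ('b \<Rightarrow> real) \<Rightarrow> bool" where
  "smooth_supported K \<zeta> \<longleftrightarrow> (\<forall>k. Ck_on k UNIV \<zeta>) \<and> (\<forall>z. z \<notin> K \<longrightarrow> \<zeta> z = 0)"

lemma smooth_supported_derivative:
  assumes "smooth_supported K \<zeta>" "closed K"
  shows "smooth_supported K (\<lambda>z. frechet_derivative \<zeta> (at z) v)"
  unfolding smooth_supported_def
proof (intro conjI allI impI)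
  fix k
  have "Ck_on (Suc k) UNIV \<zeta>" using assms unfolding smooth_supported_def by blast
  then show "Ck_on k UNIV (\<lambda>z. frechet_derivative \<zeta> (at z) v)" by simp
next
  fix z assume "z \<notin> K"
  then show "frechet_derivative \<zeta> (at z) v = 0"
    using assms by (intro frechet_derivative_eq_0_on_open[of "- K"]) (auto simp: smooth_supported_def)
qed

lemma smooth_supported_bounded:
  assumes "smooth_supported K \<zeta>" "compact K"
  obtains M where "\<And>z. \<bar>\<zeta> z\<bar> \<le> M"
proof -
  have "continuous_on K \<zeta>"
    using assms Ck_on_imp_continuous_on[of 0 UNIV \<zeta>] unfolding smooth_supported_def
    by (meson continuous_on_subset subset_UNIV)
  then have "bounded (\<zeta> ` K)" using assms by (intro compact_imp_bounded compact_continuous_image)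
  then obtain M where M: "\<And>z. z \<in> K \<Longrightarrow> \<bar>\<zeta> z\<bar> \<le> M" unfolding bounded_iff by (metis imageI real_norm_def)
  have "\<bar>\<zeta> z\<bar> \<le> max M 0" for z
    using assms M[of z] by (cases "z \<in> K") (auto simp: smooth_supported_def le_max_iff_disj)
  then show thesis by (rule that)
qed

lemma smooth_supported_measurable: "smooth_supported K \<zeta> \<Longrightarrow> \<zeta> \<in> borel_measurable borel"
  using Ck_on_imp_continuous_on[of 0 UNIV \<zeta>] unfolding smooth_supported_def
  by (metis borel_measurable_continuous_onI)

lemma smooth_supported_Lipschitz:
  fixes \<zeta> :: "'b::euclidean_space \<Rightarrow> real"
  assumes "smooth_supported K \<zeta>" "compact K"
  obtains L where "\<And>z v. \<bar>frechet_derivative \<zeta> (at z) v\<bar> \<le> L * norm v" "\<And>z w. \<bar>\<zeta> (z + w) - \<zeta> z\<bar> \<le> L * norm w"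
proof -
  have C: "Ck_on 1 UNIV \<zeta>" using assms by (simp add: smooth_supported_def)
  have "\<forall>b. \<exists>M. \<forall>z. \<bar>frechet_derivative \<zeta> (at z) b\<bar> \<le> M"
    using smooth_supported_bounded[OF smooth_supported_derivative[OF assms(1) compact_imp_closed[OF assms(2)]] assms(2)]
    by metis
  then obtain M where M: "\<And>b z. \<bar>frechet_derivative \<zeta> (at z) b\<bar> \<le> M b" by metis
  define L where "L = (\<Sum>b\<in>Basis. M b)"
  have der: "(\<zeta> has_derivative frechet_derivative \<zeta> (at z)) (at z)" for z
    using C by (intro Ck_on_has_derivative[of 0 UNIV]) auto
  have 1: "\<bar>frechet_derivative \<zeta> (at z) v\<bar> \<le> L * norm v" for z v
  proof -
    have lin: "linear (frechet_derivative \<zeta> (at z))" by (rule has_derivative_linear[OF der])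
    have "frechet_derivative \<zeta> (at z) v = frechet_derivative \<zeta> (at z) (\<Sum>b\<in>Basis. (v \<bullet> b) *\<^sub>R b)"
      by (simp only: euclidean_representation)
    also have "\<dots> = (\<Sum>b\<in>Basis. (v \<bullet> b) * frechet_derivative \<zeta> (at z) b)"
      by (subst linear_sum[OF lin]) (simp add: linear_scale[OF lin])
    finally have "\<bar>frechet_derivative \<zeta> (at z) v\<bar> \<le> (\<Sum>b\<in>Basis. \<bar>(v \<bullet> b) * frechet_derivative \<zeta> (at z) b\<bar>)"
      by (simp add: sum_abs)
    also have "\<dots> \<le> (\<Sum>b\<in>Basis. norm v * M b)"
      by (intro sum_mono) (auto simp: abs_mult intro!: mult_mono Basis_le_norm M)
    also have "\<dots> = L * norm v" by (simp only: L_def sum_distrib_right) (simp add: mult.commute)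
    finally show ?thesis .
  qed
  have 2: "\<bar>\<zeta> (z + w) - \<zeta> z\<bar> \<le> L * norm w" for z w
  proof -
    have "norm (\<zeta> (z + w) - \<zeta> z) \<le> L * norm ((z + w) - z)"
    proof (rule differentiable_bound[of UNIV])
      show "(\<zeta> has_derivative frechet_derivative \<zeta> (at x)) (at x within UNIV)" for x using der by simp
      show "onorm (frechet_derivative \<zeta> (at x)) \<le> L" for x
        by (rule onorm_le) (use 1 in simp)
    qed auto
    then show ?thesis by simp
  qed
  show thesis by (rule that[OF 1 2])
qed

text \<open>The difference quotients of \<open>\<zeta>\<close> are bounded by its Lipschitz constant, so differentiation under the
integral is dominated convergence against the kernel, which only has to be integrable because all
derivatives fall on \<open>\<zeta>\<close>.\<close>

lemma time_corr_has_derivative: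
  fixes \<zeta> :: "real \<times> 'a::euclidean_space \<Rightarrow> real"
  assumes k: "integrable lborel k" and \<zeta>: "smooth_supported K \<zeta>" "compact K"
  shows "(time_corr k \<zeta> has_derivative (\<lambda>v. time_corr k (\<lambda>z. frechet_derivative \<zeta> (at z) v) z)) (at z)"
proof -
  have [measurable]: "k \<in> borel_measurable borel" using k by auto
  have int: "integrable lborel (\<lambda>r. k r * \<xi> (z + (r, 0)))" if \<xi>: "smooth_supported K \<xi>" for \<xi> :: "real \<times> 'a \<Rightarrow> real" and z
  proof -
    obtain M where M: "\<And>z. \<bar>\<xi> z\<bar> \<le> M" using smooth_supported_bounded[OF \<xi> \<zeta>(2)] by blast
    have [measurable]: "\<xi> \<in> borel_measurable borel" by (rule smooth_supported_measurable[OF \<xi>])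
    show ?thesis
    proof (rule Bochner_Integration.integrable_bound)
      show "integrable lborel (\<lambda>r. M * k r)" using k by simp
      show "AE r in lborel. norm (k r * \<xi> (z + (r, 0))) \<le> norm (M * k r)"
      proof (rule AE_I2)
        fix r
        have "\<bar>\<xi> (z + (r, 0))\<bar> \<le> \<bar>M\<bar>" using M[of "z + (r, 0)"] by linarith
        then show "norm (k r * \<xi> (z + (r, 0))) \<le> norm (M * k r)"
          using mult_left_mono[OF _ abs_ge_zero[of "k r"]] by (fastforce simp: abs_mult mult.commute)
      qed
    qed measurable
  qed
  define D where "D v = time_corr k (\<lambda>z. frechet_derivative \<zeta> (at z) v) z" for v
  have C: "Ck_on 1 UNIV \<zeta>" using \<zeta> by (simp add: smooth_supported_def)
  have der: "(\<zeta> has_derivative frechet_derivative \<zeta> (at z)) (at z)" for z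
    using C by (intro Ck_on_has_derivative[of 0 UNIV]) auto
  have lin: "linear (frechet_derivative \<zeta> (at z))" for z by (rule has_derivative_linear[OF der])
  have \<zeta>': "smooth_supported K (\<lambda>z. frechet_derivative \<zeta> (at z) v)" for v
    by (rule smooth_supported_derivative[OF \<zeta>(1) compact_imp_closed[OF \<zeta>(2)]])
  have [measurable]: "\<zeta> \<in> borel_measurable borel" "(\<lambda>z. frechet_derivative \<zeta> (at z) v) \<in> borel_measurable borel" for v
    using smooth_supported_measurable \<zeta>(1) \<zeta>' by blast+
  obtain L where L: "\<And>z v. \<bar>frechet_derivative \<zeta> (at z) v\<bar> \<le> L * norm v" "\<And>z w. \<bar>\<zeta> (z + w) - \<zeta> z\<bar> \<le> L * norm w"
    using smooth_supported_Lipschitz[OF \<zeta>] by blast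
  have linD: "linear D"
  proof (rule linearI)
    show "D (v + w) = D v + D w" for v w
      unfolding D_def time_corr_def using int[OF \<zeta>'[of v], of z] int[OF \<zeta>'[of w], of z]
      by (simp add: linear_add[OF lin] distrib_left)
    show "D (c *\<^sub>R v) = c *\<^sub>R D v" for c v
      unfolding D_def time_corr_def by (simp add: linear_scale[OF lin] mult.left_commute)
  qed
  have quot: "((\<lambda>w. (time_corr k \<zeta> (z + w) - time_corr k \<zeta> z - D w) / norm w) \<longlongrightarrow> 0) (at 0)"
    unfolding tendsto_at_iff_sequentially comp_def
  proof (intro allI impI)
    fix w :: "nat \<Rightarrow> real \<times> 'a"
    assume w0: "\<forall>n. w n \<in> UNIV - {0}" and w: "w \<longlonglongrightarrow> 0"
    define R where "R n r = (\<zeta> (z + (r, 0) + w n) - \<zeta> (z + (r, 0)) - frechet_derivative \<zeta> (at (z + (r, 0))) (w n)) / norm (w n)" for n r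
    have eq: "(time_corr k \<zeta> (z + w n) - time_corr k \<zeta> z - D (w n)) / norm (w n) = (\<integral>r. k r * R n r \<partial>lborel)" for n
    proof -
      have "time_corr k \<zeta> (z + w n) - time_corr k \<zeta> z - D (w n)
         = (\<integral>r. k r * \<zeta> (z + w n + (r, 0)) - k r * \<zeta> (z + (r, 0)) - k r * frechet_derivative \<zeta> (at (z + (r, 0))) (w n) \<partial>lborel)"
        unfolding D_def time_corr_def using int[OF \<zeta>(1)] int[OF \<zeta>'] by simp
      also have "\<dots> = (\<integral>r. k r * R n r * norm (w n) \<partial>lborel)"
      proof (intro Bochner_Integration.integral_cong refl)
        fix r
        have "R n r * norm (w n) = \<zeta> (z + (r, 0) + w n) - \<zeta> (z + (r, 0)) - frechet_derivative \<zeta> (at (z + (r, 0))) (w n)"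
          using w0 by (simp add: R_def)
        then show "k r * \<zeta> (z + w n + (r, 0)) - k r * \<zeta> (z + (r, 0)) - k r * frechet_derivative \<zeta> (at (z + (r, 0))) (w n)
           = k r * R n r * norm (w n)"
          by (simp add: mult.assoc right_diff_distrib add.assoc add.commute[of "w n"])
      qed
      finally show ?thesis using w0 by simp
    qed
    have "(\<lambda>n. \<integral>r. k r * R n r \<partial>lborel) \<longlonglongrightarrow> (\<integral>r. 0 \<partial>(lborel :: real measure))"
    proof (rule integral_dominated_convergence[where w = "\<lambda>r. 2 * L * \<bar>k r\<bar>"])
      show "AE r in lborel. (\<lambda>n. k r * R n r) \<longlonglongrightarrow> 0"
      proof (rule AE_I2)
        fix r
        have "((\<lambda>w. norm (\<zeta> (z + (r, 0) + w) - \<zeta> (z + (r, 0)) - frechet_derivative \<zeta> (at (z + (r, 0))) w) / norm w) \<longlongrightarrow> 0) (at 0)"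
          using der[of "z + (r, 0)"] by (simp only: has_derivative_at)
        then have "((\<lambda>w. (\<zeta> (z + (r, 0) + w) - \<zeta> (z + (r, 0)) - frechet_derivative \<zeta> (at (z + (r, 0))) w) / norm w) \<longlongrightarrow> 0) (at 0)"
          by - (rule tendsto_norm_zero_cancel, simp add: norm_divide)
        then have "(\<lambda>n. R n r) \<longlonglongrightarrow> 0"
          unfolding tendsto_at_iff_sequentially comp_def R_def using w0 w by blast
        then show "(\<lambda>n. k r * R n r) \<longlonglongrightarrow> 0" using tendsto_mult_right_zero by blast
      qed
      show "AE r in lborel. norm (k r * R n r) \<le> 2 * L * \<bar>k r\<bar>" for n
      proof (rule AE_I2)
        fix r
        have "\<bar>\<zeta> (z + (r, 0) + w n) - \<zeta> (z + (r, 0)) - frechet_derivative \<zeta> (at (z + (r, 0))) (w n)\<bar> \<le> 2 * L * norm (w n)"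
          using L(2)[of "z + (r, 0)" "w n"] L(1)[of "z + (r, 0)" "w n"] by linarith
        then have "\<bar>R n r\<bar> \<le> 2 * L"
          using w0 by (simp add: R_def pos_divide_le_eq)
        then show "norm (k r * R n r) \<le> 2 * L * \<bar>k r\<bar>"
          using mult_left_mono[OF _ abs_ge_zero[of "k r"]] by (fastforce simp: abs_mult mult.commute)
      qed
      show "(\<lambda>r. k r * R n r) \<in> borel_measurable lborel" for n unfolding R_def by measurable
    qed (use k in auto)
    then show "(\<lambda>n. (time_corr k \<zeta> (z + w n) - time_corr k \<zeta> z - D (w n)) / norm (w n)) \<longlonglongrightarrow> 0"
      unfolding eq by simp
  qed
  have "(time_corr k \<zeta> has_derivative D) (at z)"
    unfolding has_derivative_at
  proof
    show "bounded_linear D" using linD by (simp add: linear_conv_bounded_linear)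
    show "((\<lambda>w. norm (time_corr k \<zeta> (z + w) - time_corr k \<zeta> z - D w) / norm w) \<longlongrightarrow> 0) (at 0)"
      using tendsto_norm_zero[OF quot] by simp
  qed
  then show ?thesis unfolding D_def .
qed

lemma Ck_on_time_corr:
  fixes \<zeta> :: "real \<times> 'a::euclidean_space \<Rightarrow> real"
  assumes k: "integrable lborel k" and K: "compact K" and \<zeta>: "smooth_supported K \<zeta>"
  shows "Ck_on n UNIV (time_corr k \<zeta>)"
  using \<zeta>
proof (induction n arbitrary: \<zeta>)
  case 0
  have "continuous_on UNIV (time_corr k \<zeta>)"
    by (rule has_derivative_continuous_on) (use time_corr_has_derivative[OF k 0 K] in simp)
  then show ?case by simp
next
  case (Suc n)
  show ?case
    by (rule Ck_on_SucI[OF open_UNIV time_corr_has_derivative[OF k Suc.prems K]])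
       (intro Suc.IH smooth_supported_derivative Suc.prems compact_imp_closed K)
qed

section \<open>Inverting the fractional derivative\<close>

lemma smooth_supported_eq_0: "smooth_supported K \<zeta> \<Longrightarrow> z \<notin> K \<Longrightarrow> \<zeta> z = 0"
  by (simp add: smooth_supported_def)

text \<open>The truncation at \<open>T\<close> makes the kernel integrable and does not change convolutions before time \<open>T\<close> with functions that
vanish for negative times.\<close>

definition rl_kernel_upto :: "real \<Rightarrow> real \<Rightarrow> real \<Rightarrow> real" where
  "rl_kernel_upto T \<gamma> r = indicator {..<T} r * rl_kernel \<gamma> r"

lemma rl_kernel_upto_measurable [measurable]: "rl_kernel_upto T \<gamma> \<in> borel_measurable borel"
  unfolding rl_kernel_upto_def by measurable

lemma integrable_rl_kernel_upto:
  assumes "0 < \<gamma>" "0 < T"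
  shows "integrable lborel (rl_kernel_upto T \<gamma>)"
proof (rule integrableI_bounded)
  have G: "Gamma \<gamma> > 0" using assms by (simp add: Gamma_real_pos)
  have "(\<integral>\<^sup>+r. ennreal (norm (rl_kernel_upto T \<gamma> r)) \<partial>lborel)
    = (\<integral>\<^sup>+r. ennreal (1 / Gamma \<gamma>) * ennreal (indicator {0<..<T} r * r powr (\<gamma> - 1)) \<partial>lborel)"
    using G by (intro nn_integral_cong) (auto simp: rl_kernel_upto_def rl_kernel_def indicator_def ennreal_mult'[symmetric])
  also have "\<dots> = ennreal (1 / Gamma \<gamma>) * ennreal (T powr \<gamma> / \<gamma>)"
    using nn_integral_powr_from_0[of "\<gamma> - 1" T] assms by (simp add: nn_integral_cmult)
  also have "\<dots> < \<infinity>" by (simp add: ennreal_mult_less_top)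
  finally show "(\<integral>\<^sup>+r. ennreal (norm (rl_kernel_upto T \<gamma> r)) \<partial>lborel) < \<infinity>" .
qed simp

text \<open>After scaling to the unit interval this is the Beta integral \<open>B(1-\<alpha>, \<alpha>) = \<Gamma>(1-\<alpha>) \<Gamma>(\<alpha>)\<close>. It expresses that the
fractional integrals of orders \<open>1-\<alpha>\<close> and \<open>\<alpha>\<close> compose to ordinary integration.\<close>

lemma rl_kernel_conv_eq_1:
  assumes \<alpha>: "0 < \<alpha>" "\<alpha> < 1" and \<sigma>: "0 < \<sigma>"
  shows "(\<integral>r. rl_kernel (1 - \<alpha>) r * rl_kernel \<alpha> (\<sigma> - r) \<partial>lborel) = 1"
proof -
  define c where "c = Gamma (1 - \<alpha>) * Gamma \<alpha>"
  have c: "c > 0" using \<alpha> by (simp add: c_def Gamma_real_pos)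
  define b where "b t = indicator {0..1} t * (t powr ((1 - \<alpha>) - 1) * (1 - t) powr (\<alpha> - 1))" for t :: real
  have "has_bochner_integral lborel b (Beta (1 - \<alpha>) \<alpha>)"
  proof (rule has_bochner_integral_nn_integral)
    have "(\<integral>\<^sup>+t. ennreal (b t) \<partial>lborel) = (\<integral>\<^sup>+t\<in>{0..1}. ennreal (t powr ((1 - \<alpha>) - 1) * (1 - t) powr (\<alpha> - 1)) \<partial>lborel)"
      by (intro nn_integral_cong) (auto simp: b_def indicator_def)
    also have "\<dots> = ennreal (Beta (1 - \<alpha>) \<alpha>)"
      by (rule nn_integral_has_integral_lebesgue'[OF _ has_integral_Beta_real]) (use \<alpha> in auto)
    finally show "(\<integral>\<^sup>+t. ennreal (b t) \<partial>lborel) = ennreal (Beta (1 - \<alpha>) \<alpha>)" .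
    show "0 \<le> Beta (1 - \<alpha>) \<alpha>" using \<alpha> by (simp add: Beta_def Gamma_real_nonneg)
    show "b \<in> borel_measurable lborel" unfolding b_def by measurable
    show "AE t in lborel. 0 \<le> b t" by (simp add: b_def)
  qed
  moreover have "Beta (1 - \<alpha>) \<alpha> = c" by (simp add: Beta_def c_def)
  ultimately have b: "(\<integral>t. b t \<partial>lborel) = c" by (simp add: has_bochner_integral_iff)
  have "(\<integral>r. rl_kernel (1 - \<alpha>) r * rl_kernel \<alpha> (\<sigma> - r) \<partial>lborel)
     = \<sigma> * (\<integral>t. rl_kernel (1 - \<alpha>) (0 + \<sigma> * t) * rl_kernel \<alpha> (\<sigma> - (0 + \<sigma> * t)) \<partial>lborel)"
    using \<sigma> by (subst lborel_integral_real_affine[of \<sigma> _ 0]) auto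
  also have "(\<integral>t. rl_kernel (1 - \<alpha>) (0 + \<sigma> * t) * rl_kernel \<alpha> (\<sigma> - (0 + \<sigma> * t)) \<partial>lborel) = (\<integral>t. 1 / (\<sigma> * c) * b t \<partial>lborel)"
  proof (rule Bochner_Integration.integral_cong[OF refl])
    fix t :: real
    consider "t \<le> 0" | "1 \<le> t" | "0 < t" "t < 1" by linarith
    then show "rl_kernel (1 - \<alpha>) (0 + \<sigma> * t) * rl_kernel \<alpha> (\<sigma> - (0 + \<sigma> * t)) = 1 / (\<sigma> * c) * b t"
    proof cases
      case 1
      then have "\<sigma> * t \<le> 0" using \<sigma> by (simp add: mult_le_0_iff)
      then show ?thesis using 1 by (cases "t = 0") (auto simp: rl_kernel_nonpos b_def)
    next
      case 2
      then have "\<sigma> - \<sigma> * t \<le> 0" using \<sigma> by simp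
      then show ?thesis using 2 by (cases "t = 1") (auto simp: rl_kernel_nonpos b_def)
    next
      case 3
      have e: "\<sigma> - \<sigma> * t = \<sigma> * (1 - t)" by (simp add: algebra_simps)
      have p: "\<sigma> * t > 0" "\<sigma> * (1 - t) > 0" using 3 \<sigma> by auto
      have "\<sigma> powr (- \<alpha>) * \<sigma> powr (\<alpha> - 1) = \<sigma> powr (- \<alpha> + (\<alpha> - 1))"
        by (simp only: powr_add)
      also have "\<dots> = 1 / \<sigma>" using \<sigma> by (simp add: powr_minus_divide)
      finally have "\<sigma> powr (- \<alpha>) * \<sigma> powr (\<alpha> - 1) = 1 / \<sigma>" .
      moreover have "(\<sigma> * t) powr (- \<alpha>) * (\<sigma> * (1 - t)) powr (\<alpha> - 1)
          = (\<sigma> powr (- \<alpha>) * \<sigma> powr (\<alpha> - 1)) * (t powr (- \<alpha>) * (1 - t) powr (\<alpha> - 1))"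
        using 3 \<sigma> by (simp add: powr_mult)
      ultimately have "(\<sigma> * t) powr (- \<alpha>) * (\<sigma> * (1 - t)) powr (\<alpha> - 1) = 1 / \<sigma> * (t powr (- \<alpha>) * (1 - t) powr (\<alpha> - 1))"
        by (simp only:)
      then show ?thesis using 3 p by (simp add: rl_kernel_pos e b_def c_def)
    qed
  qed
  also have "\<dots> = 1 / \<sigma>" using b c by simp
  finally show ?thesis using \<sigma> by simp
qed

text \<open>Below \<open>T\<close> the convolution of the two truncated kernels is that of the full kernels, namely \<open>1\<close> on the positive
half-line, and \<open>H\<close> vanishes from \<open>T\<close> on.\<close>

lemma rl_kernel_upto_compose:
  fixes H :: "real \<Rightarrow> real"
  assumes \<alpha>: "0 < \<alpha>" "\<alpha> < 1" and T: "0 < T"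
    and [measurable]: "H \<in> borel_measurable borel" and M: "\<And>\<sigma>. \<bar>H \<sigma>\<bar> \<le> M" and H0: "\<And>\<sigma>. T \<le> \<sigma> \<Longrightarrow> H \<sigma> = 0"
  shows "(\<integral>r. rl_kernel_upto T (1 - \<alpha>) r * (\<integral>\<rho>. rl_kernel_upto T \<alpha> \<rho> * H (r + \<rho>) \<partial>lborel) \<partial>lborel)
     = (\<integral>\<sigma>. indicator {0<..} \<sigma> * H \<sigma> \<partial>lborel)"
proof -
  define k where "k = rl_kernel_upto T \<alpha>"
  define k' where "k' = rl_kernel_upto T (1 - \<alpha>)"
  have int: "integrable lborel k" "integrable lborel k'"
    using \<alpha> T by (auto simp: k_def k'_def intro!: integrable_rl_kernel_upto)
  have [measurable]: "k \<in> borel_measurable borel" "k' \<in> borel_measurable borel" by (simp_all add: k_def k'_def)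
  have kk: "integrable (lborel \<Otimes>\<^sub>M lborel) (\<lambda>(r, \<sigma>). k' r * k (\<sigma> - r))"
  proof (rule lborel_pair.Fubini_integrable)
    have "(\<integral>\<sigma>. norm (k' r * k (\<sigma> - r)) \<partial>lborel) = \<bar>k' r\<bar> * (\<integral>\<sigma>. \<bar>k \<sigma>\<bar> \<partial>lborel)" for r
      using lborel_integral_translate[of "\<lambda>\<sigma>. \<bar>k \<sigma>\<bar>" "- r"] by (simp add: abs_mult)
    then show "integrable lborel (\<lambda>r. \<integral>\<sigma>. norm (case (r, \<sigma>) of (r, \<sigma>) \<Rightarrow> k' r * k (\<sigma> - r)) \<partial>lborel)"
      using int by simp
    show "AE r in lborel. integrable lborel (\<lambda>\<sigma>. case (r, \<sigma>) of (r, \<sigma>) \<Rightarrow> k' r * k (\<sigma> - r))"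
      using lborel_integrable_translate[OF int(1), of "- r" for r] by (intro AE_I2) simp
  qed measurable
  have kkH: "integrable (lborel \<Otimes>\<^sub>M lborel) (\<lambda>(r, \<sigma>). k' r * k (\<sigma> - r) * H \<sigma>)"
  proof (rule Bochner_Integration.integrable_bound)
    show "integrable (lborel \<Otimes>\<^sub>M lborel) (\<lambda>z. M * (case z of (r, \<sigma>) \<Rightarrow> k' r * k (\<sigma> - r)))" using kk by simp
    show "AE z in lborel \<Otimes>\<^sub>M lborel. norm (case z of (r, \<sigma>) \<Rightarrow> k' r * k (\<sigma> - r) * H \<sigma>)
       \<le> norm (M * (case z of (r, \<sigma>) \<Rightarrow> k' r * k (\<sigma> - r)))"
    proof (rule AE_I2, clarify)
      fix r \<sigma> :: real
      have "\<bar>H \<sigma>\<bar> \<le> \<bar>M\<bar>" using M[of \<sigma>] by linarith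
      then show "norm (k' r * k (\<sigma> - r) * H \<sigma>) \<le> norm (M * (k' r * k (\<sigma> - r)))"
        using mult_left_mono[OF _ abs_ge_zero[of "k' r * k (\<sigma> - r)"]] by (fastforce simp: abs_mult mult_ac)
    qed
  qed measurable
  have "(\<integral>r. k' r * (\<integral>\<rho>. k \<rho> * H (r + \<rho>) \<partial>lborel) \<partial>lborel) = (\<integral>r. \<integral>\<sigma>. k' r * k (\<sigma> - r) * H \<sigma> \<partial>lborel \<partial>lborel)"
  proof (rule Bochner_Integration.integral_cong[OF refl])
    fix r
    have "(\<integral>\<rho>. k \<rho> * H (r + \<rho>) \<partial>lborel) = (\<integral>\<sigma>. k (\<sigma> - r) * H \<sigma> \<partial>lborel)"
      using lborel_integral_translate[of "\<lambda>\<sigma>. k \<sigma> * H (r + \<sigma>)" "- r"] by simp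
    then show "k' r * (\<integral>\<rho>. k \<rho> * H (r + \<rho>) \<partial>lborel) = (\<integral>\<sigma>. k' r * k (\<sigma> - r) * H \<sigma> \<partial>lborel)"
      by (simp add: mult.assoc)
  qed
  also have "\<dots> = (\<integral>\<sigma>. \<integral>r. k' r * k (\<sigma> - r) * H \<sigma> \<partial>lborel \<partial>lborel)"
    by (rule lborel_pair.Fubini_integral[OF kkH, symmetric])
  also have "\<dots> = (\<integral>\<sigma>. indicator {0<..} \<sigma> * H \<sigma> \<partial>lborel)"
  proof (rule Bochner_Integration.integral_cong[OF refl])
    fix \<sigma> :: real
    show "(\<integral>r. k' r * k (\<sigma> - r) * H \<sigma> \<partial>lborel) = indicator {0<..} \<sigma> * H \<sigma>"
    proof (cases "T \<le> \<sigma>")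
      case True
      then show ?thesis by (simp add: H0)
    next
      case False
      have eq: "k' r * k (\<sigma> - r) = rl_kernel (1 - \<alpha>) r * rl_kernel \<alpha> (\<sigma> - r)" for r
        using False by (auto simp: k_def k'_def rl_kernel_upto_def rl_kernel_def indicator_def)
      show ?thesis
      proof (cases "0 < \<sigma>")
        case True
        then show ?thesis using rl_kernel_conv_eq_1[OF \<alpha> True] by (simp add: eq)
      next
        case False
        then have "k' r * k (\<sigma> - r) = 0" for r
          unfolding eq by (cases "r \<le> 0") (auto simp: rl_kernel_nonpos)
        then show ?thesis using False by (simp only:) simp
      qed
    qed
  qed
  finally show ?thesis unfolding k_def k'_def .
qed

text \<open>The two right-sided fractional integrals compose to integration over \<open>(t,T)\<close>, which turns
\<open>\<partial>\<^sub>t\<zeta>\<close> back into \<open>-\<zeta>\<close> because \<open>\<zeta>\<close> vanishes at time \<open>T\<close>.\<close>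

lemma time_corr_inverse:
  fixes \<zeta> :: "real \<times> 'a::euclidean_space \<Rightarrow> real"
  assumes \<alpha>: "0 < \<alpha>" "\<alpha> < 1" and T: "0 < T"
    and \<zeta>: "smooth_supported K \<zeta>" "compact K" and K: "\<And>z. z \<in> K \<Longrightarrow> fst z < T" and z: "0 < fst z"
  shows "time_corr (rl_kernel_upto T (1 - \<alpha>)) (time_corr (rl_kernel_upto T \<alpha>) (\<lambda>z. frechet_derivative \<zeta> (at z) (1, 0))) z = - \<zeta> z"
proof -
  define \<eta> where "\<eta> z = frechet_derivative \<zeta> (at z) (1, 0)" for z
  have \<eta>: "smooth_supported K \<eta>"
    unfolding \<eta>_def[abs_def] by (rule smooth_supported_derivative[OF \<zeta>(1) compact_imp_closed[OF \<zeta>(2)]])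
  note [measurable] = smooth_supported_measurable[OF \<eta>]
  obtain M where M: "\<And>z. \<bar>\<eta> z\<bar> \<le> M" using smooth_supported_bounded[OF \<eta> \<zeta>(2)] by blast
  define H where "H \<sigma> = \<eta> (z + (\<sigma>, 0))" for \<sigma>
  have out: "z + (\<sigma>, 0) \<notin> K" if "T \<le> \<sigma>" for \<sigma>
    using K[of "z + (\<sigma>, 0)"] that z by auto
  have H0: "H \<sigma> = 0" if "T \<le> \<sigma>" for \<sigma>
    using smooth_supported_eq_0[OF \<eta> out[OF that]] by (simp add: H_def)
  have C: "Ck_on 1 UNIV \<zeta>" "Ck_on 0 UNIV \<eta>" using \<zeta>(1) \<eta> by (auto simp: smooth_supported_def)
  have contH: "continuous_on UNIV H"
    unfolding H_def using C(2) by (auto intro!: continuous_on_compose2[of UNIV \<eta>] continuous_intros)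
  have [measurable]: "H \<in> borel_measurable borel" by (rule borel_measurable_continuous_onI[OF contH])
  have "time_corr (rl_kernel_upto T (1 - \<alpha>)) (time_corr (rl_kernel_upto T \<alpha>) \<eta>) z
    = (\<integral>r. rl_kernel_upto T (1 - \<alpha>) r * (\<integral>\<rho>. rl_kernel_upto T \<alpha> \<rho> * H (r + \<rho>) \<partial>lborel) \<partial>lborel)"
    by (simp add: time_corr_def H_def add.assoc)
  also have "\<dots> = (\<integral>\<sigma>. indicator {0<..} \<sigma> * H \<sigma> \<partial>lborel)"
    by (rule rl_kernel_upto_compose[OF \<alpha> T _ _ H0, where M = M]) (use M in \<open>auto simp: H_def\<close>)
  also have "\<dots> = (\<integral>\<sigma>. indicator {0..T} \<sigma> *\<^sub>R H \<sigma> \<partial>lborel)"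
  proof (rule integral_cong_AE)
    show "AE \<sigma> in lborel. indicator {0<..} \<sigma> * H \<sigma> = indicator {0..T} \<sigma> *\<^sub>R H \<sigma>"
      using AE_lborel_singleton[of 0]
    proof eventually_elim
      case (elim \<sigma>)
      then show ?case using H0[of \<sigma>] by (auto simp: indicator_def)
    qed
  qed measurable
  also have "\<dots> = \<zeta> (z + (T, 0)) - \<zeta> (z + (0, 0))"
  proof (rule integral_FTC_Icc[where F = "\<lambda>\<sigma>. \<zeta> (z + (\<sigma>, 0))"])
    fix \<sigma> :: real
    have "((\<lambda>\<sigma>. z + (\<sigma>, 0)) has_derivative (\<lambda>h. (h, 0))) (at \<sigma> within {0..T})"
      by (auto intro!: derivative_eq_intros)
    from has_derivative_compose[OF this Ck_on_has_derivative[of 0 UNIV \<zeta>]] C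
    have "((\<lambda>\<sigma>. \<zeta> (z + (\<sigma>, 0))) has_derivative (\<lambda>h. frechet_derivative \<zeta> (at (z + (\<sigma>, 0))) (h, 0))) (at \<sigma> within {0..T})"
      by simp
    moreover have "frechet_derivative \<zeta> (at y) (h, 0) = h *\<^sub>R \<eta> y" for h y
    proof -
      have "\<zeta> differentiable at y" using Ck_on_has_derivative[of 0 UNIV \<zeta> y] C(1) by (metis One_nat_def UNIV_I differentiableI)
      from linear_scale[OF linear_frechet_derivative[OF this], of h "(1, 0)"] show ?thesis by (simp add: \<eta>_def)
    qed
    ultimately show "((\<lambda>\<sigma>. \<zeta> (z + (\<sigma>, 0))) has_vector_derivative H \<sigma>) (at \<sigma> within {0..T})"
      by (simp add: has_vector_derivative_def H_def)
  qed (use T continuous_on_subset[OF contH] in auto)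
  also have "\<zeta> (z + (T, 0)) = 0" using smooth_supported_eq_0[OF \<zeta>(1) out[of T]] by simp
  finally show ?thesis by (simp add: \<eta>_def[abs_def] zero_prod_def[symmetric])
qed

lemma frac_int_eq_time_conv:
  fixes u :: "real \<times> 'a::euclidean_space \<Rightarrow> real"
  assumes \<gamma>: "0 < \<gamma>" and t: "0 < t" "t < T" and x: "x \<in> \<Omega>"
    and u': "u' \<in> borel_measurable borel" "\<And>z. z \<notin> cyl T \<Omega> \<Longrightarrow> u' z = 0"
    and ae: "AE s in lborel. (s, x) \<in> cyl T \<Omega> \<longrightarrow> u (s, x) = u' (s, x)"
  shows "frac_int \<gamma> u (t, x) = time_conv (rl_kernel_upto T \<gamma>) u' (t, x)"
proof -
  have G: "Gamma \<gamma> > 0" using \<gamma> by (simp add: Gamma_real_pos)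
  note u'(1)[measurable]
  define F where "F s = (t - s) powr (\<gamma> - 1) * u (s, x)" for s
  define F' where "F' s = indicator {0..t} s * ((t - s) powr (\<gamma> - 1) * u' (s, x))" for s
  have F'[measurable]: "F' \<in> borel_measurable borel" unfolding F'_def by measurable
  have aeF: "AE s in lborel. indicator {0..t} s * F s = F' s"
    using ae AE_lborel_singleton[of 0]
  proof eventually_elim
    case (elim s)
    then show ?case using t x by (auto simp: F_def F'_def cyl_def indicator_def)
  qed
  have "borel_version {0..t} F F'"
    unfolding borel_version_def
  proof (intro conjI)
    have "(\<lambda>s. indicator {0..t} s * F s) \<in> borel_measurable lebesgue"
    proof (rule borel_measurable_AE[of F'])
      show "F' \<in> borel_measurable lebesgue" by (rule measurable_completion) measurable
      show "AE s in lebesgue. F' s = indicator {0..t} s * F s"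
        using AE_completion[OF aeF] by eventually_elim simp
    qed
    then show "F \<in> borel_measurable (lebesgue_on {0..t})"
      by (subst borel_measurable_restrict_space_iff) (auto simp: mult.commute)
    show "AE s in lborel. s \<in> {0..t} \<longrightarrow> F s = F' s"
      using aeF by eventually_elim auto
  qed (auto simp: F'_def)
  then have "(\<integral>s. F s \<partial>lebesgue_on {0..t}) = (\<integral>s. F' s \<partial>lborel)"
    by (intro borel_version_integral) auto
  also have "\<dots> = (\<integral>r. F' (t + (- 1) * r) \<partial>lborel)"
    by (subst lborel_integral_real_affine[of "- 1" _ t]) auto
  also have "\<dots> = (\<integral>r. Gamma \<gamma> * (rl_kernel_upto T \<gamma> r * u' ((t, x) - (r, 0))) \<partial>lborel)"
  proof (rule Bochner_Integration.integral_cong[OF refl])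
    fix r
    show "F' (t + (- 1) * r) = Gamma \<gamma> * (rl_kernel_upto T \<gamma> r * u' ((t, x) - (r, 0)))"
    proof (cases "0 < r \<and> r < t")
      case True
      then show ?thesis using t G by (simp add: F'_def rl_kernel_upto_def rl_kernel_pos)
    next
      case False
      then consider "r < 0" | "r = 0" | "t \<le> r" by linarith
      then show ?thesis
      proof cases
        case 3
        then have "u' (t - r, x) = 0" by (intro u'(2)) (auto simp: cyl_def)
        then show ?thesis by (simp add: F'_def)
      qed (auto simp: F'_def rl_kernel_upto_def rl_kernel_nonpos)
    qed
  qed
  finally show ?thesis using G by (simp add: frac_int_def F_def time_conv_def)
qed

lemma AE_lborel_snd:
  fixes P :: "'b::euclidean_space \<Rightarrow> bool"
  assumes "AE x in lborel. P x"
  shows "AE z in (lborel :: ('c::euclidean_space \<times> 'b) measure). P (snd z)"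
proof -
  obtain N where N: "{x \<in> space lborel. \<not> P x} \<subseteq> N" "N \<in> null_sets lborel"
    using assms by (auto elim!: AE_E simp: null_sets_def)
  have [measurable]: "N \<in> sets borel" using N(2) by auto
  have [measurable]: "(snd :: 'c \<times> 'b \<Rightarrow> 'b) \<in> borel_measurable borel"
    by (intro borel_measurable_continuous_onI continuous_on_snd continuous_on_id)
  have "(\<integral>\<^sup>+z. indicator N (snd z) \<partial>(lborel :: ('c \<times> 'b) measure)) = (\<integral>\<^sup>+t. \<integral>\<^sup>+x. indicator N x \<partial>lborel \<partial>(lborel :: 'c measure))"
    by (subst nn_integral_lborel_pair(1)) auto
  also have "\<dots> = 0" using N(2) by auto
  finally have "AE z in (lborel :: ('c \<times> 'b) measure). indicator N (snd z) = (0::ennreal)"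
    by (subst (asm) nn_integral_0_iff_AE) auto
  then show ?thesis
  proof eventually_elim
    case (elim z)
    then show ?case using N(1) by (auto simp: indicator_def split: if_splits)
  qed
qed

text \<open>\<open>frac_int\<close> integrates slices of \<open>u\<close>, which need not be measurable; for almost every \<open>x\<close> they agree
almost everywhere with those of the Borel representative. This also gives the measurability of \<open>frac_int\<close>.\<close>

lemma frac_int_borel_version:
  fixes u :: "real \<times> 'a::euclidean_space \<Rightarrow> real"
  assumes \<gamma>: "0 < \<gamma>" and T: "0 < T" and \<Omega>: "open \<Omega>" and u': "borel_version (cyl T \<Omega>) u u'" "integrable lborel u'"
  shows "borel_version (cyl T \<Omega>) (frac_int \<gamma> u) (\<lambda>z. indicator (cyl T \<Omega>) z * time_conv (rl_kernel_upto T \<gamma>) u' z)"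
proof -
  let ?X = "cyl T \<Omega>"
  have X[measurable]: "?X \<in> sets borel" using open_cyl[OF \<Omega>] by simp
  have u'0: "\<And>z. z \<notin> ?X \<Longrightarrow> u' z = 0" and [measurable]: "u' \<in> borel_measurable borel"
    and ae: "AE z in lborel. z \<in> ?X \<longrightarrow> u z = u' z"
    using u' borel_version_eq_0[OF u'(1)] by (auto simp: borel_version_def)
  have m: "time_conv (rl_kernel_upto T \<gamma>) u' \<in> borel_measurable borel"
    using integrable_time_conv[OF integrable_rl_kernel_upto[OF \<gamma> T] u'(2)] by simp
  note m[measurable]
  have "AE z in lborel. AE s in lborel. (s, snd z) \<in> ?X \<longrightarrow> u (s, snd z) = u' (s, snd z)"
    using AE_lborel_snd[OF AE_lborel_pair_snd[OF ae]] .
  then have eq: "AE z in lborel. z \<in> ?X \<longrightarrow> frac_int \<gamma> u z = indicator ?X z * time_conv (rl_kernel_upto T \<gamma>) u' z"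
  proof eventually_elim
    case (elim z)
    show ?case
    proof
      assume z: "z \<in> ?X"
      obtain t x where tx: "z = (t, x)" by (cases z)
      have "frac_int \<gamma> u (t, x) = time_conv (rl_kernel_upto T \<gamma>) u' (t, x)"
        by (rule frac_int_eq_time_conv[where \<Omega> = \<Omega>]) (use \<gamma> z tx u'0 elim in \<open>auto simp: cyl_def\<close>)
      then show "frac_int \<gamma> u z = indicator ?X z * time_conv (rl_kernel_upto T \<gamma>) u' z" using z tx by simp
    qed
  qed
  have "(\<lambda>z. frac_int \<gamma> u z * indicator ?X z) \<in> borel_measurable lebesgue"
  proof (rule borel_measurable_AE)
    show "(\<lambda>z. indicator ?X z * time_conv (rl_kernel_upto T \<gamma>) u' z) \<in> borel_measurable lebesgue"
      by (rule measurable_completion) measurable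
    show "AE z in lebesgue. indicator ?X z * time_conv (rl_kernel_upto T \<gamma>) u' z = frac_int \<gamma> u z * indicator ?X z"
      using AE_completion[OF eq] by eventually_elim (auto simp: indicator_def)
  qed
  then have "frac_int \<gamma> u \<in> borel_measurable (lebesgue_on ?X)"
    by (subst borel_measurable_restrict_space_iff) (auto simp: mult.commute)
  then show ?thesis using eq unfolding borel_version_def by auto
qed

text \<open>The correlation spreads the support of the bump towards earlier times, down to \<open>t = 0\<close> and beyond, but not to later
ones. Functions that need not vanish at \<open>t = 0\<close> are admissible in the definition of the fractional derivative.\<close>

lemma time_corr_bump_test_fun:
  fixes \<zeta> :: "real \<times> 'a::euclidean_space \<Rightarrow> real"
  assumes k: "integrable lborel k" "\<And>r. r \<le> 0 \<Longrightarrow> k r = 0"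
    and \<zeta>: "smooth_supported (cbox a b) \<zeta>" and ab: "cbox a b \<subseteq> cyl T \<Omega>"
  shows "time_corr k \<zeta> \<in> test_funs ({0..<T} \<times> \<Omega>)"
proof -
  let ?D = "{0..<T} \<times> \<Omega>" and ?S = "{z \<in> {0..<T} \<times> \<Omega>. time_corr k \<zeta> z \<noteq> 0}"
  have supp: "cbox a b \<noteq> {} \<and> z \<in> {0..fst b} \<times> cbox (snd a) (snd b)" if z: "z \<in> ?S" for z
  proof -
    have "\<exists>r. k r * \<zeta> (z + (r, 0)) \<noteq> 0"
    proof (rule ccontr)
      assume "\<not> ?thesis"
      then have "(\<lambda>r. k r * \<zeta> (z + (r, 0))) = (\<lambda>_. 0)" by auto
      then have "time_corr k \<zeta> z = 0" unfolding time_corr_def by (simp only:) simp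
      then show False using z by simp
    qed
    then obtain r where r: "k r \<noteq> 0" "\<zeta> (z + (r, 0)) \<noteq> 0" by auto
    then have "0 < r" using k(2) not_le by blast
    moreover have "z + (r, 0) \<in> cbox a b" using r smooth_supported_eq_0[OF \<zeta>] by blast
    then have "fst z + r \<in> cbox (fst a) (fst b)" "snd z \<in> cbox (snd a) (snd b)" "cbox a b \<noteq> {}"
      by (auto simp: cbox_Pair_eq[of "fst a" "snd a" "fst b" "snd b", simplified] mem_Times_iff)
    ultimately show ?thesis using z by (auto simp: mem_Times_iff)
  qed
  have clos: "closure ?S \<subseteq> {0..fst b} \<times> cbox (snd a) (snd b)"
    by (rule closure_minimal) (use supp in \<open>auto intro: closed_Times closed_cbox\<close>)
  have "closure ?S \<subseteq> ?D"
  proof (cases "?S = {}")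
    case False
    then have ne: "cbox a b \<noteq> {}" using supp by blast
    have prod: "cbox a b = cbox (fst a) (fst b) \<times> cbox (snd a) (snd b)"
      using cbox_Pair_eq[of "fst a" "snd a" "fst b" "snd b"] by simp
    then have "fst b \<in> cbox (fst a) (fst b)" "cbox (snd a) (snd b) \<noteq> {}" using ne by auto
    then have "fst b < T" "cbox (snd a) (snd b) \<subseteq> \<Omega>"
      using ab ne unfolding prod cyl_def by (auto simp: subset_iff)
    then have "{0..fst b} \<times> cbox (snd a) (snd b) \<subseteq> ?D" by auto
    then show ?thesis using clos by blast
  next
    case True
    then show ?thesis by (simp only: closure_empty empty_subsetI)
  qed
  moreover have "bounded ?S"
  proof (rule bounded_subset)
    show "bounded ({0..fst b} \<times> cbox (snd a) (snd b))" by (intro bounded_Times bounded_cbox bounded_closed_interval)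
    show "?S \<subseteq> {0..fst b} \<times> cbox (snd a) (snd b)" using supp by blast
  qed
  moreover have "smooth_on ?D (time_corr k \<zeta>)"
    unfolding smooth_on_def using Ck_on_time_corr[OF k(1) compact_cbox \<zeta>]
    by (intro exI[of _ UNIV] exI[of _ "time_corr k \<zeta>"]) auto
  ultimately show ?thesis by (simp add: test_funs_def)
qed

lemma time_corr_measurable:
  assumes "integrable lborel k" "compact K" "smooth_supported K \<zeta>"
  shows "time_corr k \<zeta> \<in> borel_measurable borel"
  using Ck_on_imp_continuous_on[OF Ck_on_time_corr[OF assms, of 0]] by (rule borel_measurable_continuous_onI)

lemma time_corr_bounded:
  fixes \<zeta> :: "real \<times> 'a::euclidean_space \<Rightarrow> real"
  assumes k: "integrable lborel k" and M: "\<And>z. \<bar>\<zeta> z\<bar> \<le> M" and [measurable]: "\<zeta> \<in> borel_measurable borel"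
  shows "\<bar>time_corr k \<zeta> z\<bar> \<le> (\<integral>r. \<bar>k r\<bar> * M \<partial>lborel)"
proof -
  have [measurable]: "k \<in> borel_measurable borel" using k by auto
  have le: "\<bar>k r * \<zeta> (z + (r, 0))\<bar> \<le> \<bar>k r\<bar> * M" for r
    using M by (simp add: abs_mult mult_left_mono)
  have "integrable lborel (\<lambda>r. k r * \<zeta> (z + (r, 0)))"
  proof (rule Bochner_Integration.integrable_bound)
    show "integrable lborel (\<lambda>r. \<bar>k r\<bar> * M)" using k by simp
    show "AE r in lborel. norm (k r * \<zeta> (z + (r, 0))) \<le> norm (\<bar>k r\<bar> * M)"
      using le by (intro AE_I2) (metis abs_ge_self order_trans real_norm_def)
  qed measurable
  then have "\<bar>time_corr k \<zeta> z\<bar> \<le> (\<integral>r. \<bar>k r * \<zeta> (z + (r, 0))\<bar> \<partial>lborel)"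
    unfolding time_corr_def using integral_norm_bound[of lborel "\<lambda>r. k r * \<zeta> (z + (r, 0))"] by simp
  also have "\<dots> \<le> (\<integral>r. \<bar>k r\<bar> * M \<partial>lborel)"
    using \<open>integrable lborel (\<lambda>r. k r * \<zeta> (z + (r, 0)))\<close> k le by (intro integral_mono) auto
  finally show ?thesis .
qed

text \<open>By duality. For a bump \<open>\<zeta>\<close> let \<open>\<phi>\<close> be its right-sided fractional integral of order \<open>\<alpha>\<close>, which is
an admissible test function. Moving the fractional integrals to the other factor, \<open>\<integral> g \<phi>\<close> is
the pairing of \<open>I\<^sup>\<alpha>g\<close> with \<open>\<zeta>\<close>, while \<open>- \<integral> I\<^sup>1\<^sup>-\<^sup>\<alpha>u \<partial>\<^sub>t\<phi>\<close> is the pairing of \<open>u\<close> with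
\<open>\<zeta>\<close>. So \<open>u - I\<^sup>\<alpha>g\<close> is orthogonal to all bumps.\<close>

lemma frac_dt_inverse:
  fixes u :: "real \<times> 'a::euclidean_space \<Rightarrow> real"
  assumes \<alpha>: "0 < \<alpha>" "\<alpha> < 1" and T: "0 < T" and \<Omega>: "open \<Omega>" "bounded \<Omega>" and p: "1 \<le> p"
    and u: "u \<in> Lp_space p (cyl T \<Omega>)" and g: "is_frac_dt \<alpha> p T \<Omega> u g"
    and u': "borel_version (cyl T \<Omega>) u u'" and g': "borel_version (cyl T \<Omega>) g g'"
  shows "AE z in lborel. z \<in> cyl T \<Omega> \<longrightarrow> u' z = time_conv (rl_kernel_upto T \<alpha>) g' z"
proof -
  let ?X = "cyl T \<Omega>"
  have X: "open ?X" "?X \<in> sets borel" "bounded ?X" using \<Omega> open_cyl bounded_cyl borel_open by blast+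
  define k where "k = rl_kernel_upto T \<alpha>"
  define k' where "k' = rl_kernel_upto T (1 - \<alpha>)"
  have int_k: "integrable lborel k" "integrable lborel k'"
    using \<alpha> T by (auto simp: k_def k'_def intro!: integrable_rl_kernel_upto)
  have k0: "k r = 0" "k' r = 0" if "r \<le> 0" for r
    using that by (auto simp: k_def k'_def rl_kernel_upto_def rl_kernel_nonpos)
  have int_u: "integrable lborel u'" by (rule Lp_space_integrable(1)[OF X(2,3) p u u'])
  have int_g: "integrable lborel g'"
    by (rule Lp_space_integrable(1)[OF X(2,3) p _ g']) (use g in \<open>simp add: is_frac_dt_def\<close>)
  have int_c: "integrable lborel (time_conv k g')" by (rule integrable_time_conv[OF int_k(1) int_g])
  note u'0 = borel_version_eq_0[OF u'] and g'0 = borel_version_eq_0[OF g']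
  have "AE z in lborel. z \<in> ?X \<longrightarrow> u' z - time_conv k g' z = 0"
  proof (rule fundamental_lemma_variations[OF X(1)])
    show "(\<lambda>z. u' z - time_conv k g' z) \<in> borel_measurable borel" using int_u int_c by simp
    show "set_integrable lborel (cbox a b) (\<lambda>z. u' z - time_conv k g' z)" for a b
      unfolding set_integrable_def using int_u int_c by (intro integrable_mult_indicator) auto
    fix \<zeta> assume bump: "bump_in ?X \<zeta>"
    then obtain a b where ab: "cbox a b \<subseteq> ?X" and \<zeta>: "smooth_supported (cbox a b) \<zeta>"
      unfolding bump_in_def smooth_supported_def using box_subset_cbox by blast
    define \<eta> where "\<eta> z = frechet_derivative \<zeta> (at z) (1, 0)" for z
    have \<eta>: "smooth_supported (cbox a b) \<eta>"
      unfolding \<eta>_def[abs_def] by (rule smooth_supported_derivative[OF \<zeta> closed_cbox])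
    define \<phi> where "\<phi> = time_corr k \<zeta>"
    have \<phi>: "\<phi> \<in> test_funs ({0..<T} \<times> \<Omega>)"
      unfolding \<phi>_def by (rule time_corr_bump_test_fun[OF int_k(1) k0(1) \<zeta> ab])
    have \<phi>': "frechet_derivative \<phi> (at z) (1, 0) = time_corr k \<eta> z" for z
      using frechet_derivative_at[OF time_corr_has_derivative[OF int_k(1) \<zeta> compact_cbox, of z]]
      unfolding \<phi>_def \<eta>_def by metis
    obtain M where M: "\<And>z. \<bar>\<zeta> z\<bar> \<le> M" using smooth_supported_bounded[OF \<zeta> compact_cbox] by blast
    obtain M' where M': "\<And>z. \<bar>\<eta> z\<bar> \<le> M'" using smooth_supported_bounded[OF \<eta> compact_cbox] by blast
    note meas[measurable] = smooth_supported_measurable[OF \<zeta>] smooth_supported_measurable[OF \<eta>]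
      time_corr_measurable[OF int_k(1) compact_cbox \<zeta>] time_corr_measurable[OF int_k(1) compact_cbox \<eta>]
    have "(\<integral>z. time_conv k g' z * \<zeta> z \<partial>lborel) = (\<integral>z. g' z * \<phi> z \<partial>lborel)"
      unfolding \<phi>_def by (rule time_conv_adjoint[OF int_k(1) int_g _ M]) simp
    also have "\<dots> = (\<integral>z. g z * \<phi> z \<partial>lebesgue_on ?X)"
      by (rule borel_version_integral(1)[OF X(2) borel_version_mult[OF g'], symmetric]) (simp add: \<phi>_def)
    also have "\<dots> = - (\<integral>z. frac_int (1 - \<alpha>) u z * frechet_derivative \<phi> (at z) (1, 0) \<partial>lebesgue_on ?X)"
      using g \<phi> by (simp add: is_frac_dt_def)
    also have "(\<integral>z. frac_int (1 - \<alpha>) u z * frechet_derivative \<phi> (at z) (1, 0) \<partial>lebesgue_on ?X)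
       = (\<integral>z. (indicator ?X z * time_conv k' u' z) * time_corr k \<eta> z \<partial>lborel)"
      unfolding \<phi>' k'_def
      by (rule borel_version_integral(1)[OF X(2) borel_version_mult[OF frac_int_borel_version[OF _ T \<Omega>(1) u' int_u]]])
         (use \<alpha> in auto)
    also have "\<dots> = (\<integral>z. time_conv k' u' z * time_corr k \<eta> z \<partial>lborel)"
    proof (rule Bochner_Integration.integral_cong[OF refl])
      fix z :: "real \<times> 'a"
      show "(indicator ?X z * time_conv k' u' z) * time_corr k \<eta> z = time_conv k' u' z * time_corr k \<eta> z"
      proof (cases "z \<in> ?X")
        case False
        then consider "fst z \<le> 0" | "T \<le> fst z" | "snd z \<notin> \<Omega>" by (cases z) (auto simp: cyl_def not_less)
        then have "time_conv k' u' z = 0 \<or> time_corr k \<eta> z = 0"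
        proof cases
          case 1
          have "k' r * u' (z - (r, 0)) = 0" for r
          proof (cases "r \<le> 0")
            case False
            then have "z - (r, 0) \<notin> ?X" using 1 by (auto simp: cyl_def mem_Times_iff)
            then show ?thesis by (simp add: u'0)
          qed (simp add: k0)
          then show ?thesis unfolding time_conv_def by (simp only:) simp
        next
          case 2
          have "k r * \<eta> (z + (r, 0)) = 0" for r
          proof (cases "r \<le> 0")
            case False
            then have "z + (r, 0) \<notin> ?X" using 2 by (auto simp: cyl_def mem_Times_iff)
            then have "z + (r, 0) \<notin> cbox a b" using ab by blast
            then show ?thesis using smooth_supported_eq_0[OF \<eta>] by simp
          qed (simp add: k0)
          then show ?thesis unfolding time_corr_def by (simp only:) simp
        next
          case 3
          then have "u' (z - (r, 0)) = 0" for r by (intro u'0) (auto simp: cyl_def mem_Times_iff)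
          then show ?thesis by (simp add: time_conv_def)
        qed
        then show ?thesis by auto
      qed simp
    qed
    also have "\<dots> = (\<integral>z. u' z * time_corr k' (time_corr k \<eta>) z \<partial>lborel)"
      by (rule time_conv_adjoint[OF int_k(2) int_u _ time_corr_bounded[OF int_k(1) M']]) auto
    also have "\<dots> = (\<integral>z. - (u' z * \<zeta> z) \<partial>lborel)"
    proof (rule Bochner_Integration.integral_cong[OF refl])
      fix z :: "real \<times> 'a"
      show "u' z * time_corr k' (time_corr k \<eta>) z = - (u' z * \<zeta> z)"
      proof (cases "z \<in> ?X")
        case True
        have "time_corr k' (time_corr k \<eta>) z = - \<zeta> z"
          unfolding k_def k'_def \<eta>_def[abs_def]
          by (rule time_corr_inverse[OF \<alpha> T \<zeta> compact_cbox]) (use ab True in \<open>auto simp: cyl_def subset_iff\<close>)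
        then show ?thesis by simp
      qed (simp add: u'0)
    qed
    finally have "(\<integral>z. time_conv k g' z * \<zeta> z \<partial>lborel) = (\<integral>z. u' z * \<zeta> z \<partial>lborel)" by simp
    then show "(\<integral>z. (u' z - time_conv k g' z) * \<zeta> z \<partial>lborel) = 0"
      using integrable_mult_bump[OF int_u bump] integrable_mult_bump[OF int_c bump]
      by (simp add: left_diff_distrib)
  qed
  then show ?thesis unfolding k_def by eventually_elim simp
qed

section \<open>The interpolation estimate\<close>

text \<open>The estimates use the fractional derivative only through this representation of almost every time slice, which makes
them one-dimensional.\<close>

lemma H_space_slices:
  fixes \<psi> :: "real \<times> 'a::euclidean_space \<Rightarrow> real"
  assumes \<alpha>: "0 < \<alpha>" "\<alpha> < 1" and T: "0 < T" and \<Omega>: "open \<Omega>" "bounded \<Omega>" and p: "1 \<le> p"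
    and \<psi>: "\<psi> \<in> H_space \<alpha> p T \<Omega>"
  shows "\<exists>u g. borel_version (cyl T \<Omega>) \<psi> u \<and> borel_version (cyl T \<Omega>) (frac_dt \<alpha> p T \<Omega> \<psi>) g \<and>
    u \<in> borel_measurable borel \<and> g \<in> borel_measurable borel \<and>
    (\<forall>t x. t \<notin> {0<..<T} \<or> x \<notin> \<Omega> \<longrightarrow> u (t, x) = 0 \<and> g (t, x) = 0) \<and>
    (\<integral>\<^sup>+z. ennreal (\<bar>u z\<bar> powr p) \<partial>lborel) = ennreal (Lp_norm p (cyl T \<Omega>) \<psi> powr p) \<and>
    (\<integral>\<^sup>+z. ennreal (\<bar>g z\<bar> powr p) \<partial>lborel) = ennreal (Lp_norm p (cyl T \<Omega>) (frac_dt \<alpha> p T \<Omega> \<psi>) powr p) \<and>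
    (AE x in lborel. AE t in lborel. t \<in> {0<..<T} \<longrightarrow> u (t, x) = (\<integral>r. rl_kernel \<alpha> r * g (t - r, x) \<partial>lborel))"
proof -
  let ?X = "cyl T \<Omega>" and ?g = "frac_dt \<alpha> p T \<Omega> \<psi>"
  have X: "?X \<in> sets borel" using open_cyl[OF \<Omega>(1)] by simp
  have \<psi>L: "\<psi> \<in> Lp_space p ?X" using \<psi> by (simp add: H_space_def)
  have g: "is_frac_dt \<alpha> p T \<Omega> \<psi> ?g"
    unfolding frac_dt_def
    by (rule someI_ex[where P = "is_frac_dt \<alpha> p T \<Omega> \<psi>"]) (use \<psi> in \<open>simp add: H_space_def\<close>)
  have gL: "?g \<in> Lp_space p ?X" using g by (simp add: is_frac_dt_def)
  obtain u where u: "borel_version ?X \<psi> u"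
    using borel_version_exists[OF X] \<psi>L unfolding Lp_space_def by blast
  obtain g' where g': "borel_version ?X ?g g'"
    using borel_version_exists[OF X] gL unfolding Lp_space_def by blast
  have outside: "u (t, x) = 0" "g' (t, x) = 0" if "t \<notin> {0<..<T} \<or> x \<notin> \<Omega>" for t x
    using that borel_version_eq_0[OF u, of "(t, x)"] borel_version_eq_0[OF g', of "(t, x)"] by (auto simp: cyl_def)
  have "AE z in lborel. z \<in> ?X \<longrightarrow> u z = time_conv (rl_kernel_upto T \<alpha>) g' z"
    by (rule frac_dt_inverse[OF \<alpha> T \<Omega> p \<psi>L g u g'])
  from AE_lborel_pair_snd[OF this]
  have rep: "AE x in lborel. AE t in lborel. t \<in> {0<..<T} \<longrightarrow> u (t, x) = (\<integral>r. rl_kernel \<alpha> r * g' (t - r, x) \<partial>lborel)"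
  proof eventually_elim
    case (elim x)
    then show ?case
    proof eventually_elim
      case (elim t)
      show ?case
      proof
        assume t: "t \<in> {0<..<T}"
        show "u (t, x) = (\<integral>r. rl_kernel \<alpha> r * g' (t - r, x) \<partial>lborel)"
        proof (cases "x \<in> \<Omega>")
          case True
          then have "u (t, x) = (\<integral>r. rl_kernel_upto T \<alpha> r * g' (t - r, x) \<partial>lborel)"
            using elim t by (simp add: cyl_def time_conv_def)
          also have "(\<lambda>r. rl_kernel_upto T \<alpha> r * g' (t - r, x)) = (\<lambda>r. rl_kernel \<alpha> r * g' (t - r, x))"
          proof
            fix r
            show "rl_kernel_upto T \<alpha> r * g' (t - r, x) = rl_kernel \<alpha> r * g' (t - r, x)"
              using t outside(2)[of "t - r" x] by (cases "r < T") (auto simp: rl_kernel_upto_def)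
          qed
          finally show ?thesis .
        next
          case False
          then show ?thesis using outside by simp
        qed
      qed
    qed
  qed
  have "u \<in> borel_measurable borel" "g' \<in> borel_measurable borel" using u g' by (auto simp: borel_version_def)
  moreover have "(\<integral>\<^sup>+z. ennreal (\<bar>u z\<bar> powr p) \<partial>lborel) = ennreal (Lp_norm p ?X \<psi> powr p)"
    by (rule borel_version_Lp[OF X _ u \<psi>L]) (use p in simp)
  moreover have "(\<integral>\<^sup>+z. ennreal (\<bar>g' z\<bar> powr p) \<partial>lborel) = ennreal (Lp_norm p ?X ?g powr p)"
    by (rule borel_version_Lp[OF X _ g' gL]) (use p in simp)
  ultimately show ?thesis using u g' outside rep by blast
qed

lemma Lp_norm_le_of_version:
  assumes X: "X \<in> sets borel" and q: "0 < q" and u: "borel_version X f u" and c: "0 \<le> c"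
    and le: "(\<integral>\<^sup>+z. ennreal (\<bar>u z\<bar> powr q) \<partial>lborel) \<le> ennreal (c powr q)"
  shows "f \<in> Lp_space q X \<and> Lp_norm q X f \<le> c"
proof
  show f: "f \<in> Lp_space q X"
    by (rule borel_version_Lp_space[OF X u le_less_trans[OF le]]) simp
  have "Lp_norm q X f powr q \<le> c powr q"
    using le unfolding borel_version_Lp[OF X q u f] by (simp add: ennreal_le_iff)
  then show "Lp_norm q X f \<le> c"
    using q c Lp_norm_nonneg[of q X f] by (meson leD leI powr_less_mono2)
qed

text \<open>The exponents \<open>a\<close> and \<open>b\<close> below are those of the bound \<open>C U(x)\<^sup>a Q(x)\<^sup>b\<close> for the slice at \<open>x\<close>; the factor
\<open>U(x)\<^sup>a\<close> is bounded uniformly in \<open>x\<close>, and \<open>b \<le> 1\<close> makes \<open>Q\<^sup>b\<close> integrable.\<close>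

lemma interpolation_estimate:
  fixes \<alpha> p q :: real
  assumes \<alpha>: "0 < \<alpha>" "\<alpha> < 1" and p: "1 < p" "real DIM('a::euclidean_space) < p"
    and q: "p < q" "q \<le> p * (\<alpha> * p + 1)" and \<theta>: "\<theta> = 1 / \<alpha> * (1 / p - 1 / q)"
  shows "0 < \<theta>" "\<theta> < 1"
    "\<exists>N::real. \<forall>T>0. \<forall>\<psi>\<in>H0_space \<alpha> p T (ball (0::'a) 1).
       \<psi> \<in> Lp_space q (cyl T (ball 0 1)) \<and>
       Lp_norm q (cyl T (ball 0 1)) \<psi>
         \<le> N * W1_norm p T (ball 0 1) \<psi> powr (1 - \<theta>)
             * Lp_norm p (cyl T (ball 0 1)) (frac_dt \<alpha> p T (ball 0 1) \<psi>) powr \<theta>"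
proof -
  have q0: "0 < q" "1 < q" using p q by auto
  have \<theta>q: "\<theta> * q = (q / p - 1) / \<alpha>"
    using p q0 \<alpha> by (simp add: \<theta> field_simps)
  have "q / p - 1 \<le> \<alpha> * p" using q p by (simp add: field_simps)
  then have \<theta>qp: "\<theta> * q \<le> p" unfolding \<theta>q using \<alpha> by (simp add: pos_divide_le_eq mult.commute)
  have "1 / q < 1 / p" using p q by (simp add: frac_less2)
  then show \<theta>0: "0 < \<theta>" using \<alpha> by (simp add: \<theta>)
  show \<theta>1: "\<theta> < 1"
  proof (rule ccontr)
    assume "\<not> \<theta> < 1"
    then have "1 * q \<le> \<theta> * q" using q0 by (intro mult_right_mono) auto
    then show False using \<theta>qp q by simp
  qed
  have sub: "1 / p - 1 / q < \<alpha>"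
    using \<theta>1 \<alpha> by (simp add: \<theta> pos_divide_less_eq)
  define a where "a = (1 - \<theta>) * q / p"
  define b where "b = \<theta> * q / p"
  have b: "0 < b" "b \<le> 1" using \<theta>0 \<theta>qp q0 p by (auto simp: b_def)
  define V where "V = measure lborel (ball (0::'a) 1) + 1"
  have V: "0 < V" "emeasure lborel (ball (0::'a) 1) \<le> ennreal V"
  proof -
    show "0 < V" unfolding V_def by (simp add: add_nonneg_pos)
    have "emeasure lborel (ball (0::'a) 1) = ennreal (measure lborel (ball (0::'a) 1))"
      using emeasure_bounded_finite[OF bounded_ball, of "0::'a" 1] by (intro emeasure_eq_ennreal_measure) auto
    then show "emeasure lborel (ball (0::'a) 1) \<le> ennreal V" by (simp add: V_def ennreal_leI)
  qed
  show "\<exists>N::real. \<forall>T>0. \<forall>\<psi>\<in>H0_space \<alpha> p T (ball (0::'a) 1).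
       \<psi> \<in> Lp_space q (cyl T (ball 0 1)) \<and>
       Lp_norm q (cyl T (ball 0 1)) \<psi>
         \<le> N * W1_norm p T (ball 0 1) \<psi> powr (1 - \<theta>)
             * Lp_norm p (cyl T (ball 0 1)) (frac_dt \<alpha> p T (ball 0 1) \<psi>) powr \<theta>"
  proof (rule time_gagliardo_nirenberg[OF \<alpha> p(1) q(1) sub], rule sup_time_Lp_bound[OF p])
    fix C K :: real
    assume C: "0 < C" and GN: "\<And>T f u P Q. 0 < T \<Longrightarrow> f \<in> borel_measurable borel \<Longrightarrow> u \<in> borel_measurable borel \<Longrightarrow>
      (\<And>t. t \<notin> {0<..<T} \<Longrightarrow> f t = 0) \<Longrightarrow> (\<And>t. t \<notin> {0<..<T} \<Longrightarrow> u t = 0) \<Longrightarrow>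
      (AE t in lborel. t \<in> {0<..<T} \<longrightarrow> u t = (\<integral>r. rl_kernel \<alpha> r * f (t - r) \<partial>lborel)) \<Longrightarrow>
      0 \<le> P \<Longrightarrow> 0 \<le> Q \<Longrightarrow>
      (\<integral>\<^sup>+t. ennreal (\<bar>u t\<bar> powr p) \<partial>lborel) \<le> ennreal P \<Longrightarrow>
      (\<integral>\<^sup>+t. ennreal (\<bar>f t\<bar> powr p) \<partial>lborel) \<le> ennreal Q \<Longrightarrow>
      (\<integral>\<^sup>+t. ennreal (\<bar>u t\<bar> powr q) \<partial>lborel)
        \<le> ennreal (C * P powr ((1 - 1 / \<alpha> * (1 / p - 1 / q)) * q / p)
                     * Q powr (1 / \<alpha> * (1 / p - 1 / q) * q / p))"
    assume K: "0 < K" and sup: "\<And>\<alpha> T (u :: real \<times> 'a \<Rightarrow> real) u'. u \<in> H0_space \<alpha> p T (ball 0 1) \<Longrightarrow>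
       borel_version (cyl T (ball 0 1)) u u' \<Longrightarrow>
       AE x in lborel. (\<integral>\<^sup>+t. ennreal (\<bar>u' (t, x)\<bar> powr p) \<partial>lborel) \<le> ennreal (K * W1_norm p T (ball 0 1) u powr p)"
    define N where "N = (C * K powr a * V powr (1 - b)) powr (1 / q)"
    show ?thesis
    proof (rule exI[of _ N], intro allI impI ballI)
      fix T :: real and \<psi> :: "real \<times> 'a \<Rightarrow> real"
      assume T: "0 < T" and \<psi>: "\<psi> \<in> H0_space \<alpha> p T (ball 0 1)"
      let ?B = "ball 0 1 :: 'a set"
      let ?X = "cyl T ?B"
      define W where "W = W1_norm p T ?B \<psi>"
      define F where "F = Lp_norm p ?X (frac_dt \<alpha> p T ?B \<psi>)"
      have WF: "0 \<le> W" "0 \<le> F" by (simp_all add: W_def F_def Lp_norm_le_W1_norm Lp_norm_nonneg)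
      have X: "?X \<in> sets borel" by (intro borel_open open_cyl open_ball)
      have \<psi>H: "\<psi> \<in> H_space \<alpha> p T ?B" using \<psi> by (simp add: H0_space_def)
      have p1: "1 \<le> p" using p by simp
      obtain u g where u: "borel_version ?X \<psi> u" and [measurable]: "u \<in> borel_measurable borel" "g \<in> borel_measurable borel"
        and u0: "\<And>t x. t \<notin> {0<..<T} \<Longrightarrow> u (t, x) = 0" and g0: "\<And>t x. t \<notin> {0<..<T} \<Longrightarrow> g (t, x) = 0"
        and uB: "\<And>t x. x \<notin> ?B \<Longrightarrow> u (t, x) = 0"
        and g_norm: "(\<integral>\<^sup>+z. ennreal (\<bar>g z\<bar> powr p) \<partial>lborel) = ennreal (F powr p)"
        and rep: "AE x in lborel. AE t in lborel. t \<in> {0<..<T} \<longrightarrow> u (t, x) = (\<integral>r. rl_kernel \<alpha> r * g (t - r, x) \<partial>lborel)"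
        unfolding F_def using H_space_slices[OF \<alpha> T open_ball bounded_ball p1 \<psi>H] by blast
      have [measurable]: "?B \<in> sets borel" by simp
      define Q where "Q x = (\<integral>\<^sup>+t. ennreal (\<bar>g (t, x)\<bar> powr p) \<partial>lborel)" for x
      have [measurable]: "Q \<in> borel_measurable borel" unfolding Q_def by measurable
      have intQ: "(\<integral>\<^sup>+x. Q x \<partial>lborel) = ennreal (F powr p)"
        unfolding Q_def g_norm[symmetric]
        by (rule nn_integral_lborel_pair(2)[symmetric, where f = "\<lambda>z. ennreal (\<bar>g z\<bar> powr p)"]) measurable
      then have Qfin: "AE x in lborel. Q x \<noteq> \<infinity>" by (intro nn_integral_noteq_infinite) auto
      define P where "P = K * W powr p"
      have P: "0 \<le> P" using K by (simp add: P_def)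
      have slice: "AE x in lborel. (\<integral>\<^sup>+t. ennreal (\<bar>u (t, x)\<bar> powr q) \<partial>lborel)
          \<le> ennreal (C * P powr a) * ennreal (indicator ?B x * enn2real (Q x) powr b)"
        using rep sup[OF \<psi> u] Qfin
      proof eventually_elim
        case (elim x)
        show ?case
        proof (cases "x \<in> ?B")
          case False
          then show ?thesis using uB by simp
        next
          case True
          have "(\<integral>\<^sup>+t. ennreal (\<bar>u (t, x)\<bar> powr q) \<partial>lborel)
            \<le> ennreal (C * P powr ((1 - 1 / \<alpha> * (1 / p - 1 / q)) * q / p)
                     * enn2real (Q x) powr (1 / \<alpha> * (1 / p - 1 / q) * q / p))"
          proof (rule GN[where f = "\<lambda>t. g (t, x)" and u = "\<lambda>t. u (t, x)" and T = T])
            show "(\<integral>\<^sup>+t. ennreal (\<bar>g (t, x)\<bar> powr p) \<partial>lborel) \<le> ennreal (enn2real (Q x))"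
              using elim(3) by (simp add: Q_def less_top)
          qed (use T u0 g0 elim P in \<open>simp_all add: P_def W_def\<close>)
          then have "(\<integral>\<^sup>+t. ennreal (\<bar>u (t, x)\<bar> powr q) \<partial>lborel) \<le> ennreal (C * P powr a * enn2real (Q x) powr b)"
            unfolding a_def b_def \<theta> .
          then show ?thesis using True C by (simp add: ennreal_mult')
        qed
      qed
      have Jensen: "(\<integral>\<^sup>+x. ennreal (indicator ?B x * enn2real (Q x) powr b) \<partial>lborel)
          \<le> ennreal (V powr (1 - 1 / (1 / b)) * (F powr p) powr (1 / (1 / b)))"
      proof (rule nn_integral_Jensen_set)
        have "(\<integral>\<^sup>+x. ennreal (indicator ?B x * (enn2real (Q x) powr b) powr (1 / b)) \<partial>lborel) \<le> (\<integral>\<^sup>+x. Q x \<partial>lborel)"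
        proof (rule nn_integral_mono_AE, use Qfin in eventually_elim)
          case (elim x)
          have "indicator ?B x * (enn2real (Q x) powr b) powr (1 / b) \<le> enn2real (Q x)"
            using b by (simp add: powr_powr indicator_def)
          then have "ennreal (indicator ?B x * (enn2real (Q x) powr b) powr (1 / b)) \<le> ennreal (enn2real (Q x))"
            by (rule ennreal_leI)
          also have "ennreal (enn2real (Q x)) = Q x" using elim by (simp add: less_top)
          finally show ?case .
        qed
        then show "(\<integral>\<^sup>+x. ennreal (indicator ?B x * (enn2real (Q x) powr b) powr (1 / b)) \<partial>lborel) \<le> ennreal (F powr p)"
          unfolding intQ .
      qed (use V b in auto)
      have "(\<integral>\<^sup>+z. ennreal (\<bar>u z\<bar> powr q) \<partial>lborel) = (\<integral>\<^sup>+x. \<integral>\<^sup>+t. ennreal (\<bar>u (t, x)\<bar> powr q) \<partial>lborel \<partial>lborel)"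
        by (rule nn_integral_lborel_pair(2)) measurable
      also have "\<dots> \<le> (\<integral>\<^sup>+x. ennreal (C * P powr a) * ennreal (indicator ?B x * enn2real (Q x) powr b) \<partial>lborel)"
        by (rule nn_integral_mono_AE[OF slice])
      also have "\<dots> = ennreal (C * P powr a) * (\<integral>\<^sup>+x. ennreal (indicator ?B x * enn2real (Q x) powr b) \<partial>lborel)"
        by (rule nn_integral_cmult) measurable
      also have "\<dots> \<le> ennreal (C * P powr a) * ennreal (V powr (1 - 1 / (1 / b)) * (F powr p) powr (1 / (1 / b)))"
        by (intro mult_left_mono Jensen) auto
      also have "\<dots> = ennreal (C * P powr a * (V powr (1 - b) * (F powr p) powr b))"
        using C by (simp add: ennreal_mult)
      also have "C * P powr a * (V powr (1 - b) * (F powr p) powr b) = (N * W powr (1 - \<theta>) * F powr \<theta>) powr q"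
      proof -
        have e: "p * a = (1 - \<theta>) * q" "p * b = \<theta> * q" using p by (simp_all add: a_def b_def)
        have "(N * W powr (1 - \<theta>) * F powr \<theta>) powr q = N powr q * W powr ((1 - \<theta>) * q) * F powr (\<theta> * q)"
          by (simp add: powr_mult powr_powr N_def)
        also have "N powr q = C * K powr a * V powr (1 - b)"
          using q0 C by (simp add: N_def powr_powr)
        also have "W powr ((1 - \<theta>) * q) = (W powr p) powr a" by (simp only: powr_powr e)
        also have "F powr (\<theta> * q) = (F powr p) powr b" by (simp only: powr_powr e)
        finally show ?thesis using K by (simp add: P_def powr_mult)
      qed
      finally show "\<psi> \<in> Lp_space q ?X \<and> Lp_norm q ?X \<psi>
         \<le> N * W1_norm p T ?B \<psi> powr (1 - \<theta>) * Lp_norm p ?X (frac_dt \<alpha> p T ?B \<psi>) powr \<theta>"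
        unfolding W_def[symmetric] F_def[symmetric]
        by (intro Lp_norm_le_of_version[OF X q0(1) u]) (auto simp: N_def)
    qed
  qed
qed

text \<open>The constant has to serve all \<open>\<theta>\<close> at once; \<open>A\<^sup>\<theta> \<le> max 1 A\<close> for the norm \<open>A\<close> of the fractional integral on
\<open>(0,T)\<close>.\<close>

lemma subcritical_estimate:
  fixes \<alpha> p q T :: real
  assumes \<alpha>: "0 < \<alpha>" "\<alpha> < 1" and p: "1 < p" and q: "1 \<le> q" "q \<le> p" and T: "0 < T"
  shows "\<exists>N::real. \<forall>\<theta>. 0 \<le> \<theta> \<and> \<theta> < 1 \<longrightarrow> (\<forall>\<psi>\<in>H_space \<alpha> p T (ball (0::'a::euclidean_space) 1).
       \<psi> \<in> Lp_space q (cyl T (ball 0 1)) \<and>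
       Lp_norm q (cyl T (ball 0 1)) \<psi>
         \<le> N * W1_norm p T (ball 0 1) \<psi> powr (1 - \<theta>)
             * Lp_norm p (cyl T (ball 0 1)) (frac_dt \<alpha> p T (ball 0 1) \<psi>) powr \<theta>)"
proof -
  let ?B = "ball 0 1 :: 'a set"
  let ?X = "cyl T ?B"
  have X: "?X \<in> sets borel" "bounded ?X"
    by (intro borel_open open_cyl open_ball bounded_cyl bounded_ball)+
  define A where "A = T powr \<alpha> / (\<alpha> * Gamma \<alpha>)"
  have A: "0 < A" using \<alpha> T by (simp add: A_def Gamma_real_pos)
  define V where "V = measure lborel ?X + 1"
  have V: "0 < V" "emeasure lborel ?X \<le> ennreal V"
  proof -
    show "0 < V" unfolding V_def by (simp add: add_nonneg_pos)
    have "emeasure lborel ?X = ennreal (measure lborel ?X)"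
      using emeasure_bounded_finite[OF X(2)] by (intro emeasure_eq_ennreal_measure) auto
    then show "emeasure lborel ?X \<le> ennreal V" by (simp add: V_def ennreal_leI)
  qed
  define N where "N = V powr (1 / q - 1 / p) * max 1 A"
  have q0: "0 < q" and p1: "1 \<le> p" using q p by auto
  show ?thesis
  proof (rule exI[of _ N], intro allI impI ballI)
    fix \<theta> :: real and \<psi> :: "real \<times> 'a \<Rightarrow> real"
    assume \<theta>: "0 \<le> \<theta> \<and> \<theta> < 1" and \<psi>: "\<psi> \<in> H_space \<alpha> p T ?B"
    define U where "U = Lp_norm p ?X \<psi>"
    define W where "W = W1_norm p T ?B \<psi>"
    define F where "F = Lp_norm p ?X (frac_dt \<alpha> p T ?B \<psi>)"
    have WF: "0 \<le> U" "U \<le> W" "0 \<le> F" by (simp_all add: U_def W_def F_def Lp_norm_le_W1_norm Lp_norm_nonneg)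
    obtain u g where u: "borel_version ?X \<psi> u" and [measurable]: "u \<in> borel_measurable borel" "g \<in> borel_measurable borel"
      and u0: "\<And>t x. t \<notin> {0<..<T} \<Longrightarrow> u (t, x) = 0" and g0: "\<And>t x. t \<notin> {0<..<T} \<Longrightarrow> g (t, x) = 0"
      and u_norm: "(\<integral>\<^sup>+z. ennreal (\<bar>u z\<bar> powr p) \<partial>lborel) = ennreal (U powr p)"
      and g_norm: "(\<integral>\<^sup>+z. ennreal (\<bar>g z\<bar> powr p) \<partial>lborel) = ennreal (F powr p)"
      and rep: "AE x in lborel. AE t in lborel. t \<in> {0<..<T} \<longrightarrow> u (t, x) = (\<integral>r. rl_kernel \<alpha> r * g (t - r, x) \<partial>lborel)"
      unfolding F_def U_def using H_space_slices[OF \<alpha> T open_ball bounded_ball p1 \<psi>] by blast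
    have "U \<le> A * F"
    proof -
      define Q where "Q x = (\<integral>\<^sup>+t. ennreal (\<bar>g (t, x)\<bar> powr p) \<partial>lborel)" for x
      have [measurable]: "Q \<in> borel_measurable borel" unfolding Q_def by measurable
      have intQ: "(\<integral>\<^sup>+x. Q x \<partial>lborel) = ennreal (F powr p)"
        unfolding Q_def g_norm[symmetric]
        by (rule nn_integral_lborel_pair(2)[symmetric, where f = "\<lambda>z. ennreal (\<bar>g z\<bar> powr p)"]) measurable
      then have Qfin: "AE x in lborel. Q x \<noteq> \<infinity>" by (intro nn_integral_noteq_infinite) auto
      have slice: "AE x in lborel. (\<integral>\<^sup>+t. ennreal (\<bar>u (t, x)\<bar> powr p) \<partial>lborel) \<le> ennreal (A powr p) * Q x"
        using rep Qfin
      proof eventually_elim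
        case (elim x)
        have "(\<integral>\<^sup>+t. ennreal (\<bar>u (t, x)\<bar> powr p) \<partial>lborel)
           = (\<integral>\<^sup>+t. ennreal (indicator {0<..<T} t * \<bar>\<integral>r. rl_kernel \<alpha> r * g (t - r, x) \<partial>lborel\<bar> powr p) \<partial>lborel)"
        proof (rule nn_integral_cong_AE, use elim(1) in eventually_elim)
          case (elim t)
          then show ?case using u0[of t x] by (cases "t \<in> {0<..<T}") auto
        qed
        also have "\<dots> \<le> ennreal (A powr p * enn2real (Q x))"
          unfolding A_def using elim(2)
          by (intro rl_convolution_Lp(2)[OF \<alpha>(1) p1 T, where f = "\<lambda>t. g (t, x)"]) (auto simp: g0 Q_def less_top)
        also have "\<dots> = ennreal (A powr p) * Q x" using elim(2) by (simp add: ennreal_mult less_top)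
        finally show ?case .
      qed
      have "ennreal (U powr p) = (\<integral>\<^sup>+x. \<integral>\<^sup>+t. ennreal (\<bar>u (t, x)\<bar> powr p) \<partial>lborel \<partial>lborel)"
        unfolding u_norm[symmetric] by (rule nn_integral_lborel_pair(2)) measurable
      also have "\<dots> \<le> (\<integral>\<^sup>+x. ennreal (A powr p) * Q x \<partial>lborel)" by (rule nn_integral_mono_AE[OF slice])
      also have "\<dots> = ennreal (A powr p) * ennreal (F powr p)" by (simp add: nn_integral_cmult intQ)
      also have "\<dots> = ennreal ((A * F) powr p)" using A WF by (simp add: ennreal_mult powr_mult)
      finally have "U powr p \<le> (A * F) powr p" by (simp add: ennreal_le_iff)
      then show ?thesis using p A WF by (meson leD leI mult_nonneg_nonneg less_imp_le powr_less_mono2 order_less_trans zero_less_one)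
    qed
    have U_le: "U \<le> max 1 A * W powr (1 - \<theta>) * F powr \<theta>"
    proof (cases "U = 0")
      case False
      then have U: "0 < U" using WF by simp
      have "U = U powr (1 - \<theta>) * U powr \<theta>" using U by (simp add: powr_add[symmetric])
      also have "\<dots> \<le> W powr (1 - \<theta>) * (A * F) powr \<theta>"
        using \<theta> WF \<open>U \<le> A * F\<close> by (intro mult_mono powr_mono2) auto
      also have "\<dots> = A powr \<theta> * (W powr (1 - \<theta>) * F powr \<theta>)" using A WF by (simp add: powr_mult)
      also have "\<dots> \<le> max 1 A * (W powr (1 - \<theta>) * F powr \<theta>)"
      proof (intro mult_right_mono)
        show "A powr \<theta> \<le> max 1 A"
        proof (cases "A \<le> 1")
          case True
          then show ?thesis using A \<theta> by (auto simp: powr_le1 le_max_iff_disj)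
        next
          case False
          then have "A powr \<theta> \<le> A powr 1" using \<theta> by (intro powr_mono) auto
          then show ?thesis using A by auto
        qed
      qed auto
      finally show ?thesis by (simp add: mult.assoc)
    qed auto
    have "\<psi> \<in> Lp_space q ?X \<and> Lp_norm q ?X \<psi> \<le> V powr (1 / q - 1 / p) * U"
    proof (rule Lp_norm_le_of_version[OF X(1) q0 u])
      have out: "u z = 0" if "z \<notin> ?X" for z by (rule borel_version_eq_0[OF u that])
      have "(\<integral>\<^sup>+z. ennreal (indicator ?X z * \<bar>u z\<bar> powr q) \<partial>lborel)
         \<le> ennreal (V powr (1 - 1 / (p / q)) * (U powr p) powr (1 / (p / q)))"
      proof (rule nn_integral_Jensen_set)
        have "indicator ?X z * (\<bar>u z\<bar> powr q) powr (p / q) \<le> \<bar>u z\<bar> powr p" for z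
          using q0 by (simp add: powr_powr indicator_def)
        then have "(\<integral>\<^sup>+z. ennreal (indicator ?X z * (\<bar>u z\<bar> powr q) powr (p / q)) \<partial>lborel) \<le> (\<integral>\<^sup>+z. ennreal (\<bar>u z\<bar> powr p) \<partial>lborel)"
          by (intro nn_integral_mono ennreal_leI)
        then show "(\<integral>\<^sup>+z. ennreal (indicator ?X z * (\<bar>u z\<bar> powr q) powr (p / q)) \<partial>lborel) \<le> ennreal (U powr p)"
          unfolding u_norm .
      qed (use V q q0 X in auto)
      also have "(\<lambda>z. ennreal (indicator ?X z * \<bar>u z\<bar> powr q)) = (\<lambda>z. ennreal (\<bar>u z\<bar> powr q))"
      proof
        fix z
        show "ennreal (indicator ?X z * \<bar>u z\<bar> powr q) = ennreal (\<bar>u z\<bar> powr q)"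
          using out[of z] by (cases "z \<in> ?X") auto
      qed
      also have "V powr (1 - 1 / (p / q)) * (U powr p) powr (1 / (p / q)) = (V powr (1 / q - 1 / p) * U) powr q"
      proof -
        have "(1 / q - 1 / p) * q = 1 - 1 / (p / q)" "p * (1 / (p / q)) = q" using q0 p by (simp_all add: field_simps)
        then show ?thesis using WF by (simp add: powr_mult powr_powr)
      qed
      finally show "(\<integral>\<^sup>+z. ennreal (\<bar>u z\<bar> powr q) \<partial>lborel) \<le> ennreal ((V powr (1 / q - 1 / p) * U) powr q)" .
    qed (use WF in auto)
    moreover have "V powr (1 / q - 1 / p) * U \<le> N * W powr (1 - \<theta>) * F powr \<theta>"
      using mult_left_mono[OF U_le, of "V powr (1 / q - 1 / p)"] by (simp add: N_def mult.assoc)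
    ultimately show "\<psi> \<in> Lp_space q ?X \<and> Lp_norm q ?X \<psi>
         \<le> N * W1_norm p T ?B \<psi> powr (1 - \<theta>) * Lp_norm p ?X (frac_dt \<alpha> p T ?B \<psi>) powr \<theta>"
      unfolding W_def F_def by linarith
  qed
qed

theorem theoremA3:
  fixes \<alpha> p :: real
  assumes "0 < \<alpha>" "\<alpha> < 1" "1 < p" "real DIM('a::euclidean_space) < p"
  shows
    "(\<forall>q \<theta>. p < 1 / \<alpha> \<and> 1 < q \<and> p < q \<and> q \<le> p * (\<alpha> * p + 1) \<and>
        \<theta> = 1 / \<alpha> * (1 / p - 1 / q) \<longrightarrow>
        0 < \<theta> \<and> \<theta> < 1 \<and>
        (\<exists>N::real. \<forall>T>0. \<forall>\<psi>\<in>H0_space \<alpha> p T (ball (0::'a) 1).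
           \<psi> \<in> Lp_space q (cyl T (ball 0 1)) \<and>
           Lp_norm q (cyl T (ball 0 1)) \<psi>
             \<le> N * W1_norm p T (ball 0 1) \<psi> powr (1 - \<theta>)
                 * Lp_norm p (cyl T (ball 0 1)) (frac_dt \<alpha> p T (ball 0 1) \<psi>) powr \<theta>))
     \<and>
     (\<forall>q T. p \<le> 1 / \<alpha> \<and> 1 \<le> q \<and> q < p * (\<alpha> * p + 1) \<and> 0 < T \<longrightarrow>
        (p < q \<longrightarrow> 0 < 1 / \<alpha> * (1 / p - 1 / q) \<and> 1 / \<alpha> * (1 / p - 1 / q) < 1) \<and>
        (\<exists>N::real. \<forall>\<theta>.
           (if p < q then \<theta> = 1 / \<alpha> * (1 / p - 1 / q) else 0 \<le> \<theta> \<and> \<theta> < 1) \<longrightarrow>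
           (\<forall>\<psi>\<in>H0_space \<alpha> p T (ball (0::'a) 1).
              \<psi> \<in> Lp_space q (cyl T (ball 0 1)) \<and>
              Lp_norm q (cyl T (ball 0 1)) \<psi>
                \<le> N * W1_norm p T (ball 0 1) \<psi> powr (1 - \<theta>)
                    * Lp_norm p (cyl T (ball 0 1)) (frac_dt \<alpha> p T (ball 0 1) \<psi>) powr \<theta>)))"
proof (intro conjI allI impI)
  fix q \<theta> :: real
  assume a: "p < 1 / \<alpha> \<and> 1 < q \<and> p < q \<and> q \<le> p * (\<alpha> * p + 1) \<and> \<theta> = 1 / \<alpha> * (1 / p - 1 / q)"
  then have q: "p < q" "q \<le> p * (\<alpha> * p + 1)" "\<theta> = 1 / \<alpha> * (1 / p - 1 / q)" by auto
  note est = interpolation_estimate[OF assms q]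
  show "0 < \<theta>" "\<theta> < 1" by (fact est)+
  show "\<exists>N::real. \<forall>T>0. \<forall>\<psi>\<in>H0_space \<alpha> p T (ball (0::'a) 1).
           \<psi> \<in> Lp_space q (cyl T (ball 0 1)) \<and>
           Lp_norm q (cyl T (ball 0 1)) \<psi>
             \<le> N * W1_norm p T (ball 0 1) \<psi> powr (1 - \<theta>)
                 * Lp_norm p (cyl T (ball 0 1)) (frac_dt \<alpha> p T (ball 0 1) \<psi>) powr \<theta>"
    by (fact est)
next
  fix q T :: real
  assume a: "p \<le> 1 / \<alpha> \<and> 1 \<le> q \<and> q < p * (\<alpha> * p + 1) \<and> 0 < T"
  then have q': "q \<le> p * (\<alpha> * p + 1)" by simp
  note est = interpolation_estimate[OF assms _ q' refl]
  show "0 < 1 / \<alpha> * (1 / p - 1 / q)" "1 / \<alpha> * (1 / p - 1 / q) < 1" if "p < q" by (fact est[OF that])+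
  show "\<exists>N::real. \<forall>\<theta>.
           (if p < q then \<theta> = 1 / \<alpha> * (1 / p - 1 / q) else 0 \<le> \<theta> \<and> \<theta> < 1) \<longrightarrow>
           (\<forall>\<psi>\<in>H0_space \<alpha> p T (ball (0::'a) 1).
              \<psi> \<in> Lp_space q (cyl T (ball 0 1)) \<and>
              Lp_norm q (cyl T (ball 0 1)) \<psi>
                \<le> N * W1_norm p T (ball 0 1) \<psi> powr (1 - \<theta>)
                    * Lp_norm p (cyl T (ball 0 1)) (frac_dt \<alpha> p T (ball 0 1) \<psi>) powr \<theta>)"
  proof (cases "p < q")
    case True
    then show ?thesis using est(3)[OF True] a by auto
  next
    case False
    have "H0_space \<alpha> p T (ball (0::'a) 1) \<subseteq> H_space \<alpha> p T (ball 0 1)" by (auto simp: H0_space_def)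
    then show ?thesis
      using subcritical_estimate[OF assms(1-3), of q T, where 'a = 'a] a False by (auto simp: not_less subset_iff)
  qed
qed

end
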